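(* Let $\mathcal{C}$ be an $\omega$-category. The natural linear maps $h_n^-:C_n^{gl}(\mathcal{C})\to\mathbb{Z}\omega Cat(I^n,\mathcal{C})^-$ given by $h_n^-(x_n)=\square_n^-x_n$ on $\mathbb{Z}\mathcal{C}_n$ for $n\ge1$, and by $h_0^-(x_0,y_0)=x_0$ on $\mathbb{Z}\mathcal{C}_0\oplus\mathbb{Z}\mathcal{C}_0$, induce a natural linear map $H_n^{gl}(\mathcal{C})\to H_n^-(\mathcal{C})$ for every $n\geq 0$, from the globular homology of $\mathcal{C}$ to its negative corner homology.
   Context: An $\omega$-category is a set $A$ with maps $s_n=d_n^-$ and $t_n=d_n^+$ from $A$ to $A$ ($n\ge 0$) and partial binary operations $*_n$ ($n\ge 0$), where $x*_n y$ is defined exactly when $t_n x=s_n y$, such that for all $\alpha,\beta\in\{-,+\}$: (1) $d_m^\beta d_n^\alpha x=d_m^\beta x$ if $m<n$ and $d_m^\beta d_n^\alpha x=d_n^\alpha x$ if $m\ge n$; (2) $s_nx*_nx=x*_nt_nx=x$; (3) if $x*_ny$ is defined then $s_n(x*_ny)=s_nx$, $t_n(x*_ny)=t_ny$, and $d_m^\alpha(x*_ny)=d_m^\alpha x*_nd_m^\alpha y$ for $m\neq n$; (4) $(x*_ny)*_nz=x*_n(y*_nz)$ when both sides exist; (5) $(x*_ny)*_m(z*_nw)=(x*_mz)*_n(y*_mw)$ for $m\neq n$ when both sides make sense; (6) for every $x$ there is $n$ with $s_nx=t_nx=x$; the least such $n$ is the dimension $\dim(x)$. An $\omega$-functor preserves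 all $s_n,t_n,*_n$; $\omega Cat$ is the resulting category. $\mathcal{C}_n$ is the set of $n$-dimensional elements of $\mathcal{C}$; $\mathbb{Z}S$ is the free abelian group on $S$. An $\omega$-functor $f$ is non $1$-contracting if $f(x)$ is $1$-dimensional for every $1$-dimensional $x$; naturality is with respect to non $1$-contracting $\omega$-functors. Standing assumption: $s_nx$ and $t_nx$ are $n$-dimensional whenever $x$ is $(n+1)$-dimensional ($n\ge0$). Globular homology: $C_0^{gl}(\mathcal{C})=\mathbb{Z}\mathcal{C}_0\oplus\mathbb{Z}\mathcal{C}_0$, $C_n^{gl}(\mathcal{C})=\mathbb{Z}\mathcal{C}_n$ for $n\ge1$; $\partial^{gl}(x)=(s_0x,t_0x)$ for $x\in\mathbb{Z}\mathcal{C}_1$, and $\partial^{gl}(x)=s_nx-t_nx$ for $x\in\mathbb{Z}\mathcal{C}_{n+1}$, $n\ge1$. $H_*^{gl}(\mathcal{C})$ is its homology; a non $1$-contracting $f$ acts in degree $n\ge1$ by $x\mapsto f(x)$ if $\dim f(x)=n$, and $x\mapsto0$ otherwise. The $\omega$-category $I^n$ of the $n$-cube: let $\Lambda^n$ be the set of words $k_1\dots k_n$ in the alphabet $\{-,0,+\}$ (faces of the $n$-cube), the dimension being the number of zeros. For $x\in\Lambda^n$ of dimension $i$ and $y\in\Lambda^i$, let $r_y(x)$ be obtained by replacing the $\ell$-th zero of $x$ by $y(\ell)$ for all $\ell$. Write $b_y(x)=r_y(x)$ if $y(\ell)\ne0$ implies $y(\ell)=(-)^\ell$ (sign $-$ for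 $\ell$ odd, $+$ for $\ell$ even), and $e_y(x)=r_y(x)$ if $y(\ell)\neq0$ implies $y(\ell)=(-)^{\ell+1}$. For $X\subset\Lambda^n$ let $R(X)$ be the smallest subset containing $X$ and stable under all the operations $x\mapsto b_y(x)$, $x\mapsto e_y(x)$. $I^n$ is the unique $\omega$-category whose elements are subsets of $\Lambda^n$ of the form $R(X)$, including all $R(\{x\})$, $x\in\Lambda^n$; such that every element is a composite of elements $R(\{x\})$; for $x$ of dimension $p\ge1$, $s_{p-1}R(\{x\})=R(\{b_y(x):\dim y=p-1\})$ and $t_{p-1}R(\{x\})=R(\{e_y(x):\dim y=p-1\})$; and whenever $t_pR(X)=s_pR(Y)$, $R(X)*_pR(Y)=R(X\cup Y)$. It is freely generated by the faces of the $n$-cube. For $x\in\omega Cat(I^n,\mathcal{C})$ write $x(k_1\dots k_n)=x(R(\{k_1\dots k_n\}))$. Operations on the cubical singular nerve $\omega Cat(I^*,\mathcal{C})$: $\partial_i^\alpha(x)(k_1\dots k_{n-1})=x(k_1\dots k_{i-1}\,\alpha\,k_i\dots k_{n-1})$, $\epsilon_i(x)(k_1\dots k_{n+1})=x(k_1\dots\widehat{k_i}\dots k_{n+1})$, $\Gamma_i^-(x)(k_1\dots k_{n+1})=x(k_1\dots\max(k_i,k_{i+1})\dots k_{n+1})$ with $-<0<+$. Degenerate means in the image of some $\epsilon_i$. Negative corner homology: $\omega Cat(I^n,\mathcal{C})^-$ is the set of non degenerate $x\in\omega Cat(I^n,\mathcal{C})$ all of whose iterated faces $\partial^-_{i_1}\cdots\partial^-_{i_p}(x)$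 are non degenerate. With $\partial^-=\sum_i(-1)^{i+1}\partial_i^-$, $H_*^-(\mathcal{C})=H_*(\mathbb{Z}\omega Cat(I^*,\mathcal{C})^-,\partial^-)$. The maps $\square_n^-$: for $x\in\mathcal{C}_1$, $\square_1^-(x)\in\omega Cat(I^1,\mathcal{C})$ has values $s_0x,x,t_0x$ at $-,0,+$. For $n\ge2$ and $x\in\mathcal{C}_n$, $\square_n^-(x)$ is the unique element of $\omega Cat(I^n,\mathcal{C})$ with $\square_n^-(x)(0\dots0)=x$, $\partial_i^\pm\square_n^-(x)=\Gamma_{n-2}^-\partial_i^\pm\square_{n-1}^-s_{n-1}(x)$ for $1\le i\le n-2$, and, for $n-1\le i\le n$, $\partial_i^-\square_n^-(x)=\square_{n-1}^-d_{n-1}^{(-)^i}(x)$ and $\partial_i^+\square_n^-(x)=\epsilon_{n-1}\partial_{n-1}^+\square_{n-1}^-s_{n-1}(x)$. It is extended by linearity. Meaning of "induce": let $D_0^-(\mathcal{C})=D_1^-(\mathcal{C})=0$ and, for $n\ge2$, let $D_n^-(\mathcal{C})\subset\mathbb{Z}\omega Cat(I^n,\mathcal{C})^-$ be the subgroup generated by the elements $\Gamma_i^-(y)$ with $y\in\omega Cat(I^{n-1},\mathcal{C})^-$, $1\le i\le n-1$; $D_*^-(\mathcal{C})$ is a subcomplex. The $h_n^-$ define a chain map from $C_*^{gl}(\mathcal{C})$ to $\mathbb{Z}\omega Cat(I^*,\mathcal{C})^-/D_*^-(\mathcal{C})$; the induced map $H_n^{gl}(\mathcal{C})\to H_n^-(\mathcal{C})$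 is the one whose composite with the map on homology induced by the projection $\mathbb{Z}\omega Cat(I^*,\mathcal{C})^-\to\mathbb{Z}\omega Cat(I^*,\mathcal{C})^-/D_*^-(\mathcal{C})$ (an isomorphism on homology) is the map on homology given by this chain map.
   Formalization: The maps h_n^- commute strictly with f only on n-dimensional x with dim f(x)=n; in general they commute modulo the subgroup D_n^- generated by the Γ_i^-(y), since strict naturality fails when f lowers dimension. The map on homology is strictly natural. *)

theory Defs
  imports "HOL-Algebra.Free_Abelian_Groups" "HOL-Algebra.Generated_Groups"
begin

section \<open>Omega-categories\<close>

text \<open>
  Signs are the integers \<open>-1\<close> and \<open>1\<close>, so that the sign \<open>(-)^i\<close> is literally \<open>(-1) ^ i\<close>.
  \<open>bd C \<alpha> n\<close> is the map \<open>d_n^\<alpha>\<close>. The operation \<open>cmp C n x y\<close> is only meaningful if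
  \<open>tgt C n x = src C n y\<close>; its other values are junk and are never used.
\<close>

record 'a omega_cat = "'a partial_object" +
  bd :: "int \<Rightarrow> nat \<Rightarrow> 'a \<Rightarrow> 'a"
  cmp :: "nat \<Rightarrow> 'a \<Rightarrow> 'a \<Rightarrow> 'a"

abbreviation signs :: "int set" where
  "signs \<equiv> {-1, 1}"

abbreviation src :: "'a omega_cat \<Rightarrow> nat \<Rightarrow> 'a \<Rightarrow> 'a" where
  "src C \<equiv> bd C (-1)"

abbreviation tgt :: "'a omega_cat \<Rightarrow> nat \<Rightarrow> 'a \<Rightarrow> 'a" where
  "tgt C \<equiv> bd C 1"

definition composable :: "'a omega_cat \<Rightarrow> nat \<Rightarrow> 'a \<Rightarrow> 'a \<Rightarrow> bool" where
  "composable C n x y \<longleftrightarrow> x \<in> carrier C \<and> y \<in> carrier C \<and> tgt C n x = src C n y"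

locale omega_category =
  fixes C :: "'a omega_cat"
  assumes bd_closed: "\<lbrakk>x \<in> carrier C; \<alpha> \<in> signs\<rbrakk> \<Longrightarrow> bd C \<alpha> n x \<in> carrier C"
    and cmp_closed: "composable C n x y \<Longrightarrow> cmp C n x y \<in> carrier C"
    and bd_bd_less:
      "\<lbrakk>x \<in> carrier C; \<alpha> \<in> signs; \<beta> \<in> signs; m < n\<rbrakk> \<Longrightarrow> bd C \<beta> m (bd C \<alpha> n x) = bd C \<beta> m x"
    and bd_bd_ge:
      "\<lbrakk>x \<in> carrier C; \<alpha> \<in> signs; \<beta> \<in> signs; m \<ge> n\<rbrakk> \<Longrightarrow> bd C \<beta> m (bd C \<alpha> n x) = bd C \<alpha> n x"
    and cmp_src: "x \<in> carrier C \<Longrightarrow> cmp C n (src C n x) x = x"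
    and cmp_tgt: "x \<in> carrier C \<Longrightarrow> cmp C n x (tgt C n x) = x"
    and src_cmp: "composable C n x y \<Longrightarrow> src C n (cmp C n x y) = src C n x"
    and tgt_cmp: "composable C n x y \<Longrightarrow> tgt C n (cmp C n x y) = tgt C n y"
    and bd_cmp:
      "\<lbrakk>composable C n x y; \<alpha> \<in> signs; m \<noteq> n\<rbrakk>
        \<Longrightarrow> bd C \<alpha> m (cmp C n x y) = cmp C n (bd C \<alpha> m x) (bd C \<alpha> m y)"
    and cmp_assoc:
      "\<lbrakk>composable C n x y; composable C n (cmp C n x y) z;
        composable C n y z; composable C n x (cmp C n y z)\<rbrakk>
        \<Longrightarrow> cmp C n (cmp C n x y) z = cmp C n x (cmp C n y z)"
    and interchange:
      "\<lbrakk>m \<noteq> n; composable C n x y; composable C n z w; composable C m (cmp C n x y) (cmp C n z w);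
        composable C m x z; composable C m y w; composable C n (cmp C m x z) (cmp C m y w)\<rbrakk>
        \<Longrightarrow> cmp C m (cmp C n x y) (cmp C n z w) = cmp C n (cmp C m x z) (cmp C m y w)"
    and finite_dimensional: "x \<in> carrier C \<Longrightarrow> \<exists>n. src C n x = x \<and> tgt C n x = x"

definition cell_dim :: "'a omega_cat \<Rightarrow> 'a \<Rightarrow> nat" where
  "cell_dim C x = (LEAST n. src C n x = x \<and> tgt C n x = x)"

definition cells :: "'a omega_cat \<Rightarrow> nat \<Rightarrow> 'a set" where
  "cells C n = {x \<in> carrier C. cell_dim C x = n}"

definition bd_lowers_dim :: "'a omega_cat \<Rightarrow> bool" where
  "bd_lowers_dim C \<longleftrightarrow>
    (\<forall>n. \<forall>x \<in> cells C (Suc n). src C n x \<in> cells C n \<and> tgt C n x \<in> cells C n)"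

definition omega_functor :: "'a omega_cat \<Rightarrow> 'b omega_cat \<Rightarrow> ('a \<Rightarrow> 'b) \<Rightarrow> bool" where
  "omega_functor C D f \<longleftrightarrow>
    f \<in> carrier C \<rightarrow> carrier D \<and>
    (\<forall>x \<in> carrier C. \<forall>n. \<forall>\<alpha> \<in> signs. f (bd C \<alpha> n x) = bd D \<alpha> n (f x)) \<and>
    (\<forall>n x y. composable C n x y \<longrightarrow> f (cmp C n x y) = cmp D n (f x) (f y))"

definition non_1_contracting :: "'a omega_cat \<Rightarrow> 'b omega_cat \<Rightarrow> ('a \<Rightarrow> 'b) \<Rightarrow> bool" where
  "non_1_contracting C D f \<longleftrightarrow> (\<forall>x \<in> cells C 1. f x \<in> cells D 1)"

section \<open>The omega-category of the n-cube\<close>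

text \<open>Faces of the cube are words over \<open>-1, 0, 1\<close>, which has the order \<open>- < 0 < +\<close>.\<close>

definition words :: "nat \<Rightarrow> int list set" where
  "words n = {k. length k = n \<and> set k \<subseteq> {-1, 0, 1}}"

definition word_dim :: "int list \<Rightarrow> nat" where
  "word_dim k = length (filter (\<lambda>a. a = 0) k)"

text \<open>\<open>subst_zeros x y\<close> is \<open>r_y(x)\<close>: the l-th zero of \<open>x\<close> is replaced by the l-th letter of \<open>y\<close>.\<close>

fun subst_zeros :: "int list \<Rightarrow> int list \<Rightarrow> int list" where
  "subst_zeros (k # ks) (y # ys) =
    (if k = 0 then y # subst_zeros ks ys else k # subst_zeros ks (y # ys))"
| "subst_zeros ks [] = ks"
| "subst_zeros [] ys = []"

text \<open>
  \<open>b_words i\<close> and \<open>e_words i\<close> are the words \<open>y\<close> of length \<open>i\<close> for which \<open>b_y\<close> and \<open>e_y\<close> are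
  defined on faces of dimension \<open>i\<close>. Letters are numbered from 1, list positions from 0.
\<close>

definition b_words :: "nat \<Rightarrow> int list set" where
  "b_words i = {y \<in> words i. \<forall>l \<in> {1..i}. y ! (l - 1) \<noteq> 0 \<longrightarrow> y ! (l - 1) = (-1) ^ l}"

definition e_words :: "nat \<Rightarrow> int list set" where
  "e_words i = {y \<in> words i. \<forall>l \<in> {1..i}. y ! (l - 1) \<noteq> 0 \<longrightarrow> y ! (l - 1) = (-1) ^ (l + 1)}"

inductive_set R :: "int list set \<Rightarrow> int list set" for X where
  base: "x \<in> X \<Longrightarrow> x \<in> R X"
| b: "x \<in> R X \<Longrightarrow> y \<in> b_words (word_dim x) \<Longrightarrow> subst_zeros x y \<in> R X"
| e: "x \<in> R X \<Longrightarrow> y \<in> e_words (word_dim x) \<Longrightarrow> subst_zeros x y \<in> R X"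

inductive_set composites :: "'a omega_cat \<Rightarrow> 'a set \<Rightarrow> 'a set" for C S where
  base: "x \<in> S \<Longrightarrow> x \<in> composites C S"
| cmp: "x \<in> composites C S \<Longrightarrow> y \<in> composites C S \<Longrightarrow> composable C p x y
    \<Longrightarrow> cmp C p x y \<in> composites C S"

text \<open>
  The clause saying that \<open>s_p\<close> and \<open>t_p\<close> fix \<open>R {x}\<close> for \<open>x\<close> of dimension \<open>p\<close> only makes explicit
  that a p-dimensional face of the cube is a generator of dimension \<open>p\<close>.
\<close>

definition is_cube_cat :: "nat \<Rightarrow> int list set omega_cat \<Rightarrow> bool" where
  "is_cube_cat n I \<longleftrightarrow>
    omega_category I \<and>
    carrier I \<subseteq> {R X | X. X \<subseteq> words n} \<and>
    (\<forall>x \<in> words n. R {x} \<in> carrier I) \<and>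
    carrier I \<subseteq> composites I {R {x} | x. x \<in> words n} \<and>
    (\<forall>x \<in> words n. \<forall>\<alpha> \<in> signs. bd I \<alpha> (word_dim x) (R {x}) = R {x}) \<and>
    (\<forall>x \<in> words n. \<forall>p. word_dim x = Suc p \<longrightarrow>
      src I p (R {x}) = R {subst_zeros x y | y. y \<in> b_words (Suc p) \<and> word_dim y = p} \<and>
      tgt I p (R {x}) = R {subst_zeros x y | y. y \<in> e_words (Suc p) \<and> word_dim y = p}) \<and>
    (\<forall>X Y p. X \<subseteq> words n \<longrightarrow> Y \<subseteq> words n \<longrightarrow> composable I p (R X) (R Y) \<longrightarrow>
      cmp I p (R X) (R Y) = R (X \<union> Y))"

text \<open>
  The properties above determine the elements of \<open>I^n\<close> and its operations on them; the choice
  operator only selects junk values (boundaries of non-elements, composites of non-composable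
  elements).
\<close>

definition cube_cat :: "nat \<Rightarrow> int list set omega_cat" where
  "cube_cat n = (SOME I. is_cube_cat n I)"

section \<open>The cubical singular nerve\<close>

text \<open>\<open>nerve C n\<close> is \<open>\<omega>Cat(I^n, C)\<close>; functors are extensional, so that equality is the intended one.\<close>

type_synonym 'a cube = "int list set \<Rightarrow> 'a"

definition nerve :: "'a omega_cat \<Rightarrow> nat \<Rightarrow> 'a cube set" where
  "nerve C n = {x \<in> extensional (carrier (cube_cat n)). omega_functor (cube_cat n) C x}"

text \<open>An omega-functor on \<open>I^n\<close> is determined by its values \<open>v k\<close> on the faces \<open>k\<close> of the cube.\<close>

definition cube_with_values :: "'a omega_cat \<Rightarrow> nat \<Rightarrow> (int list \<Rightarrow> 'a) \<Rightarrow> 'a cube" where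
  "cube_with_values C n v = (THE x. x \<in> nerve C n \<and> (\<forall>k \<in> words n. x (R {k}) = v k))"

text \<open>In the next three definitions \<open>x\<close> is an n-cube and \<open>i\<close> counts from 1.\<close>

definition face :: "'a omega_cat \<Rightarrow> nat \<Rightarrow> nat \<Rightarrow> int \<Rightarrow> 'a cube \<Rightarrow> 'a cube" where
  "face C n i \<alpha> x =
    cube_with_values C (n - 1) (\<lambda>k. x (R {take (i - 1) k @ [\<alpha>] @ drop (i - 1) k}))"

definition degeneracy :: "'a omega_cat \<Rightarrow> nat \<Rightarrow> nat \<Rightarrow> 'a cube \<Rightarrow> 'a cube" where
  "degeneracy C n i x =
    cube_with_values C (n + 1) (\<lambda>k. x (R {take (i - 1) k @ drop i k}))"

definition connection :: "'a omega_cat \<Rightarrow> nat \<Rightarrow> nat \<Rightarrow> 'a cube \<Rightarrow> 'a cube" where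
  "connection C n i x =
    cube_with_values C (n + 1)
      (\<lambda>k. x (R {take (i - 1) k @ [max (k ! (i - 1)) (k ! i)] @ drop (i + 1) k}))"

definition degenerate :: "'a omega_cat \<Rightarrow> nat \<Rightarrow> 'a cube \<Rightarrow> bool" where
  "degenerate C n x \<longleftrightarrow>
    (\<exists>m i y. n = Suc m \<and> i \<in> {1..n} \<and> y \<in> nerve C m \<and> x = degeneracy C m i y)"

text \<open>\<open>neg_face C n x m y\<close>: the m-cube \<open>y\<close> is an iterated negative face of the n-cube \<open>x\<close>.\<close>

inductive neg_face :: "'a omega_cat \<Rightarrow> nat \<Rightarrow> 'a cube \<Rightarrow> nat \<Rightarrow> 'a cube \<Rightarrow> bool" for C n x where
  refl: "neg_face C n x n x"
| step: "neg_face C n x (Suc m) y \<Longrightarrow> i \<in> {1..Suc m} \<Longrightarrow> neg_face C n x m (face C (Suc m) i (-1) y)"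

definition neg_nerve :: "'a omega_cat \<Rightarrow> nat \<Rightarrow> 'a cube set" where
  "neg_nerve C n = {x \<in> nerve C n. \<forall>m y. neg_face C n x m y \<longrightarrow> \<not> degenerate C m y}"

definition nerve_map :: "nat \<Rightarrow> ('a \<Rightarrow> 'b) \<Rightarrow> 'a cube \<Rightarrow> 'b cube" where
  "nerve_map n f x = restrict (f \<circ> x) (carrier (cube_cat n))"

section \<open>Chain complexes of abelian groups\<close>

record 'c complex_data =
  grp :: "nat \<Rightarrow> 'c monoid"
  bdry :: "nat \<Rightarrow> 'c \<Rightarrow> 'c"

definition cycles :: "'c complex_data \<Rightarrow> nat \<Rightarrow> 'c set" where
  "cycles K n =
    (if n = 0 then carrier (grp K 0) else kernel (grp K n) (grp K (n - 1)) (bdry K n))"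

definition boundaries :: "'c complex_data \<Rightarrow> nat \<Rightarrow> 'c set" where
  "boundaries K n = bdry K (Suc n) ` carrier (grp K (Suc n))"

definition homology :: "'c complex_data \<Rightarrow> nat \<Rightarrow> 'c set monoid" where
  "homology K n = (grp K n)\<lparr>carrier := cycles K n\<rparr> Mod boundaries K n"

definition chain_map :: "'c complex_data \<Rightarrow> 'd complex_data \<Rightarrow> (nat \<Rightarrow> 'c \<Rightarrow> 'd) \<Rightarrow> bool" where
  "chain_map K L f \<longleftrightarrow>
    (\<forall>n. f n \<in> hom (grp K n) (grp L n)) \<and>
    (\<forall>n. \<forall>c \<in> carrier (grp K (Suc n)). f n (bdry K (Suc n) c) = bdry L (Suc n) (f (Suc n) c))"

text \<open>
  If \<open>f\<close> sends the subgroup \<open>N\<close> into \<open>N'\<close>, then \<open>N' <#> f ` (N + c) = N' + f c\<close>. This describes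
  the map induced by \<open>f\<close> on homology and the differential of a quotient complex.
\<close>

definition homology_map :: "'d complex_data \<Rightarrow> nat \<Rightarrow> ('c \<Rightarrow> 'd) \<Rightarrow> 'c set \<Rightarrow> 'd set" where
  "homology_map L n f U = boundaries L n <#>\<^bsub>grp L n\<^esub> (f ` U)"

definition quotient_complex ::
  "'c complex_data \<Rightarrow> (nat \<Rightarrow> 'c set) \<Rightarrow> 'c set complex_data" where
  "quotient_complex K N =
    \<lparr>grp = (\<lambda>n. grp K n Mod N n),
     bdry = (\<lambda>n U. N (n - 1) <#>\<^bsub>grp K (n - 1)\<^esub> (bdry K n ` U))\<rparr>"

definition quotient_proj ::
  "'c complex_data \<Rightarrow> (nat \<Rightarrow> 'c set) \<Rightarrow> nat \<Rightarrow> 'c \<Rightarrow> 'c set" where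
  "quotient_proj K N n c = N n #>\<^bsub>grp K n\<^esub> c"

section \<open>Globular homology\<close>

text \<open>
  So that all degrees live in one type, chains are pairs, the second component being trivial
  in positive degrees.
\<close>

definition gl_complex :: "'a omega_cat \<Rightarrow> (('a \<Rightarrow>\<^sub>0 int) \<times> ('a \<Rightarrow>\<^sub>0 int)) complex_data" where
  "gl_complex C =
    \<lparr>grp = (\<lambda>n. free_Abelian_group (cells C n) \<times>\<times>
                free_Abelian_group (if n = 0 then cells C 0 else {})),
     bdry = (\<lambda>n (c, _).
       if n = 0 then (0, 0)
       else if n = 1 then
         (frag_extend (\<lambda>x. frag_of (src C 0 x)) c, frag_extend (\<lambda>x. frag_of (tgt C 0 x)) c)
       else
         (frag_extend (\<lambda>x. frag_of (src C (n - 1) x) - frag_of (tgt C (n - 1) x)) c, 0))\<rparr>"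

definition gl_map :: "'b omega_cat \<Rightarrow> nat \<Rightarrow> ('a \<Rightarrow> 'b) \<Rightarrow>
    ('a \<Rightarrow>\<^sub>0 int) \<times> ('a \<Rightarrow>\<^sub>0 int) \<Rightarrow> ('b \<Rightarrow>\<^sub>0 int) \<times> ('b \<Rightarrow>\<^sub>0 int)" where
  "gl_map D n f =
    map_prod (frag_extend (\<lambda>x. if cell_dim D (f x) = n then frag_of (f x) else 0))
             (frag_extend (\<lambda>x. if cell_dim D (f x) = n then frag_of (f x) else 0))"

section \<open>Negative corner homology\<close>

definition corner_complex :: "'a omega_cat \<Rightarrow> ('a cube \<Rightarrow>\<^sub>0 int) complex_data" where
  "corner_complex C =
    \<lparr>grp = (\<lambda>n. free_Abelian_group (neg_nerve C n)),
     bdry = (\<lambda>n. frag_extend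
       (\<lambda>x. \<Sum>i = 1..n. frag_cmul ((-1) ^ (i + 1)) (frag_of (face C n i (-1) x))))\<rparr>"

text \<open>
  If \<open>f\<close> is non 1-contracting, composition with \<open>f\<close> maps \<open>neg_nerve C n\<close> to \<open>neg_nerve D n\<close>:
  the edges of such a cube at its initial corner have dimension 1, whereas a degenerate cube
  has a 0-dimensional one. So no generator has to be sent to 0.
\<close>

definition corner_map :: "nat \<Rightarrow> ('a \<Rightarrow> 'b) \<Rightarrow> ('a cube \<Rightarrow>\<^sub>0 int) \<Rightarrow> ('b cube \<Rightarrow>\<^sub>0 int)" where
  "corner_map n f = frag_extend (\<lambda>x. frag_of (nerve_map n f x))"

definition D_minus :: "'a omega_cat \<Rightarrow> nat \<Rightarrow> ('a cube \<Rightarrow>\<^sub>0 int) set" where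
  "D_minus C n = generate (free_Abelian_group (neg_nerve C n))
    {frag_of (connection C (n - 1) i y) | i y. n \<ge> 2 \<and> i \<in> {1..n - 1} \<and> y \<in> neg_nerve C (n - 1)}"

section \<open>From globular to negative corner homology\<close>

text \<open>
  In degree 0, \<open>box_minus\<close> is the identification of 0-dimensional elements with functors on \<open>I^0\<close>.
  The last equation defines the n-cube for \<open>n = m + 2\<close>.
\<close>

fun box_minus :: "'a omega_cat \<Rightarrow> nat \<Rightarrow> 'a \<Rightarrow> 'a cube" where
  "box_minus C 0 x = cube_with_values C 0 (\<lambda>_. x)"
| "box_minus C (Suc 0) x =
    (THE z. z \<in> nerve C 1 \<and>
      z (R {[-1]}) = src C 0 x \<and> z (R {[0]}) = x \<and> z (R {[1]}) = tgt C 0 x)"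
| "box_minus C (Suc (Suc m)) x =
    (THE z. z \<in> nerve C (m + 2) \<and>
      z (R {replicate (m + 2) 0}) = x \<and>
      (\<forall>i \<in> {1..m}. \<forall>\<alpha> \<in> signs.
        face C (m + 2) i \<alpha> z =
          connection C m m (face C (m + 1) i \<alpha> (box_minus C (Suc m) (src C (m + 1) x)))) \<and>
      (\<forall>i \<in> {m + 1..m + 2}.
        face C (m + 2) i (-1) z = box_minus C (Suc m) (bd C ((-1) ^ i) (m + 1) x) \<and>
        face C (m + 2) i 1 z =
          degeneracy C m (m + 1)
            (face C (m + 1) (m + 1) 1 (box_minus C (Suc m) (src C (m + 1) x)))))"

definition h_minus ::
  "'a omega_cat \<Rightarrow> nat \<Rightarrow> ('a \<Rightarrow>\<^sub>0 int) \<times> ('a \<Rightarrow>\<^sub>0 int) \<Rightarrow> ('a cube \<Rightarrow>\<^sub>0 int)" where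
  "h_minus C n c = frag_extend (\<lambda>x. frag_of (box_minus C n x)) (fst c)"

definition reduced_complex :: "'a omega_cat \<Rightarrow> ('a cube \<Rightarrow>\<^sub>0 int) set complex_data" where
  "reduced_complex C = quotient_complex (corner_complex C) (D_minus C)"

definition reduction :: "'a omega_cat \<Rightarrow> nat \<Rightarrow> ('a cube \<Rightarrow>\<^sub>0 int) \<Rightarrow> ('a cube \<Rightarrow>\<^sub>0 int) set" where
  "reduction C = quotient_proj (corner_complex C) (D_minus C)"

definition induced_by_h_minus :: "'a omega_cat \<Rightarrow> nat \<Rightarrow>
    ((('a \<Rightarrow>\<^sub>0 int) \<times> ('a \<Rightarrow>\<^sub>0 int)) set \<Rightarrow> ('a cube \<Rightarrow>\<^sub>0 int) set) \<Rightarrow> bool" where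
  "induced_by_h_minus C n \<phi> \<longleftrightarrow>
    \<phi> \<in> hom (homology (gl_complex C) n) (homology (corner_complex C) n) \<and>
    \<phi> \<in> extensional (carrier (homology (gl_complex C) n)) \<and>
    (\<forall>z \<in> carrier (homology (gl_complex C) n).
      homology_map (reduced_complex C) n (reduction C n) (\<phi> z) =
      homology_map (reduced_complex C) n (reduction C n \<circ> h_minus C n) z)"

end

theory Submission
  imports Defs
begin

text \<open>
  The omega-category of the cube is realised inside Steiner's omega-category of tables of chains,
  whose operations are given by addition, so that the axioms are linear identities. Projecting a
  table to the directions of one face shows that it is determined by its set of cells; splitting
  off atoms in the order of a weight on words shows that every table is a composite of atoms. A
  functor on the cube then only has to be checked on the top-dimensional boundaries of the
  generators.

  The cube \<open>\<box>\<^sub>n\<^sup>-(x)\<close> factors through the infinite globe, which gives its faces in closed form and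
  makes \<open>h\<^sup>-\<close> a chain map modulo connections. The negative faces and the connections \<open>\<Gamma>\<^sup>-\<close> satisfy the
  simplicial identities on the cubes whose initial edges are not degenerate. Hence the subcomplex
  generated by the connections is acyclic, by the argument of the normalization theorem for
  simplicial abelian groups, and a chain map into the quotient induces a unique map into the
  homology of the corner complex. If a functor lowers the dimension of \<open>x\<close>, it sends \<open>\<box>\<^sub>n\<^sup>-(x)\<close> to a
  connection, which gives naturality.
\<close>

section \<open>Faces of the cube\<close>

text \<open>The elements of \<open>cube_cat\<close> are sets of faces, and such a set does not
  display the signs that decide which composites exist. Tables keep these signs, so that boundaries
  and composites become formulas; the price is to show that nothing is lost in passing back to sets.
  The constants \<open>cube_with_values\<close> and \<open>box_minus\<close> are definite
  descriptions, hence each needs existence and uniqueness of a functor. Uniqueness holds because the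
  faces generate. Existence always comes from an explicit formula on arbitrary sets of words: the
  closure under \<open>R\<close> of the image under a map of words yields faces, degeneracies and
  connections, and the largest code in a set yields the map to the globe. Membership in
  \<open>neg_nerve\<close> speaks of all iterated negative faces. It amounts to the n edges at the
  corner (-,...,-) not being 0-dimensional. In this form it passes to negative faces, to
  connections, and to images under non 1-contracting functors, which is where that notion
  enters.\<close>

lemma word_dim_simps [simp]:
  "word_dim [] = 0"
  "word_dim (a # k) = (if a = 0 then Suc (word_dim k) else word_dim k)"
  by (auto simp: word_dim_def)

lemma words_0 [simp]: "words 0 = {[]}"
  by (auto simp: words_def)

lemma Nil_in_words [simp]: "[] \<in> words n \<longleftrightarrow> n = 0"
  by (auto simp: words_def)

lemma Cons_in_words [simp]:
  "a # k \<in> words (Suc n) \<longleftrightarrow> (a = -1 \<or> a = 0 \<or> a = 1) \<and> k \<in> words n"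
  by (auto simp: words_def)

lemma words_Suc: "words (Suc n) = (#) (-1) ` words n \<union> (#) 0 ` words n \<union> (#) 1 ` words n"
proof -
  have "k \<in> (#) (-1) ` words n \<union> (#) 0 ` words n \<union> (#) 1 ` words n" if "k \<in> words (Suc n)" for k
    using that by (cases k) auto
  then show ?thesis by auto
qed

lemma finite_words [simp]: "finite (words n)"
  by (induction n) (auto simp: words_Suc)

lemma length_words: "k \<in> words n \<Longrightarrow> length k = n"
  by (simp add: words_def)

lemma word_dim_le_length: "word_dim k \<le> length k"
  by (simp add: word_dim_def)

lemma word_dim_replicate [simp]: "word_dim (replicate n 0) = n"
  by (induction n) auto

lemma replicate_in_words [simp]: "replicate n 0 \<in> words n"
  by (auto simp: words_def)

text \<open>The inclusion order of the faces of the cube; \<open>R_iff\<close> identifies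
  \<open>R X\<close> with the down-closure of \<open>X\<close> in this order.\<close>

fun subface :: "int list \<Rightarrow> int list \<Rightarrow> bool" where
  "subface [] [] = True"
| "subface (a # k) (b # m) = ((a = b \<or> b = 0 \<and> (a = -1 \<or> a = 1)) \<and> subface k m)"
| "subface _ _ = False"

lemma subface_refl [simp]: "subface k k"
  by (induction k) auto

lemma subface_length: "subface k m \<Longrightarrow> length k = length m"
  by (induction k m rule: subface.induct) auto

lemma subface_words: "subface k m \<Longrightarrow> m \<in> words n \<Longrightarrow> k \<in> words n"
  by (induction k m arbitrary: n rule: subface.induct) (auto simp: words_def)

lemma subface_dim: "subface k m \<Longrightarrow> word_dim k \<le> word_dim m"
  by (induction k m rule: subface.induct) auto

lemma subface_dim_eq: "subface k m \<Longrightarrow> word_dim k = word_dim m \<Longrightarrow> k = m"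
proof (induction k m rule: subface.induct)
  case (2 a k b m)
  then show ?case using subface_dim[of k m] by (auto split: if_splits)
qed auto

lemma subface_trans: "subface k m \<Longrightarrow> subface m l \<Longrightarrow> subface k l"
proof (induction k m arbitrary: l rule: subface.induct)
  case (2 a k b m)
  then show ?case by (cases l) auto
qed (auto elim: subface.elims)

text \<open>
  \<open>atom_cell \<alpha> m k\<close> says that the face \<open>k\<close> occurs in the iterated boundary \<open>d_j^\<alpha>\<close> of the face
  \<open>m\<close> for \<open>j = dim k\<close>: a letter that replaces a zero of \<open>m\<close> has the sign \<open>\<alpha> (-)^z\<close>, where \<open>z\<close>
  counts the zeros before it that are retained.
\<close>

fun atom_cell :: "int \<Rightarrow> int list \<Rightarrow> int list \<Rightarrow> bool" where
  "atom_cell \<alpha> [] [] = True"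
| "atom_cell \<alpha> (a # m) (b # k) =
    (if a = 0 then b = 0 \<and> atom_cell (-\<alpha>) m k \<or> b = \<alpha> \<and> atom_cell \<alpha> m k
     else b = a \<and> atom_cell \<alpha> m k)"
| "atom_cell _ _ _ = False"

lemma signs_uminus: "\<alpha> \<in> signs \<Longrightarrow> -\<alpha> \<in> signs"
  by auto

lemma atom_cell_refl [simp]: "atom_cell \<alpha> m m"
  by (induction m arbitrary: \<alpha>) auto

lemma atom_cell_subface: "atom_cell \<alpha> m k \<Longrightarrow> \<alpha> \<in> signs \<Longrightarrow> subface k m"
proof (induction \<alpha> m k rule: atom_cell.induct)
  case (2 \<alpha> a m b k)
  then show ?case using signs_uminus[of \<alpha>] by (auto split: if_splits)
qed auto

text \<open>The zeros before the first replaced zero are all retained, so the letter put there is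
  \<alpha> (-)^z with a fixed z, and the two values of \<alpha> contradict each other. Hence no zero
  is replaced.\<close>

lemma atom_cell_disjoint: "atom_cell \<alpha> m k \<Longrightarrow> atom_cell (-\<alpha>) m k \<Longrightarrow> \<alpha> \<in> signs \<Longrightarrow> k = m"
proof (induction \<alpha> m k rule: atom_cell.induct)
  case (2 \<alpha> a m b k)
  then show ?case using signs_uminus[of \<alpha>] by (auto split: if_splits)
qed auto

text \<open>In codimension 1 a single letter is replaced, and its sign tells to which of the two
  boundaries the face belongs.\<close>

lemma atom_cell_facet:
  "subface k m \<Longrightarrow> word_dim m = Suc (word_dim k) \<Longrightarrow> \<alpha> \<in> signs
    \<Longrightarrow> atom_cell \<alpha> m k \<or> atom_cell (-\<alpha>) m k"
proof (induction k m arbitrary: \<alpha> rule: subface.induct)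
  case (2 a k b m)
  have sub: "subface k m" and d: "a = b \<or> b = 0 \<and> (a = -1 \<or> a = 1)" using 2 by auto
  consider "b \<noteq> 0" "a = b" | "b = 0" "a = 0" | "b = 0" "a = -1 \<or> a = 1" using d by blast
  then show ?case
  proof cases
    case 1
    then show ?thesis using 2(1)[of \<alpha>] 2(3,4) sub by simp
  next
    case c: 2
    then show ?thesis using 2(1)[of "-\<alpha>"] 2(3,4) sub by auto
  next
    case 3
    then have "k = m" using 2(3) subface_dim_eq[OF sub] by auto
    then show ?thesis using 3 2(4) by auto
  qed
qed auto

text \<open>Put back the last replaced zero: the counts of retained zeros for the other replaced
  letters do not change.\<close>

lemma atom_cell_coface:
  "atom_cell \<beta> a k \<Longrightarrow> \<beta> \<in> signs \<Longrightarrow> word_dim k < word_dim a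
    \<Longrightarrow> \<exists>m. subface k m \<and> word_dim m = Suc (word_dim k) \<and> atom_cell \<beta> a m"
proof (induction \<beta> a k rule: atom_cell.induct)
  case (2 \<beta> a m b k)
  note IH = 2
  show ?case
  proof (cases "a = 0")
    case False
    then have "b = a" "atom_cell \<beta> m k" "word_dim k < word_dim m" using IH by auto
    then obtain u where "subface k u" "word_dim u = Suc (word_dim k)" "atom_cell \<beta> m u"
      using IH False by auto
    then show ?thesis using False \<open>b = a\<close> by (intro exI[of _ "a # u"]) auto
  next
    case True
    show ?thesis
    proof (cases "b = 0")
      case b: True
      then have "atom_cell (-\<beta>) m k" "word_dim k < word_dim m" using IH True by auto
      then obtain u where "subface k u" "word_dim u = Suc (word_dim k)" "atom_cell (-\<beta>) m u"
        using IH(1) True signs_uminus IH(5) IH by blast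
      then show ?thesis using True b by (intro exI[of _ "0 # u"]) auto
    next
      case b: False
      then have b: "b \<noteq> 0" "b = \<beta>" "atom_cell \<beta> m k" using IH True by auto
      show ?thesis
      proof (cases "word_dim k < word_dim m")
        case t: True
        then obtain u where "subface k u" "word_dim u = Suc (word_dim k)" "atom_cell \<beta> m u"
          using IH(2) True IH b by blast
        then show ?thesis using True b by (intro exI[of _ "b # u"]) auto
      next
        case False
        then have "k = m"
          using subface_dim subface_dim_eq atom_cell_subface[OF b(3)] IH(5)
          by (metis IH(5) linorder_neqE_nat not_le \<open>\<beta> \<in> signs\<close>)
        then show ?thesis using True b \<open>\<beta> \<in> signs\<close> by (intro exI[of _ "0 # m"]) auto
      qed
    qed
  qed
qed auto

text \<open>Keep only the first replaced letter of \<open>k\<close>. The zeros before it are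
  retained in \<open>k\<close> as well, so it has the same sign in the facet.\<close>

lemma atom_cell_same_coface:
  "atom_cell \<alpha> a k \<Longrightarrow> \<alpha> \<in> signs \<Longrightarrow> word_dim k < word_dim a
    \<Longrightarrow> \<exists>m. atom_cell \<alpha> a m \<and> word_dim a = Suc (word_dim m) \<and> subface k m"
proof (induction \<alpha> a k rule: atom_cell.induct)
  case (2 \<alpha> a m b k)
  show ?case
  proof (cases "a = 0")
    case False
    then have "\<exists>u. atom_cell \<alpha> m u \<and> word_dim m = Suc (word_dim u) \<and> subface k u"
      using 2 by auto
    then obtain u where "atom_cell \<alpha> m u" "word_dim m = Suc (word_dim u)" "subface k u" by auto
    then show ?thesis using 2 False by (intro exI[of _ "a # u"]) auto
  next
    case True
    show ?thesis
    proof (cases "b = 0")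
      case b: True
      then have "\<exists>u. atom_cell (-\<alpha>) m u \<and> word_dim m = Suc (word_dim u) \<and> subface k u"
        using 2 True signs_uminus[of \<alpha>] by auto
      then obtain u where "atom_cell (-\<alpha>) m u" "word_dim m = Suc (word_dim u)" "subface k u" by auto
      then show ?thesis using True b by (intro exI[of _ "0 # u"]) auto
    next
      case False
      then have "b = \<alpha>" "atom_cell \<alpha> m k" using 2 True by auto
      then show ?thesis using True 2 atom_cell_subface[of \<alpha> m k]
        by (intro exI[of _ "\<alpha> # m"]) auto
    qed
  qed
qed auto

text \<open>Keep only the second replaced letter of \<open>k\<close>. Putting the first one back to
  0 adds one retained zero before it, which turns the sign.\<close>

lemma atom_cell_other_coface:
  "atom_cell \<alpha> a k \<Longrightarrow> \<alpha> \<in> signs \<Longrightarrow> Suc (word_dim k) < word_dim a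
    \<Longrightarrow> \<exists>m. atom_cell (-\<alpha>) a m \<and> word_dim a = Suc (word_dim m) \<and> subface k m"
proof (induction \<alpha> a k rule: atom_cell.induct)
  case (2 \<alpha> a m b k)
  show ?case
  proof (cases "a = 0")
    case False
    then have "\<exists>u. atom_cell (-\<alpha>) m u \<and> word_dim m = Suc (word_dim u) \<and> subface k u"
      using 2 by auto
    then obtain u where "atom_cell (-\<alpha>) m u" "word_dim m = Suc (word_dim u)" "subface k u" by auto
    then show ?thesis using 2 False by (intro exI[of _ "a # u"]) auto
  next
    case True
    show ?thesis
    proof (cases "b = 0")
      case b: True
      then have "\<exists>u. atom_cell (- (-\<alpha>)) m u \<and> word_dim m = Suc (word_dim u) \<and> subface k u"
        using 2 True signs_uminus[of \<alpha>] by auto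
      then obtain u where "atom_cell \<alpha> m u" "word_dim m = Suc (word_dim u)" "subface k u" by auto
      then show ?thesis using True b by (intro exI[of _ "0 # u"]) auto
    next
      case False
      then have "b = \<alpha>" "atom_cell \<alpha> m k" "word_dim k < word_dim m" using 2 True by auto
      then obtain u where "atom_cell \<alpha> m u" "word_dim m = Suc (word_dim u)" "subface k u"
        using 2 atom_cell_same_coface by blast
      then show ?thesis using True 2 \<open>b = \<alpha>\<close>
        by (intro exI[of _ "0 # u"]) auto
    qed
  qed
qed auto

text \<open>
  \<open>chain_bd c k\<close> is the coefficient of the face \<open>k\<close> in the boundary of the chain \<open>c\<close>. The faces that
  have \<open>k\<close> in their boundary arise from \<open>k\<close> by replacing one nonzero letter by 0.
\<close>

fun chain_bd :: "(int list \<Rightarrow> int) \<Rightarrow> int list \<Rightarrow> int" where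
  "chain_bd c [] = 0"
| "chain_bd c (a # k) =
    (if a = 0 then - chain_bd (\<lambda>u. c (0 # u)) k else a * c (0 # k) + chain_bd (\<lambda>u. c (a # u)) k)"

lemma chain_bd_0 [simp]: "chain_bd (\<lambda>_. 0) k = 0"
  by (induction k) auto

lemma chain_bd_add: "chain_bd (\<lambda>u. c u + e u) k = chain_bd c k + chain_bd e k"
  by (induction k arbitrary: c e) (auto simp: algebra_simps)

lemma chain_bd_diff: "chain_bd (\<lambda>u. c u - e u) k = chain_bd c k - chain_bd e k"
  by (induction k arbitrary: c e) (auto simp: algebra_simps)

lemma chain_bd_cong:
  "(\<And>m. subface k m \<Longrightarrow> word_dim m = Suc (word_dim k) \<Longrightarrow> c m = e m) \<Longrightarrow> k \<in> words n
    \<Longrightarrow> chain_bd c k = chain_bd e k"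
proof (induction k arbitrary: c e n)
  case (Cons a k)
  then obtain n' where n: "n = Suc n'" "k \<in> words n'" by (cases n) (auto simp: words_def)
  have "chain_bd (\<lambda>u. c (a # u)) k = chain_bd (\<lambda>u. e (a # u)) k"
    by (rule Cons.IH[OF _ n(2)]) (use Cons.prems in auto)
  then show ?case using Cons.prems n by auto
qed auto

text \<open>The right side does not depend on \<open>\<alpha>\<close>, which the induction exploits:
  under a leading zero, the chain of sign \<open>\<alpha>\<close> is 0 times the chain of sign
  \<open>-\<alpha>\<close> of the tail plus \<open>\<alpha>\<close> times its chain of sign
  \<open>\<alpha>\<close>.\<close>

lemma chain_bd_atom:
  "a \<in> words n \<Longrightarrow> k \<in> words n \<Longrightarrow> \<alpha> \<in> signs \<Longrightarrow>
    chain_bd (\<lambda>u. of_bool (atom_cell \<alpha> a u)) k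
      = of_bool (atom_cell 1 a k) - of_bool (atom_cell (-1) a k)"
proof (induction n arbitrary: a k \<alpha>)
  case (Suc n)
  obtain b m c l where [simp]: "a = b # m" "k = c # l" using Suc.prems by (cases a; cases k) auto
  have m: "m \<in> words n" "l \<in> words n" using Suc.prems by auto
  have "chain_bd (\<lambda>u. of_bool (atom_cell \<alpha> m u)) l
      = of_bool (atom_cell 1 m l) - of_bool (atom_cell (-1) m l)"
    "chain_bd (\<lambda>u. of_bool (atom_cell (-\<alpha>) m u)) l
      = of_bool (atom_cell 1 m l) - of_bool (atom_cell (-1) m l)"
    using Suc.IH[OF m, of \<alpha>] Suc.IH[OF m, of "-\<alpha>"] Suc.prems(3) by auto
  then show ?case using Suc.prems by (auto)
qed auto

text \<open>A nonzero letter of \<open>k\<close> after z zeros is \<beta> (-)^z, and its coface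
  enters the boundary with the letter times (-)^z. So all cofaces have the incidence \<beta>, and
  the coefficients of a nonnegative chain cannot cancel.\<close>

lemma chain_bd_ge_coface:
  "atom_cell \<beta> (replicate n 0) k \<Longrightarrow> \<beta> \<in> signs \<Longrightarrow> (\<And>u. c u \<ge> 0) \<Longrightarrow>
    \<beta> * chain_bd c k \<ge> 0 \<and>
    (\<forall>m. subface k m \<longrightarrow> word_dim m = Suc (word_dim k) \<longrightarrow> \<beta> * chain_bd c k \<ge> c m)"
proof (induction n arbitrary: k \<beta> c)
  case 0
  then show ?case by (cases k) (auto elim: subface.elims)
next
  case (Suc n)
  obtain b l where k [simp]: "k = b # l" using Suc.prems by (cases k) auto
  show ?case
  proof (cases "b = 0")
    case True
    then have at: "atom_cell (-\<beta>) (replicate n 0) l" using Suc.prems by auto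
    have IH: "- \<beta> * chain_bd (\<lambda>u. c (0 # u)) l \<ge> 0"
      "\<And>m. subface l m \<Longrightarrow> word_dim m = Suc (word_dim l) \<Longrightarrow>
        - \<beta> * chain_bd (\<lambda>u. c (0 # u)) l \<ge> c (0 # m)"
      using Suc.IH[OF at signs_uminus[OF Suc.prems(2)], of "\<lambda>u. c (0 # u)"] Suc.prems(3) by auto
    have "\<beta> * chain_bd c k \<ge> c m" if "subface k m" "word_dim m = Suc (word_dim k)" for m
      using that IH(2) True by (cases m) auto
    then show ?thesis using IH(1) True by auto
  next
    case False
    then have at: "b = \<beta>" "atom_cell \<beta> (replicate n 0) l" using Suc.prems by auto
    have IH: "\<beta> * chain_bd (\<lambda>u. c (\<beta> # u)) l \<ge> 0"
      "\<And>m. subface l m \<Longrightarrow> word_dim m = Suc (word_dim l) \<Longrightarrow>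
        \<beta> * chain_bd (\<lambda>u. c (\<beta> # u)) l \<ge> c (\<beta> # m)"
      using Suc.IH[OF at(2) Suc.prems(2), of "\<lambda>u. c (\<beta> # u)"] Suc.prems(3) by auto
    have bb: "\<beta> * \<beta> = 1" "\<beta> \<noteq> 0" using Suc.prems(2) by auto
    have eq: "\<beta> * chain_bd c k = c (0 # l) + \<beta> * chain_bd (\<lambda>u. c (\<beta> # u)) l"
      using at bb by (simp add: distrib_left mult.assoc[symmetric])
    have c0: "c (0 # l) \<ge> 0" "\<And>m. c (\<beta> # m) \<ge> 0" using Suc.prems(3) by auto
    have "\<beta> * chain_bd c k \<ge> c m" if m: "subface k m" "word_dim m = Suc (word_dim k)" for m
    proof -
      obtain d u where [simp]: "m = d # u" using m by (cases m) auto
      have "d = b \<or> d = 0" "subface l u" using m by auto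
      moreover have "u = l" if "d = 0" using that m subface_dim_eq[of l u] False by auto
      ultimately show ?thesis
        using m IH(1) IH(2)[of u] c0(1) at bb unfolding eq by (auto split: if_splits)
    qed
    then show ?thesis using IH(1) c0 unfolding eq by auto
  qed
qed

text \<open>
  Comparing weights means comparing words lexicographically, where the order \<open>- < 0 < +\<close> of the
  letters is reversed after an odd number of zeros.
\<close>

fun word_weight :: "int list \<Rightarrow> int" where
  "word_weight [] = 0"
| "word_weight (a # k) = a * 3 ^ length k + (if a = 0 then - word_weight k else word_weight k)"

text \<open>Two tails differ by less than one unit of the leading digit, so the first letter where
  two words differ decides the comparison.\<close>

lemma abs_word_weight: "k \<in> words n \<Longrightarrow> 2 * \<bar>word_weight k\<bar> < 3 ^ n"
proof (induction n arbitrary: k)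
  case (Suc n)
  obtain b l where [simp]: "k = b # l" using Suc.prems by (cases k) auto
  have "2 * \<bar>word_weight l\<bar> < 3 ^ n" "length l = n" using Suc by (auto simp: length_words)
  moreover have "b = -1 \<or> b = 0 \<or> b = 1" using Suc.prems by auto
  ultimately show ?case by (elim disjE; simp; linarith)
qed auto

text \<open>The first replaced zero, after z zeros, becomes \<alpha> (-)^z, and the weight counts
  this position with the factor (-)^z. So output cells are heavier than the face and input cells are
  lighter.\<close>

lemma atom_cell_weight:
  "atom_cell \<alpha> a k \<Longrightarrow> \<alpha> \<in> signs \<Longrightarrow> a \<in> words n \<Longrightarrow> k \<noteq> a
    \<Longrightarrow> \<alpha> * word_weight a < \<alpha> * word_weight k"
proof (induction n arbitrary: a k \<alpha>)
  case (Suc n)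
  obtain b m c l where [simp]: "a = b # m" "k = c # l" using Suc.prems by (cases a; cases k) auto
  have m: "m \<in> words n" "l \<in> words n" "length m = n" "length l = n"
    using Suc.prems subface_words[OF atom_cell_subface] by (auto simp: length_words)
  note b = abs_word_weight[OF m(1)] abs_word_weight[OF m(2)]
  consider "b \<noteq> 0" "c = b" "atom_cell \<alpha> m l" | "b = 0" "c = 0" "atom_cell (-\<alpha>) m l"
    | "b = 0" "c = \<alpha>" using Suc.prems by (auto split: if_splits)
  then show ?case
  proof cases
    case 1
    then show ?thesis using Suc.IH[of \<alpha> m l] Suc.prems m by (auto)
  next
    case 2
    then show ?thesis using Suc.IH[of "-\<alpha>" m l] signs_uminus[of \<alpha>] Suc.prems m by auto
  next
    case 3
    then show ?thesis using b m Suc.prems(2) by (auto)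
  qed
next
  case 0
  then show ?case by (cases k) auto
qed

section \<open>The omega-category of tables\<close>

text \<open>
  \<open>x \<alpha> k\<close> is the coefficient of \<open>k\<close> in the chain of dimension \<open>dim k\<close> and sign \<open>\<alpha>\<close>, so that one
  function holds the chains of all dimensions.
\<close>

definition is_table :: "nat \<Rightarrow> (int \<Rightarrow> int list \<Rightarrow> int) \<Rightarrow> bool" where
  "is_table n x \<longleftrightarrow>
    (\<forall>\<alpha> k. x \<alpha> k \<ge> 0) \<and> (\<forall>\<alpha> k. x \<alpha> k \<noteq> 0 \<longrightarrow> \<alpha> \<in> signs \<and> k \<in> words n) \<and>
    (\<forall>\<alpha>\<in>signs. (\<Sum>k | k \<in> words n \<and> word_dim k = 0. x \<alpha> k) = 1) \<and>
    (\<forall>\<alpha>\<in>signs. \<forall>k\<in>words n. chain_bd (x \<alpha>) k = x 1 k - x (-1) k)"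

text \<open>The value 0 at arguments that are not signs makes equality of tables the same as
  equality of functions.\<close>

definition table_bd :: "int \<Rightarrow> nat \<Rightarrow> (int \<Rightarrow> int list \<Rightarrow> int) \<Rightarrow> int \<Rightarrow> int list \<Rightarrow> int" where
  "table_bd \<gamma> j x = (\<lambda>\<alpha> k.
    if \<alpha> \<in> signs \<and> word_dim k \<le> j then if word_dim k = j then x \<gamma> k else x \<alpha> k else 0)"

text \<open>In a composite the common boundary of the two factors is counted twice, hence it is
  subtracted once.\<close>

definition table_cat :: "nat \<Rightarrow> (int \<Rightarrow> int list \<Rightarrow> int) omega_cat" where
  "table_cat n = \<lparr>carrier = {x. is_table n x}, bd = table_bd,
    cmp = (\<lambda>j x y \<alpha> k. x \<alpha> k + y \<alpha> k - table_bd 1 j x \<alpha> k)\<rparr>"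

lemma table_cat_simps [simp]:
  "carrier (table_cat n) = {x. is_table n x}" "bd (table_cat n) = table_bd"
  "cmp (table_cat n) j x y = (\<lambda>\<alpha> k. x \<alpha> k + y \<alpha> k - table_bd 1 j x \<alpha> k)"
  by (simp_all add: table_cat_def)

lemma is_tableD:
  assumes "is_table n x"
  shows "x \<alpha> k \<ge> 0" "\<alpha> \<notin> signs \<Longrightarrow> x \<alpha> k = 0" "k \<notin> words n \<Longrightarrow> x \<alpha> k = 0"
    "\<alpha> \<in> signs \<Longrightarrow> (\<Sum>k | k \<in> words n \<and> word_dim k = 0. x \<alpha> k) = 1"
    "\<alpha> \<in> signs \<Longrightarrow> k \<in> words n \<Longrightarrow> chain_bd (x \<alpha>) k = x 1 k - x (-1) k"
  using assms unfolding is_table_def by blast+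

text \<open>Apart from nonnegativity the conditions on tables are affine, and the coefficients 1, 1,
  -1 have sum 1, which preserves the normalization of the vertices.\<close>

lemma is_table_affine:
  assumes x: "is_table n x" and y: "is_table n y" and z: "is_table n z"
    and nn: "\<And>\<alpha> k. \<alpha> \<in> signs \<Longrightarrow> k \<in> words n \<Longrightarrow> x \<alpha> k + y \<alpha> k - z \<alpha> k \<ge> 0"
  shows "is_table n (\<lambda>\<alpha> k. x \<alpha> k + y \<alpha> k - z \<alpha> k)"
  unfolding is_table_def
proof (intro conjI allI ballI impI)
  fix \<alpha> k
  show "x \<alpha> k + y \<alpha> k - z \<alpha> k \<ge> 0"
    using nn[of \<alpha> k] is_tableD(2)[OF x, of \<alpha> k]
      is_tableD(3)[OF x, of k \<alpha>]
      is_tableD(2)[OF y, of \<alpha> k] is_tableD(3)[OF y, of k \<alpha>]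
      is_tableD(2)[OF z, of \<alpha> k] is_tableD(3)[OF z, of k \<alpha>]
    by (cases "\<alpha> \<in> signs \<and> k \<in> words n") auto
  assume ne: "x \<alpha> k + y \<alpha> k - z \<alpha> k \<noteq> 0"
  then show "\<alpha> \<in> signs"
    using is_tableD(2)[OF x, of \<alpha> k] is_tableD(2)[OF y, of \<alpha> k] is_tableD(2)[OF z, of \<alpha> k] by linarith
  show "k \<in> words n"
    using ne is_tableD(3)[OF x, of k \<alpha>] is_tableD(3)[OF y, of k \<alpha>] is_tableD(3)[OF z, of k \<alpha>] by linarith
next
  fix \<alpha> assume a: "\<alpha> \<in> signs"
  show "(\<Sum>k | k \<in> words n \<and> word_dim k = 0. x \<alpha> k + y \<alpha> k - z \<alpha> k) = 1"
    using is_tableD(4)[OF x a] is_tableD(4)[OF y a] is_tableD(4)[OF z a]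
    by (simp add: sum.distrib sum_subtractf)
  fix k assume k: "k \<in> words n"
  have "chain_bd (\<lambda>k. x \<alpha> k + y \<alpha> k - z \<alpha> k) k
      = chain_bd (x \<alpha>) k + chain_bd (y \<alpha>) k - chain_bd (z \<alpha>) k"
    using chain_bd_diff[of "\<lambda>k. x \<alpha> k + y \<alpha> k" "z \<alpha>"] chain_bd_add[of "x \<alpha>" "y \<alpha>"] by simp
  then show "chain_bd (\<lambda>k. x \<alpha> k + y \<alpha> k - z \<alpha> k) k
      = x 1 k + y 1 k - z 1 k - (x (-1) k + y (-1) k - z (-1) k)"
    using is_tableD(5)[OF x a k] is_tableD(5)[OF y a k] is_tableD(5)[OF z a k] by simp
qed

lemma is_table_bd:
  assumes x: "is_table n x" and g: "\<gamma> \<in> signs"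
  shows "is_table n (table_bd \<gamma> j x)"
  unfolding is_table_def
proof (intro conjI allI ballI impI)
  fix \<alpha> k
  show "table_bd \<gamma> j x \<alpha> k \<ge> 0" using is_tableD(1)[OF x] by (simp add: table_bd_def)
  assume ne: "table_bd \<gamma> j x \<alpha> k \<noteq> 0"
  then show "\<alpha> \<in> signs" by (auto simp: table_bd_def split: if_splits)
  show "k \<in> words n" using ne is_tableD(3)[OF x] by (auto simp: table_bd_def split: if_splits)
next
  fix \<alpha> assume a: "\<alpha> \<in> signs"
  have "(\<Sum>k | k \<in> words n \<and> word_dim k = 0. table_bd \<gamma> j x \<alpha> k)
      = (\<Sum>k | k \<in> words n \<and> word_dim k = 0. x (if j = 0 then \<gamma> else \<alpha>) k)"
    using a by (intro sum.cong) (auto simp: table_bd_def)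
  then show "(\<Sum>k | k \<in> words n \<and> word_dim k = 0. table_bd \<gamma> j x \<alpha> k) = 1"
    using is_tableD(4)[OF x] a g by auto
  fix k assume k: "k \<in> words n"
  \<comment> \<open>The chain one dimension above \<open>k\<close> has kept its sign, has been
    replaced by that of sign \<open>\<gamma>\<close>, or has become 0.\<close>
  consider "Suc (word_dim k) < j" | "Suc (word_dim k) = j" | "j \<le> word_dim k" by linarith
  then show "chain_bd (table_bd \<gamma> j x \<alpha>) k = table_bd \<gamma> j x 1 k - table_bd \<gamma> j x (-1) k"
  proof cases
    case 1
    then have "chain_bd (table_bd \<gamma> j x \<alpha>) k = chain_bd (x \<alpha>) k"
      using a k by (intro chain_bd_cong[OF _ k]) (auto simp: table_bd_def)
    then show ?thesis using 1 is_tableD(5)[OF x a k] by (simp add: table_bd_def)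
  next
    case 2
    then have "chain_bd (table_bd \<gamma> j x \<alpha>) k = chain_bd (x \<gamma>) k"
      using a k by (intro chain_bd_cong[OF _ k]) (auto simp: table_bd_def)
    then show ?thesis using 2 is_tableD(5)[OF x g k] by (simp add: table_bd_def)
  next
    case 3
    then have "chain_bd (table_bd \<gamma> j x \<alpha>) k = chain_bd (\<lambda>_. 0) k"
      using a k by (intro chain_bd_cong[OF _ k]) (auto simp: table_bd_def)
    then show ?thesis using 3 by (simp add: table_bd_def)
  qed
qed

lemma table_composable:
  assumes "composable (table_cat n) j x y"
  shows "is_table n x" "is_table n y" "table_bd 1 j x = table_bd (-1) j y"
    "\<alpha> \<in> signs \<Longrightarrow> word_dim k < j \<Longrightarrow> x \<alpha> k = y \<alpha> k" "word_dim k = j \<Longrightarrow> x 1 k = y (-1) k"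
proof -
  show eq: "is_table n x" "is_table n y" "table_bd 1 j x = table_bd (-1) j y"
    using assms by (auto simp: composable_def)
  show "\<alpha> \<in> signs \<Longrightarrow> word_dim k < j \<Longrightarrow> x \<alpha> k = y \<alpha> k" "word_dim k = j \<Longrightarrow> x 1 k = y (-1) k"
    using fun_cong[OF fun_cong[OF eq(3)], of \<alpha> k] fun_cong[OF fun_cong[OF eq(3)], of 1 k]
    by (auto simp: table_bd_def)
qed

lemma table_bd_bd:
  "\<beta> \<in> signs \<Longrightarrow> \<alpha> \<in> signs \<Longrightarrow> table_bd \<beta> m (table_bd \<alpha> n x)
    = (if m < n then table_bd \<beta> m x else table_bd \<alpha> n x)"
  by (auto simp: table_bd_def fun_eq_iff)

lemma table_bd_affine:
  "table_bd \<beta> m (\<lambda>\<alpha> k. x \<alpha> k + y \<alpha> k - z \<alpha> k)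
    = (\<lambda>\<alpha> k. table_bd \<beta> m x \<alpha> k + table_bd \<beta> m y \<alpha> k - table_bd \<beta> m z \<alpha> k)"
  by (auto simp: table_bd_def fun_eq_iff)

lemma table_bd_above: "is_table n x \<Longrightarrow> table_bd \<gamma> (Suc n) x = x"
proof (intro ext)
  fix \<alpha> k assume x: "is_table n x"
  show "table_bd \<gamma> (Suc n) x \<alpha> k = x \<alpha> k"
    using is_tableD(2)[OF x, of \<alpha> k] is_tableD(3)[OF x, of k \<alpha>] is_tableD(3)[OF x, of k \<gamma>] word_dim_le_length[of k]
      length_words[of k n]
    by (cases "k \<in> words n") (auto simp: table_bd_def)
qed

lemma omega_category_table_cat: "omega_category (table_cat n)"
proof
  fix x \<alpha> j assume "x \<in> carrier (table_cat n)" "\<alpha> \<in> signs"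
  then show "bd (table_cat n) \<alpha> j x \<in> carrier (table_cat n)" using is_table_bd by simp
next
  fix j x y assume c: "composable (table_cat n) j x y"
  note f = table_composable[OF c]
  have "is_table n (\<lambda>\<alpha> k. x \<alpha> k + y \<alpha> k - table_bd 1 j x \<alpha> k)"
  proof (rule is_table_affine[OF f(1,2) is_table_bd[OF f(1)]])
    fix \<alpha> k assume "\<alpha> \<in> signs"
    \<comment> \<open>In dimension \<open>j\<close> the subtracted chain is
      \<open>x 1 = y (-1)\<close>, which cancels one of the two summands; below \<open>j\<close> it
      is the chain of \<open>x\<close> itself, and above \<open>j\<close> it is 0.\<close>
    then show "x \<alpha> k + y \<alpha> k - table_bd 1 j x \<alpha> k \<ge> 0"
      using is_tableD(1)[OF f(1)] is_tableD(1)[OF f(2)] f(5)[of k] 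
      by (auto simp: table_bd_def)
  qed simp
  then show "cmp (table_cat n) j x y \<in> carrier (table_cat n)" by simp
next
  fix x \<alpha> \<beta> and m j :: nat
  assume "x \<in> carrier (table_cat n)" "\<alpha> \<in> signs" "\<beta> \<in> signs" "m < j"
  then show "bd (table_cat n) \<beta> m (bd (table_cat n) \<alpha> j x) = bd (table_cat n) \<beta> m x"
    by (simp add: table_bd_bd)
next
  fix x \<alpha> \<beta> and m j :: nat
  assume "x \<in> carrier (table_cat n)" "\<alpha> \<in> signs" "\<beta> \<in> signs" "j \<le> m"
  then show "bd (table_cat n) \<beta> m (bd (table_cat n) \<alpha> j x) = bd (table_cat n) \<alpha> j x"
    by (simp add: table_bd_bd)
next
  fix x j assume "x \<in> carrier (table_cat n)"
  then show "cmp (table_cat n) j (src (table_cat n) j x) x = x"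
    by (simp add: table_bd_bd)
next
  fix x j assume "x \<in> carrier (table_cat n)"
  then show "cmp (table_cat n) j x (tgt (table_cat n) j x) = x" by simp
next
  fix j x y assume c: "composable (table_cat n) j x y"
  note f = table_composable[OF c]
  show "src (table_cat n) j (cmp (table_cat n) j x y) = src (table_cat n) j x"
    unfolding table_cat_simps table_bd_affine using f(3) by (simp add: table_bd_bd)
  show "tgt (table_cat n) j (cmp (table_cat n) j x y) = tgt (table_cat n) j y"
    unfolding table_cat_simps table_bd_affine by (simp add: table_bd_bd)
next
  fix j x y \<alpha> m assume c: "composable (table_cat n) j x y" and a: "\<alpha> \<in> signs" "m \<noteq> j"
  have a1: "(1::int) \<in> signs" by simp
  show "bd (table_cat n) \<alpha> m (cmp (table_cat n) j x y)
      = cmp (table_cat n) j (bd (table_cat n) \<alpha> m x) (bd (table_cat n) \<alpha> m y)"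
    unfolding table_cat_simps table_bd_affine table_bd_bd[OF a(1) a1] table_bd_bd[OF a1 a(1)]
    using a table_composable(4)[OF c a(1)] 
    by (auto simp: table_bd_def fun_eq_iff)
next
  fix j x y z
  show "cmp (table_cat n) j (cmp (table_cat n) j x y) z = cmp (table_cat n) j x (cmp (table_cat n) j y z)"
    unfolding table_cat_simps table_bd_affine by (simp add: table_bd_bd fun_eq_iff)
next
  fix m j :: nat and x y z w :: "int \<Rightarrow> int list \<Rightarrow> int" assume "m \<noteq> j"
  then show "cmp (table_cat n) m (cmp (table_cat n) j x y) (cmp (table_cat n) j z w)
     = cmp (table_cat n) j (cmp (table_cat n) m x z) (cmp (table_cat n) m y w)"
    unfolding table_cat_simps table_bd_affine by (auto simp: table_bd_bd fun_eq_iff)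
next
  fix x assume "x \<in> carrier (table_cat n)"
  then show "\<exists>j. src (table_cat n) j x = x \<and> tgt (table_cat n) j x = x"
    using table_bd_above by auto
qed

section \<open>Tables are determined by their sets of cells\<close>

text \<open>
  Pushforward of a chain along the projection of the cube onto the directions of the face \<open>m\<close>:
  faces which extend in a forgotten direction are sent to 0.
\<close>

fun project :: "int list \<Rightarrow> (int list \<Rightarrow> int) \<Rightarrow> int list \<Rightarrow> int" where
  "project [] c u = (if u = [] then c [] else 0)"
| "project (a # m) c u =
    (if a \<noteq> 0 then project m (\<lambda>k. c (-1 # k) + c (1 # k)) u
     else case u of [] \<Rightarrow> 0 | b # v \<Rightarrow> project m (\<lambda>k. c (b # k)) v)"

fun project_word :: "int list \<Rightarrow> int list \<Rightarrow> int list" where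
  "project_word (a # m) (b # k) = (if a = 0 then b # project_word m k else project_word m k)"
| "project_word _ _ = []"

lemma project_0 [simp]: "project m (\<lambda>_. 0) u = 0"
  by (induction m arbitrary: u) (auto split: list.split)

lemma project_add: "project m (\<lambda>k. c k + e k) u = project m c u + project m e u"
proof (induction m arbitrary: c e u)
  case (Cons a m)
  have "project m (\<lambda>k. (c (-1 # k) + e (-1 # k)) + (c (1 # k) + e (1 # k))) u
    = project m (\<lambda>k. (c (-1 # k) + c (1 # k)) + (e (-1 # k) + e (1 # k))) u"
    by (simp add: algebra_simps)
  then show ?case by (auto simp: Cons.IH split: list.split)
qed auto

lemma project_uminus: "project m (\<lambda>k. - c k) u = - project m c u"
  using project_add[of m c "\<lambda>k. - c k" u] by simp

lemma project_diff: "project m (\<lambda>k. c k - e k) u = project m c u - project m e u"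
  using project_add[of m c "\<lambda>k. - e k" u] by (simp add: project_uminus)

lemma project_cong:
  "m \<in> words n \<Longrightarrow> u \<in> words (word_dim m) \<Longrightarrow> (\<And>k. k \<in> words n \<Longrightarrow> c k = e k)
    \<Longrightarrow> project m c u = project m e u"
proof (induction n arbitrary: m c e u)
  case (Suc n)
  obtain a l where [simp]: "m = a # l" using Suc.prems by (cases m) auto
  have l: "l \<in> words n" using Suc.prems by simp
  show ?case
  proof (cases "a = 0")
    case True
    then obtain b v where [simp]: "u = b # v" using Suc.prems by (cases u) auto
    have "project l (\<lambda>k. c (b # k)) v = project l (\<lambda>k. e (b # k)) v"
      by (rule Suc.IH[OF l]) (use Suc.prems True in auto)
    then show ?thesis using True by simp
  next
    case False
    have "project l (\<lambda>k. c (-1 # k) + c (1 # k)) u = project l (\<lambda>k. e (-1 # k) + e (1 # k)) u"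
      by (rule Suc.IH[OF l]) (use Suc.prems False in auto)
    then show ?thesis using False by simp
  qed
qed auto

lemma project_nonneg: "(\<And>k. c k \<ge> 0) \<Longrightarrow> project m c u \<ge> 0"
proof (induction m arbitrary: c u)
  case (Cons a m)
  have "project m (\<lambda>k. c (-1 # k) + c (1 # k)) u \<ge> 0" "\<And>b v. project m (\<lambda>k. c (b # k)) v \<ge> 0"
    using Cons.prems by (auto intro!: Cons.IH)
  then show ?case by (auto split: list.split)
qed auto

lemma project_outside:
  "m \<in> words n \<Longrightarrow> (\<And>k. k \<notin> words n \<Longrightarrow> c k = 0) \<Longrightarrow> u \<notin> words (word_dim m)
    \<Longrightarrow> project m c u = 0"
proof (induction n arbitrary: m c u)
  case (Suc n)
  obtain a l where [simp]: "m = a # l" using Suc.prems by (cases m) auto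
  have l: "l \<in> words n" using Suc.prems by simp
  show ?case
  proof (cases "a = 0")
    case True
    show ?thesis
    proof (cases u)
      case (Cons b v)
      show ?thesis
      proof (cases "b = -1 \<or> b = 0 \<or> b = 1")
        case b: True
        have "project l (\<lambda>k. c (b # k)) v = 0"
          by (rule Suc.IH[OF l]) (use Suc.prems True Cons b in auto)
        then show ?thesis using True Cons by simp
      next
        case False
        then have "(\<lambda>k. c (b # k)) = (\<lambda>_. 0)" using Suc.prems(2) by (auto simp: fun_eq_iff)
        then show ?thesis using True Cons by simp
      qed
    qed (use True in auto)
  next
    case False
    have "project l (\<lambda>k. c (-1 # k) + c (1 # k)) u = 0"
      by (rule Suc.IH[OF l]) (use Suc.prems False in auto)
    then show ?thesis using False by simp
  qed
qed auto

lemma sum_vertices_Suc: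
  fixes c :: "int list \<Rightarrow> int"
  shows "(\<Sum>k | k \<in> words (Suc n) \<and> word_dim k = 0. c k)
    = (\<Sum>k | k \<in> words n \<and> word_dim k = 0. c (-1 # k) + c (1 # k))"
proof -
  have eq: "{k. k \<in> words (Suc n) \<and> word_dim k = 0}
    = (#) (-1) ` {k. k \<in> words n \<and> word_dim k = 0} \<union> (#) 1 ` {k. k \<in> words n \<and> word_dim k = 0}"
    by (auto simp: words_Suc)
  show ?thesis
    unfolding eq by (subst sum.union_disjoint) (auto simp: sum.reindex inj_on_def sum.distrib)
qed

lemma sum_vertices_project:
  "m \<in> words n \<Longrightarrow> (\<Sum>u | u \<in> words (word_dim m) \<and> word_dim u = 0. project m c u)
    = (\<Sum>k | k \<in> words n \<and> word_dim k = 0. c k)"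
proof (induction n arbitrary: m c)
  case 0
  have "{u::int list. u = [] \<and> word_dim u = 0} = {[]}" by auto
  then show ?case using 0 by simp
next
  case (Suc n)
  obtain a l where [simp]: "m = a # l" using Suc.prems by (cases m) auto
  have l: "l \<in> words n" using Suc.prems by simp
  show ?case
    by (cases "a = 0") (simp_all add: sum_vertices_Suc project_add[symmetric] Suc.IH[OF l])
qed

text \<open>The pushforward is a chain map: a face that extends in a forgotten direction has its two
  ends in its boundary with opposite signs, and they are added up.\<close>

lemma chain_bd_project:
  "m \<in> words n \<Longrightarrow> u \<in> words (word_dim m)
    \<Longrightarrow> chain_bd (project m c) u = project m (chain_bd c) u"
proof (induction n arbitrary: m c u)
  case (Suc n)
  obtain a l where [simp]: "m = a # l" using Suc.prems by (cases m) auto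
  have l: "l \<in> words n" using Suc.prems by simp
  show ?case
  proof (cases "a = 0")
    case True
    then obtain b v where [simp]: "u = b # v" using Suc.prems by (cases u) auto
    have v: "v \<in> words (word_dim l)" using Suc.prems True by auto
    have IH: "chain_bd (project l (\<lambda>k. c (d # k))) v = project l (chain_bd (\<lambda>k. c (d # k))) v" for d
      by (rule Suc.IH[OF l v])
    have sc: "project l (\<lambda>k. b * c (0 # k)) v = b * project l (\<lambda>k. c (0 # k)) v"
      using Suc.prems True by (auto simp: project_uminus)
    show ?thesis using True IH by (simp add: project_uminus project_add sc)
  next
    case False
    then have u: "u \<in> words (word_dim l)" using Suc.prems by auto
    have "chain_bd (project l (\<lambda>k. c (-1 # k) + c (1 # k))) u
      = project l (chain_bd (\<lambda>k. c (-1 # k) + c (1 # k))) u" by (rule Suc.IH[OF l u])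
    moreover have "chain_bd (\<lambda>k. c (-1 # k) + c (1 # k))
      = (\<lambda>k. chain_bd (\<lambda>u. c (-1 # u)) k + chain_bd (\<lambda>u. c (1 # u)) k)"
      by (rule ext) (rule chain_bd_add)
    ultimately show ?thesis using False by simp
  qed
qed auto

text \<open>Reduces assertions about an arbitrary face \<open>m\<close> of a table to assertions
  about the top face of a smaller cube.\<close>

lemma is_table_project:
  assumes x: "is_table n x" and m: "m \<in> words n"
  shows "is_table (word_dim m) (\<lambda>\<alpha>. project m (x \<alpha>))"
  unfolding is_table_def
proof (intro conjI allI ballI impI)
  fix \<alpha> k
  show "project m (x \<alpha>) k \<ge> 0" using is_tableD(1)[OF x] by (rule project_nonneg)
  assume ne: "project m (x \<alpha>) k \<noteq> 0"
  have "x \<alpha> = (\<lambda>_. 0)" if "\<alpha> \<notin> signs" using is_tableD(2)[OF x that] by auto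
  then show "\<alpha> \<in> signs" using ne by (metis project_0)
  show "k \<in> words (word_dim m)" using ne project_outside[OF m, of "x \<alpha>" k] is_tableD(3)[OF x] by blast
next
  fix \<alpha> assume a: "\<alpha> \<in> signs"
  show "(\<Sum>k | k \<in> words (word_dim m) \<and> word_dim k = 0. project m (x \<alpha>) k) = 1"
    using sum_vertices_project[OF m] is_tableD(4)[OF x a] by simp
  fix k assume k: "k \<in> words (word_dim m)"
  have "project m (chain_bd (x \<alpha>)) k = project m (\<lambda>k. x 1 k - x (-1) k) k"
    using is_tableD(5)[OF x a] by (intro project_cong[OF m k]) auto
  then show "chain_bd (project m (x \<alpha>)) k = project m (x 1) k - project m (x (-1)) k"
    using chain_bd_project[OF m k] by (simp add: project_diff)
qed

lemma project_word_in_words: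
  "subface k m \<Longrightarrow> m \<in> words n \<Longrightarrow> project_word m k \<in> words (word_dim m)"
  by (induction k m arbitrary: n rule: subface.induct) (auto simp: words_def)

lemma project_word_self [simp]: "project_word m m = replicate (word_dim m) 0"
  by (induction m) auto

lemma atom_cell_project_word:
  "subface k m \<Longrightarrow> atom_cell \<beta> m k \<longleftrightarrow> atom_cell \<beta> (replicate (word_dim m) 0) (project_word m k)"
  by (induction k m arbitrary: \<beta> rule: subface.induct) auto

text \<open>The right side is a sum of nonnegative coefficients, one for each face parallel to
  \<open>k\<close> with the same letters in the directions of \<open>m\<close>, and \<open>k\<close>
  is among them.\<close>

lemma project_ge:
  "subface k m \<Longrightarrow> m \<in> words n \<Longrightarrow> (\<And>k. c k \<ge> 0) \<Longrightarrow> c k \<le> project m c (project_word m k)"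
proof (induction k m arbitrary: c n rule: subface.induct)
  case (2 a k b m)
  obtain n' where n: "m \<in> words n'" "b = -1 \<or> b = 0 \<or> b = 1" using 2(3) by (cases n) auto
  have "c (-1 # k) + c (1 # k) \<le> project m (\<lambda>k. c (-1 # k) + c (1 # k)) (project_word m k)"
    "c (a # k) \<le> project m (\<lambda>k. c (a # k)) (project_word m k)"
    using 2(2) 2(4) n by (auto intro!: 2(1))
  moreover have "c (-1 # k) \<ge> 0" "c (1 # k) \<ge> 0" using 2(4) by auto
  ultimately show ?case using 2(2) n(2) by auto
qed auto

text \<open>Two parallel faces are both mapped to the top face when the remaining directions are
  forgotten, so their coefficients add up.\<close>

lemma project_ge_two:
  "k \<in> words n \<Longrightarrow> l \<in> words n \<Longrightarrow> map (\<lambda>a. a = 0) k = map (\<lambda>a. a = 0) l \<Longrightarrow> k \<noteq> l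
    \<Longrightarrow> (\<And>k. c k \<ge> 0) \<Longrightarrow> c k + c l \<le> project k c (replicate (word_dim k) 0)"
proof (induction n arbitrary: k l c)
  case (Suc n)
  obtain a u b v where [simp]: "k = a # u" "l = b # v" using Suc.prems by (cases k; cases l) auto
  have uv: "u \<in> words n" "v \<in> words n" "map (\<lambda>a. a = 0) u = map (\<lambda>a. a = 0) v" "a = 0 \<longleftrightarrow> b = 0"
    using Suc.prems by auto
  show ?case
  proof (cases "a = 0")
    case True
    then show ?thesis using Suc.IH[OF uv(1-3), of "\<lambda>k. c (0 # k)"] Suc.prems uv by auto
  next
    case False
    let ?c = "\<lambda>k. c (-1 # k) + c (1 # k)"
    have nn: "\<And>k. ?c k \<ge> 0" "\<And>d k. c (d # k) \<ge> 0" using Suc.prems(5) by (auto intro: add_nonneg_nonneg)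
    have ab: "a = -1 \<or> a = 1" "b = -1 \<or> b = 1" using Suc.prems False uv(4) by auto
    show ?thesis
    proof (cases "u = v")
      case True
      have "?c u \<le> project u ?c (project_word u u)" by (rule project_ge[OF _ uv(1) nn(1)]) simp
      moreover have "a \<noteq> b" using True Suc.prems by auto
      ultimately show ?thesis using ab True by (auto simp: add.commute)
    next
      case neq: False
      have "?c u + ?c v \<le> project u ?c (replicate (word_dim u) 0)"
        by (rule Suc.IH[OF uv(1-3) neq nn(1)])
      moreover have "c (a # u) \<le> ?c u" "c (b # v) \<le> ?c v" using ab nn(2) by auto
      ultimately show ?thesis using False by auto
    qed
  qed
qed auto

text \<open>Keep the zeros of \<open>k\<close> and write \<beta> (-)^z at every other position,
  where z counts the zeros before it.\<close>

lemma atom_cell_exists_direction: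
  "k \<in> words n \<Longrightarrow> \<beta> \<in> signs \<Longrightarrow>
    \<exists>v \<in> words n. map (\<lambda>a. a = 0) v = map (\<lambda>a. a = 0) k \<and> atom_cell \<beta> (replicate n 0) v"
proof (induction n arbitrary: k \<beta>)
  case (Suc n)
  obtain a u where [simp]: "k = a # u" using Suc.prems by (cases k) auto
  have u: "u \<in> words n" using Suc.prems by auto
  show ?case
  proof (cases "a = 0")
    case True
    obtain v where "v \<in> words n" "map (\<lambda>a. a = 0) v = map (\<lambda>a. a = 0) u"
      "atom_cell (-\<beta>) (replicate n 0) v"
      using Suc.IH[OF u signs_uminus[OF Suc.prems(2)]] by blast
    then show ?thesis using True by (intro bexI[of _ "0 # v"]) auto
  next
    case False
    obtain v where "v \<in> words n" "map (\<lambda>a. a = 0) v = map (\<lambda>a. a = 0) u"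
      "atom_cell \<beta> (replicate n 0) v"
      using Suc.IH[OF u Suc.prems(2)] by blast
    then show ?thesis using False Suc.prems(2) by (intro bexI[of _ "\<beta> # v"]) auto
  qed
qed auto

lemma map_zero_word_dim:
  "map (\<lambda>a. a = 0) k = map (\<lambda>a. a = 0) l \<Longrightarrow> word_dim k = word_dim l"
proof (induction k arbitrary: l)
  case (Cons a k)
  then show ?case by (cases l) auto
qed auto

text \<open>Descending induction on the dimension of \<open>k\<close>. Since all cofaces of
  \<open>k\<close> have the same incidence, a coefficient \<open>x \<beta> m\<close> of a coface is
  at most \<open>\<beta> * chain_bd (x \<beta>) k\<close>, which is the difference of the
  coefficients of \<open>k\<close> with the signs \<beta> and -\<beta>. The top face has no coface,
  so there both signs agree.\<close>

lemma table_top_le_atom: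
  assumes x: "is_table n x"
  shows "atom_cell \<beta> (replicate n 0) k \<Longrightarrow> \<alpha> \<in> signs \<Longrightarrow> \<beta> \<in> signs
    \<Longrightarrow> x \<alpha> (replicate n 0) \<le> x \<beta> k"
proof (induction "n - word_dim k" arbitrary: k rule: less_induct)
  case less
  note sub = atom_cell_subface[OF less.prems(1,3)]
  have k: "k \<in> words n" using subface_words[OF sub] by simp
  show ?case
  proof (cases "word_dim k < n")
    case True
    then obtain m where m: "subface k m" "word_dim m = Suc (word_dim k)"
      "atom_cell \<beta> (replicate n 0) m"
      using atom_cell_coface[OF less.prems(1,3)] by auto
    have "x \<alpha> (replicate n 0) \<le> x \<beta> m" using less.hyps[of m] m less.prems True by auto
    also have "x \<beta> m \<le> \<beta> * chain_bd (x \<beta>) k"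
      using chain_bd_ge_coface[OF less.prems(1,3), of "x \<beta>"] is_tableD(1)[OF x] m by blast
    also have "\<dots> = \<beta> * (x 1 k - x (-1) k)" using is_tableD(5)[OF x less.prems(3) k] by simp
    also have "\<dots> \<le> x \<beta> k"
      using less.prems(3) is_tableD(1)[OF x, of 1 k] is_tableD(1)[OF x, of "-1" k] by auto
    finally show ?thesis .
  next
    case False
    then have "k = replicate n 0" using sub subface_dim_eq[OF sub] subface_dim[OF sub] by auto
    have "chain_bd (x 1) (replicate n 0) = chain_bd (\<lambda>_. 0) (replicate n 0)"
    proof (rule chain_bd_cong)
      fix m assume "subface (replicate n 0) m" "word_dim m = Suc (word_dim (replicate n 0))"
      then show "x 1 m = 0" using word_dim_le_length[of m] subface_length[of "replicate n 0" m] by auto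
    qed (rule replicate_in_words)
    then have "x 1 (replicate n 0) = x (-1) (replicate n 0)" using is_tableD(5)[OF x, of 1] by auto
    then show ?thesis using less.prems(2,3) \<open>k = _\<close> by auto
  qed
qed

text \<open>The top face is compared with a vertex of its boundary, and the coefficients of the
  vertices are nonnegative with sum 1.\<close>

lemma table_top_le_1:
  assumes x: "is_table n x" and a: "\<alpha> \<in> signs"
  shows "x \<alpha> (replicate n 0) \<le> 1"
proof -
  \<comment> \<open>The word of ones only supplies the direction without zeros; the vertex used is
    \<open>v\<close>.\<close>
  have "replicate n 1 \<in> words n" by (auto simp: words_def)
  then obtain v where v: "v \<in> words n"
    "map (\<lambda>a. a = 0) v = map (\<lambda>a. a = 0) (replicate n (1::int))" "atom_cell \<alpha> (replicate n 0) v"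
    using atom_cell_exists_direction a by blast
  have "word_dim v = 0" using map_zero_word_dim[OF v(2)] by (simp add: word_dim_def)
  have "x \<alpha> (replicate n 0) \<le> x \<alpha> v" by (rule table_top_le_atom[OF x v(3) a a])
  also have "x \<alpha> v \<le> (\<Sum>k | k \<in> words n \<and> word_dim k = 0. x \<alpha> k)"
    using v \<open>word_dim v = 0\<close> is_tableD(1)[OF x] by (intro member_le_sum) auto
  finally show ?thesis using is_tableD(4)[OF x a] by simp
qed

text \<open>Projecting to the directions of \<open>k\<close> makes it the top face of a
  cube.\<close>

lemma table_le_1:
  assumes x: "is_table n x"
  shows "x \<alpha> k \<le> 1"
proof (cases "\<alpha> \<in> signs \<and> k \<in> words n")
  case True
  have "x \<alpha> k \<le> project k (x \<alpha>) (project_word k k)"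
    using project_ge[OF subface_refl, of k n "x \<alpha>"] is_tableD(1)[OF x] True by blast
  also have "\<dots> \<le> 1" using table_top_le_1[OF is_table_project[OF x]] True by auto
  finally show ?thesis .
qed (use is_tableD(2)[OF x, of \<alpha> k] is_tableD(3)[OF x, of k \<alpha>] in auto)

lemma table_values: "is_table n x \<Longrightarrow> x \<alpha> k = 0 \<or> x \<alpha> k = 1"
  using table_le_1[of n x \<alpha> k] is_tableD(1)[of n x \<alpha> k] by linarith

text \<open>Two parallel faces in one chain would give the top face of the projection the
  coefficient 2.\<close>

lemma table_direction_unique:
  assumes x: "is_table n x" and k: "k \<in> words n" "l \<in> words n"
    and eq: "map (\<lambda>a. a = 0) k = map (\<lambda>a. a = 0) l" and ne: "x \<alpha> k \<noteq> 0" "x \<alpha> l \<noteq> 0"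
  shows "k = l"
proof (rule ccontr)
  assume "k \<noteq> l"
  have a: "\<alpha> \<in> signs" using is_tableD(2)[OF x] ne by blast
  have "x \<alpha> k + x \<alpha> l \<le> project k (x \<alpha>) (replicate (word_dim k) 0)"
    by (rule project_ge_two[OF k eq \<open>k \<noteq> l\<close>]) (rule is_tableD(1)[OF x])
  also have "\<dots> \<le> 1" using table_top_le_1[OF is_table_project[OF x k(1)] a] by simp
  finally show False using ne table_values[OF x, of \<alpha> k] table_values[OF x, of \<alpha> l] by auto
qed

text \<open>Project to the directions of \<open>m\<close>. The image contains the top face, hence
  also the \<beta>-boundary cell \<open>v\<close> parallel to the image of \<open>k\<close>. As
  parallel cells of one chain coincide, \<open>v\<close> is the image of \<open>k\<close>.\<close>

lemma table_below_is_atom_cell: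
  assumes x: "is_table n x" and m: "x \<alpha> m \<noteq> 0" and k: "x \<beta> k \<noteq> 0" and sub: "subface k m"
  shows "atom_cell \<beta> m k"
proof -
  have a: "\<alpha> \<in> signs" "\<beta> \<in> signs" "m \<in> words n" "k \<in> words n"
    using is_tableD(2,3)[OF x] m k by blast+
  let ?y = "\<lambda>\<alpha>. project m (x \<alpha>)" and ?k = "project_word m k"
  have y: "is_table (word_dim m) ?y" by (rule is_table_project[OF x a(3)])
  have k': "?k \<in> words (word_dim m)" by (rule project_word_in_words[OF sub a(3)])
  have "1 \<le> x \<beta> k" "1 \<le> x \<alpha> m"
    using m k table_values[OF x, of \<beta> k] table_values[OF x, of \<alpha> m] by auto
  then have ge: "1 \<le> ?y \<beta> ?k" "1 \<le> ?y \<alpha> (replicate (word_dim m) 0)"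
    using project_ge[OF sub a(3), of "x \<beta>"] is_tableD(1)[OF x]
      project_ge[OF subface_refl a(3), of "x \<alpha>"] by (force intro: order_trans)+
  obtain v where v: "v \<in> words (word_dim m)" "map (\<lambda>a. a = 0) v = map (\<lambda>a. a = 0) ?k"
    "atom_cell \<beta> (replicate (word_dim m) 0) v"
    using atom_cell_exists_direction[OF k' a(2)] by blast
  have "1 \<le> ?y \<beta> v" using table_top_le_atom[OF y v(3) a(1,2)] ge by simp
  then have "v = ?k" using table_direction_unique[OF y v(1) k' v(2), of \<beta>] ge by auto
  then show ?thesis using v(3) atom_cell_project_word[OF sub] by simp
qed

definition table_cells :: "(int \<Rightarrow> int list \<Rightarrow> int) \<Rightarrow> int list set" where
  "table_cells x = {k. \<exists>\<alpha> m. x \<alpha> m \<noteq> 0 \<and> subface k m}"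

text \<open>The chains above \<open>k\<close> determine the difference of its two coefficients. If
  \<open>k\<close> were missing in \<open>y \<beta>\<close>, it would thus be missing in
  \<open>y\<close> for both signs and present in \<open>x\<close> for both. As a member of
  \<open>table_cells y\<close> it would then be a proper face of some cell \<open>m\<close> of
  \<open>y\<close>, hence of \<open>x\<close>, and lie in the input and in the output of
  \<open>m\<close>.\<close>

lemma table_cells_determine_step:
  assumes x: "is_table n x" and y: "is_table n y" and eq: "table_cells x = table_cells y"
    and above: "\<And>\<alpha> m. word_dim k < word_dim m \<Longrightarrow> x \<alpha> m = y \<alpha> m" and k: "x \<beta> k \<noteq> 0"
  shows "y \<beta> k \<noteq> 0"
proof (rule ccontr)
  assume y0: "\<not> y \<beta> k \<noteq> 0"
  have b: "\<beta> \<in> signs" "k \<in> words n" using is_tableD(2,3)[OF x] k by blast+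
  have "chain_bd (x \<beta>) k = chain_bd (y \<beta>) k" by (rule chain_bd_cong[OF _ b(2)]) (auto intro: above)
  then have "x 1 k - x (-1) k = y 1 k - y (-1) k"
    using is_tableD(5)[OF x b] is_tableD(5)[OF y b] by simp
  then have diff: "x \<beta> k - x (-\<beta>) k = y \<beta> k - y (-\<beta>) k" using b by auto
  have vals: "x \<beta> k = 1" "y \<beta> k = 0" "x (-\<beta>) k \<le> 1" "y (-\<beta>) k \<ge> 0"
    using k y0 table_values[OF x, of \<beta> k] table_le_1[OF x] is_tableD(1)[OF y] by auto
  then have z: "y (-\<beta>) k = 0" "x (-\<beta>) k = 1" using diff by linarith+
  have y00: "y \<gamma> k = 0" for \<gamma>
    using z vals is_tableD(2)[OF y, of \<gamma> k] b(1) by (cases "\<gamma> \<in> signs") auto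
  have "k \<in> table_cells y" using eq k unfolding table_cells_def by force
  then obtain \<gamma> m where m: "y \<gamma> m \<noteq> 0" "subface k m" unfolding table_cells_def by auto
  then have "m \<noteq> k" using y00 by auto
  then have "word_dim k < word_dim m" using subface_dim[OF m(2)] subface_dim_eq[OF m(2)] by fastforce
  then have "x \<gamma> m \<noteq> 0" using above m by auto
  then have "atom_cell \<beta> m k" "atom_cell (-\<beta>) m k"
    using table_below_is_atom_cell[OF x _ _ m(2)] k z by auto
  then show False using atom_cell_disjoint[OF _ _ b(1)] \<open>m \<noteq> k\<close> by blast
qed

lemma inj_on_table_cells: "inj_on table_cells {x. is_table n x}"
proof (rule inj_onI)
  fix x y assume "x \<in> {x. is_table n x}" "y \<in> {x. is_table n x}" and eq: "table_cells x = table_cells y"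
  then have x: "is_table n x" and y: "is_table n y" by auto
  have "x \<alpha> k = y \<alpha> k" for \<alpha> k
  proof (induction "n - word_dim k" arbitrary: k \<alpha> rule: less_induct)
    case less
    show ?case
    proof (cases "k \<in> words n")
      case False
      then show ?thesis using is_tableD(3)[OF x] is_tableD(3)[OF y] by simp
    next
      case True
      have above: "x \<beta> m = y \<beta> m" if "word_dim k < word_dim m" for \<beta> m
      proof (cases "m \<in> words n")
        case m: True
        have "word_dim m \<le> n" using word_dim_le_length[of m] length_words[OF m] by simp
        then show ?thesis using less that by auto
      qed (use is_tableD(3)[OF x] is_tableD(3)[OF y] in simp)
      have "x \<alpha> k \<noteq> 0 \<longleftrightarrow> y \<alpha> k \<noteq> 0"
        using table_cells_determine_step[OF x y eq above, where \<beta> = \<alpha>]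
          table_cells_determine_step[OF y x eq[symmetric] above[symmetric], where \<beta> = \<alpha>] by blast
      then show ?thesis using table_values[OF x, of \<alpha> k] table_values[OF y, of \<alpha> k] by auto
    qed
  qed
  then show "x = y" by (intro ext)
qed

section \<open>Tables are composites of atoms\<close>

definition atom_table :: "int list \<Rightarrow> int \<Rightarrow> int list \<Rightarrow> int" where
  "atom_table a = (\<lambda>\<alpha> k. of_bool (\<alpha> \<in> signs \<and> atom_cell \<alpha> a k))"

lemma sum_vertices_atom_cell:
  "a \<in> words n \<Longrightarrow> \<alpha> \<in> signs \<Longrightarrow>
    (\<Sum>k | k \<in> words n \<and> word_dim k = 0. (of_bool (atom_cell \<alpha> a k) :: int)) = 1"
proof (induction n arbitrary: a \<alpha>)
  case 0
  have "{u::int list. u = [] \<and> word_dim u = 0} = {[]}" by auto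
  then show ?case using 0 by simp
next
  case (Suc n)
  obtain b m where [simp]: "a = b # m" using Suc.prems by (cases a) auto
  have m: "m \<in> words n" using Suc.prems by simp
  have "(of_bool (atom_cell \<alpha> a (-1 # k)) :: int) + of_bool (atom_cell \<alpha> a (1 # k))
      = of_bool (atom_cell \<alpha> m k)" for k
    using Suc.prems by auto
  then show ?case using Suc.IH[OF m Suc.prems(2)] by (simp add: sum_vertices_Suc)
qed

lemma is_table_atom:
  assumes a: "a \<in> words n"
  shows "is_table n (atom_table a)"
  unfolding is_table_def
proof (intro conjI allI ballI impI)
  fix \<alpha> k
  show "atom_table a \<alpha> k \<ge> 0" by (simp add: atom_table_def)
  assume ne: "atom_table a \<alpha> k \<noteq> 0"
  then have "\<alpha> \<in> signs" "atom_cell \<alpha> a k" by (simp_all add: atom_table_def)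
  then show "\<alpha> \<in> signs" "k \<in> words n" using subface_words[OF atom_cell_subface a] by blast+
next
  fix \<alpha> assume al: "\<alpha> \<in> signs"
  show "(\<Sum>k | k \<in> words n \<and> word_dim k = 0. atom_table a \<alpha> k) = 1"
    using sum_vertices_atom_cell[OF a al] al by (simp add: atom_table_def)
  fix k assume "k \<in> words n"
  then show "chain_bd (atom_table a \<alpha>) k = atom_table a 1 k - atom_table a (-1) k"
    using chain_bd_atom[OF a _ al, of k] al by (simp add: atom_table_def)
qed

lemma atom_table_nonneg: "atom_table a \<alpha> k \<ge> 0"
  by (simp add: atom_table_def)

lemma table_cells_atom: "table_cells (atom_table a) = {k. subface k a}"
proof -
  have "\<exists>\<alpha> m. atom_table a \<alpha> m \<noteq> 0 \<and> subface k m" if "subface k a" for k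
    using that by (intro exI[of _ 1] exI[of _ a]) (simp add: atom_table_def)
  moreover have "subface k a" if "atom_table a \<alpha> m \<noteq> 0" "subface k m" for k \<alpha> m
    using that subface_trans atom_cell_subface by (fastforce simp: atom_table_def)
  ultimately show ?thesis unfolding table_cells_def by blast
qed

lemma atom_table_same_dim: "word_dim a \<le> word_dim k \<Longrightarrow> atom_table a \<alpha> k = of_bool (\<alpha> \<in> signs \<and> k = a)"
  using subface_dim[of k a] subface_dim_eq[of k a] atom_cell_subface[of \<alpha> a k]
  by (auto simp: atom_table_def)

lemma chain_bd_sum: "finite W \<Longrightarrow> chain_bd (\<lambda>u. \<Sum>a\<in>W. f a u) k = (\<Sum>a\<in>W. chain_bd (f a) k)"
  by (induction W rule: finite_induct) (auto simp: chain_bd_add)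

text \<open>The level of a partial decomposition into atoms: \<open>q = Suc n\<close> with
  \<open>W = {}\<close> holds for every table, and at \<open>q = 0\<close> the table is the sum of
  the atoms in \<open>W\<close>.\<close>

definition atomic_above :: "nat \<Rightarrow> nat \<Rightarrow> int list set \<Rightarrow> (int \<Rightarrow> int list \<Rightarrow> int) \<Rightarrow> bool" where
  "atomic_above n q W x \<longleftrightarrow> W \<subseteq> words n \<and> (\<forall>a\<in>W. q \<le> word_dim a) \<and>
    (\<forall>\<alpha> k. q \<le> word_dim k \<longrightarrow> x \<alpha> k = (\<Sum>a\<in>W. atom_table a \<alpha> k))"

lemma atomic_above_finite: "atomic_above n q W x \<Longrightarrow> finite W"
  unfolding atomic_above_def using finite_subset[OF _ finite_words] by blast

text \<open>One dimension below the known part, the boundary relation still gives the difference of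
  the two signs.\<close>

lemma atomic_above_chain_bd:
  assumes x: "is_table n x" and W: "atomic_above n (Suc q) W x" and k: "k \<in> words n" "word_dim k = q"
  shows "x 1 k - x (-1) k = (\<Sum>a\<in>W. atom_table a 1 k) - (\<Sum>a\<in>W. atom_table a (-1) k)"
proof -
  have Ws: "a \<in> words n" if "a \<in> W" for a using W that by (auto simp: atomic_above_def)
  have "x 1 k - x (-1) k = chain_bd (x 1) k" using is_tableD(5)[OF x _ k(1)] by simp
  also have "\<dots> = chain_bd (\<lambda>u. \<Sum>a\<in>W. atom_table a 1 u) k"
    using W k by (intro chain_bd_cong[OF _ k(1)]) (auto simp: atomic_above_def)
  also have "\<dots> = (\<Sum>a\<in>W. chain_bd (atom_table a 1) k)"
    using chain_bd_sum[OF atomic_above_finite[OF W], of "\<lambda>a. atom_table a 1"] by simp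
  also have "\<dots> = (\<Sum>a\<in>W. atom_table a 1 k - atom_table a (-1) k)"
    using is_tableD(5)[OF is_table_atom[OF Ws] _ k(1)] by (intro sum.cong) auto
  finally show ?thesis by (simp add: sum_subtractf)
qed

text \<open>
  An atom of \<open>W\<close> of minimal weight can be split off first, because no other atom of \<open>W\<close> has an
  output cell among its input cells.
\<close>

lemma atomic_above_split:
  assumes x: "is_table n x" and W: "atomic_above n (Suc q) W x" and ne: "W \<noteq> {}"
  obtains a y z where "a \<in> W" "composable (table_cat n) q y z" "x = cmp (table_cat n) q y z"
    "atomic_above n (Suc q) {a} y" "atomic_above n (Suc q) (W - {a}) z"
proof -
  have fin: "finite W" by (rule atomic_above_finite[OF W])
  obtain a where a: "a \<in> W" and min: "\<And>b. b \<in> W \<Longrightarrow> word_weight a \<le> word_weight b"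
    using ex_min_if_finite[of "word_weight ` W"] fin ne by (fastforce simp: not_less)
  have Ww: "b \<in> words n" "Suc q \<le> word_dim b" if "b \<in> W" for b
    using W that by (auto simp: atomic_above_def)
  \<comment> \<open>An input cell \<open>k\<close> of \<open>a\<close> is lighter than
    \<open>a\<close>, while an output cell of any atom of \<open>W\<close> is heavier than that atom
    and so heavier than \<open>a\<close>. Hence nothing compensates the coefficient -1 of
    \<open>k\<close>, and \<open>k\<close> belongs to the source of \<open>x\<close>.\<close>
  have key: "x (-1) k \<ge> 1" if k: "atom_cell (-1) a k" "word_dim k = q" for k
  proof -
    have kw: "k \<in> words n" using subface_words[OF atom_cell_subface[OF k(1)] Ww(1)[OF a]] by simp
    have "k \<noteq> a" using Ww(2)[OF a] k by auto
    then have lt: "word_weight k < word_weight a"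
      using atom_cell_weight[OF k(1) _ Ww(1)[OF a]] by simp
    have "atom_table b 1 k = 0" if b: "b \<in> W" for b
    proof (rule ccontr)
      assume "atom_table b 1 k \<noteq> 0"
      then have "atom_cell 1 b k" by (simp add: atom_table_def)
      moreover have "k \<noteq> b" using Ww(2)[OF b] k by auto
      ultimately have "word_weight b < word_weight k"
        using atom_cell_weight[OF _ _ Ww(1)[OF b], of 1 k] by simp
      then show False using lt min[OF b] by simp
    qed
    then have "(\<Sum>b\<in>W. atom_table b 1 k) = 0" by simp
    moreover have "atom_table a (-1) k \<le> (\<Sum>b\<in>W. atom_table b (-1) k)"
      using atom_table_nonneg by (intro member_le_sum[OF a _ fin]) auto
    moreover have "atom_table a (-1) k = 1" using k by (simp add: atom_table_def)
    ultimately have "x 1 k - x (-1) k \<le> - 1"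
      using atomic_above_chain_bd[OF x W kw k(2)] by simp
    then show ?thesis using is_tableD(1)[OF x, of 1 k] by simp
  qed
  let ?A = "atom_table a" and ?s = "table_bd (-1) q" and ?t = "table_bd 1 q"
  \<comment> \<open>\<open>y\<close> is the atom \<open>a\<close> together with the cells of the
    q-source of \<open>x\<close> that \<open>a\<close> does not consume; \<open>z\<close> is what
    remains when x = y *_q z is solved for the second factor.\<close>
  define y where "y = (\<lambda>\<alpha> k. ?A \<alpha> k + ?s x \<alpha> k - ?s ?A \<alpha> k)"
  define z where "z = (\<lambda>\<alpha> k. x \<alpha> k + ?t y \<alpha> k - y \<alpha> k)"
  have A: "is_table n ?A" by (rule is_table_atom[OF Ww(1)[OF a]])
  have yv: "\<alpha> \<in> signs \<Longrightarrow> word_dim k < q \<Longrightarrow> y \<alpha> k = x \<alpha> k"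
    "word_dim k = q \<Longrightarrow> y (-1) k = x (-1) k" "q < word_dim k \<Longrightarrow> y \<alpha> k = ?A \<alpha> k" for \<alpha> k
    by (auto simp: y_def table_bd_def)
  have y: "is_table n y"
    unfolding y_def
  proof (rule is_table_affine[OF A is_table_bd[OF x] is_table_bd[OF A]])
    fix \<alpha> k assume "\<alpha> \<in> signs"
    then show "?A \<alpha> k + ?s x \<alpha> k - ?s ?A \<alpha> k \<ge> 0"
      using key[of k] is_tableD(1)[OF x] 
      by (cases "word_dim k = q"; cases "atom_cell (-1) a k")
        (auto simp: table_bd_def atom_table_def)
  qed auto
  have xW: "x \<alpha> k = ?A \<alpha> k + (\<Sum>b\<in>W - {a}. atom_table b \<alpha> k)" if "q < word_dim k" for \<alpha> k
    using W that fin a by (simp add: atomic_above_def sum.remove)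
  have z: "is_table n z"
    unfolding z_def
  proof (rule is_table_affine[OF x is_table_bd[OF y] y])
    fix \<alpha> k assume al: "\<alpha> \<in> signs"
    consider "word_dim k < q" | "word_dim k = q" | "q < word_dim k" by linarith
    then show "x \<alpha> k + ?t y \<alpha> k - y \<alpha> k \<ge> 0"
    proof cases
      case 3
      then show ?thesis using xW[OF 3, of \<alpha>] yv(3)[OF 3] atom_table_nonneg
        by (auto simp: table_bd_def intro: sum_nonneg)
    next
      case 2
      then show ?thesis using al yv(2)[OF 2] is_tableD(1)[OF y, of 1 k] is_tableD(1)[OF x, of 1 k]
        by (auto simp: table_bd_def)
    next
      case 1
      then show ?thesis using al yv(1)[OF al 1] is_tableD(1)[OF x]
        by (auto simp: table_bd_def)
    qed
  qed simp
  have sy: "?s y = ?s x" unfolding y_def table_bd_affine by (simp add: table_bd_bd)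
  have "?s z = ?t y" unfolding z_def table_bd_affine by (simp add: table_bd_bd sy)
  then have comp: "composable (table_cat n) q y z" using y z by (simp add: composable_def)
  have eq: "x = cmp (table_cat n) q y z" by (simp add: z_def fun_eq_iff)
  have "atomic_above n (Suc q) {a} y" using Ww[OF a] yv(3) by (auto simp: atomic_above_def)
  moreover have "atomic_above n (Suc q) (W - {a}) z"
    using Ww yv(3) xW by (auto simp: atomic_above_def z_def table_bd_def)
  ultimately show thesis using that a comp eq by blast
qed

text \<open>A q-cell is not at once input and output of a single atom. If it is one of them, the
  difference of signs fixes both its coefficients in \<open>x\<close>; otherwise these two
  coefficients are equal, and the cells for which they are 1 form the set \<open>E\<close> and are
  added as atoms of dimension \<open>q\<close>.\<close>

lemma atomic_above_refine:
  assumes x: "is_table n x" and W: "atomic_above n (Suc q) W x" and card: "card W \<le> 1"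
  shows "\<exists>V. atomic_above n q V x"
proof -
  have fin: "finite W" by (rule atomic_above_finite[OF W])
  have Ww: "b \<in> words n" "Suc q \<le> word_dim b" if "b \<in> W" for b
    using W that by (auto simp: atomic_above_def)
  define s where "s = (\<lambda>\<alpha> k. \<Sum>a\<in>W. atom_table a \<alpha> k)"
  define E where "E = {k \<in> words n. word_dim k = q \<and> x 1 k \<noteq> 0 \<and> s 1 k = 0}"
  have E: "finite E" "W \<inter> E = {}" using Ww(2) by (fastforce simp: E_def)+
  have s01: "s \<alpha> k = 0 \<or> s \<alpha> k = 1" and sd: "word_dim k = q \<Longrightarrow> s 1 k = 0 \<or> s (-1) k = 0" for \<alpha> k
  proof -
    consider "W = {}" | a where "W = {a}" using card card_1_singletonE[of W] fin
      by (metis One_nat_def card_0_eq le_SucE le_zero_eq)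
    then have "(s \<alpha> k = 0 \<or> s \<alpha> k = 1) \<and> (word_dim k = q \<longrightarrow> s 1 k = 0 \<or> s (-1) k = 0)"
    proof cases
      case (2 a)
      then show ?thesis using atom_cell_disjoint[of 1 a k] Ww(2)[of a]
        by (auto simp: s_def atom_table_def)
    qed (simp add: s_def)
    then show "s \<alpha> k = 0 \<or> s \<alpha> k = 1" "word_dim k = q \<Longrightarrow> s 1 k = 0 \<or> s (-1) k = 0" by auto
  qed
  have Es: "(\<Sum>e\<in>E. atom_table e \<alpha> k) = of_bool (\<alpha> \<in> signs \<and> k \<in> E)" if "q \<le> word_dim k" for \<alpha> k
  proof -
    have "(\<Sum>e\<in>E. atom_table e \<alpha> k) = (\<Sum>e\<in>E. if e = k then of_bool (\<alpha> \<in> signs) else 0)"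
      using that by (intro sum.cong) (auto simp: E_def atom_table_same_dim)
    then show ?thesis using E by (auto simp: sum.delta)
  qed
  have "atomic_above n q (W \<union> E) x"
    unfolding atomic_above_def
  proof (intro conjI allI impI ballI)
    show "W \<union> E \<subseteq> words n" using Ww by (auto simp: E_def)
    show "q \<le> word_dim a" if "a \<in> W \<union> E" for a using that Ww(2)[of a] by (auto simp: E_def)
    fix \<alpha> k assume k: "q \<le> word_dim k"
    have "(\<Sum>a\<in>W \<union> E. atom_table a \<alpha> k) = s \<alpha> k + of_bool (\<alpha> \<in> signs \<and> k \<in> E)"
      using sum.union_disjoint[OF fin E, of "\<lambda>a. atom_table a \<alpha> k"] Es[OF k] by (simp add: s_def)
    also have "\<dots> = x \<alpha> k"
    proof (cases "word_dim k = q \<and> \<alpha> \<in> signs \<and> k \<in> words n")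
      case True
      have "x 1 k - x (-1) k = s 1 k - s (-1) k"
        using atomic_above_chain_bd[OF x W] True by (simp add: s_def)
      then show ?thesis
        using True s01[of 1 k] s01[of "-1" k] sd[of k] table_values[OF x, of 1 k]
          table_values[OF x, of "-1" k] by (auto simp: E_def)
    next
      case False
      then consider "Suc q \<le> word_dim k" | "\<alpha> \<notin> signs" | "k \<notin> words n" using k by linarith
      then show ?thesis
      proof cases
        case 1
        then show ?thesis using W by (auto simp: atomic_above_def s_def E_def)
      next
        case 2
        then show ?thesis using is_tableD(2)[OF x 2, of k] by (auto simp: s_def atom_table_def)
      next
        case 3
        then have "atom_table a \<alpha> k = 0" if "a \<in> W" for a
          using is_tableD(3)[OF is_table_atom[OF Ww(1)[OF that]]] by blast
        then show ?thesis using is_tableD(3)[OF x 3, of \<alpha>] 3 by (simp add: s_def E_def)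
      qed
    qed
    finally show "x \<alpha> k = (\<Sum>a\<in>W \<union> E. atom_table a \<alpha> k)" by simp
  qed
  then show ?thesis by blast
qed

text \<open>At a given level, atoms are split off until each factor has at most one; then the level
  can be lowered.\<close>

lemma atomic_above_composite:
  "is_table n x \<Longrightarrow> atomic_above n q W x \<Longrightarrow> x \<in> composites (table_cat n) (atom_table ` words n)"
proof (induction q arbitrary: x W)
  case 0
  have fin: "finite W" by (rule atomic_above_finite[OF 0(2)])
  have x: "x = (\<lambda>\<alpha> k. \<Sum>a\<in>W. atom_table a \<alpha> k)" and W: "W \<subseteq> words n"
    using 0(2) by (auto simp: atomic_above_def fun_eq_iff)
  \<comment> \<open>Each atom contributes 1 to the sum of the vertex coefficients, so this sum
    counts the atoms.\<close>
  have "1 = (\<Sum>k | k \<in> words n \<and> word_dim k = 0. x 1 k)" using is_tableD(4)[OF 0(1), of 1] by simp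
  also have "\<dots> = (\<Sum>a\<in>W. \<Sum>k | k \<in> words n \<and> word_dim k = 0. atom_table a 1 k)"
    unfolding x by (rule sum.swap)
  also have "\<dots> = (\<Sum>a\<in>W. 1)"
    using is_tableD(4)[OF is_table_atom, of _ n 1] W by (intro sum.cong) auto
  finally have "card W = 1" by simp
  then obtain a where "W = {a}" using card_1_singletonE by blast
  then show ?case using x W by (auto intro!: composites.base)
next
  case (Suc q)
  show ?case
    using Suc.prems
  proof (induction "card W" arbitrary: x W rule: less_induct)
    case less
    have fin: "finite W" by (rule atomic_above_finite[OF less.prems(2)])
    show ?case
    proof (cases "card W \<le> 1")
      case True
      then show ?thesis using atomic_above_refine[OF less.prems True] Suc.IH less.prems by blast
    next
      case False
      then have "W \<noteq> {}" by auto
      then obtain a y z where s: "a \<in> W" "composable (table_cat n) q y z" "x = cmp (table_cat n) q y z"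
        "atomic_above n (Suc q) {a} y" "atomic_above n (Suc q) (W - {a}) z"
        using atomic_above_split[OF less.prems] by metis
      note t = table_composable(1,2)[OF s(2)]
      have "y \<in> composites (table_cat n) (atom_table ` words n)"
        using less.hyps[OF _ t(1) s(4)] False by simp
      moreover have "z \<in> composites (table_cat n) (atom_table ` words n)"
        using less.hyps[OF _ t(2) s(5)] card_Diff1_less[OF fin s(1)] by simp
      ultimately show ?thesis using s(2,3) composites.cmp by metis
    qed
  qed
qed

lemma table_composite:
  assumes x: "is_table n x"
  shows "x \<in> composites (table_cat n) (atom_table ` words n)"
proof -
  have "x \<alpha> k = 0" if "Suc n \<le> word_dim k" for \<alpha> k
    using that is_tableD(3)[OF x, of k \<alpha>] word_dim_le_length[of k] length_words[of k n] by fastforce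
  then have "atomic_above n (Suc n) {} x" by (simp add: atomic_above_def)
  then show ?thesis using atomic_above_composite x by blast
qed

section \<open>Existence of the omega-category of the cube\<close>

definition image_cat :: "('a \<Rightarrow> 'b) \<Rightarrow> 'a omega_cat \<Rightarrow> 'b omega_cat" where
  "image_cat g C = \<lparr>carrier = g ` carrier C,
    bd = (\<lambda>\<alpha> n u. g (bd C \<alpha> n (inv_into (carrier C) g u))),
    cmp = (\<lambda>n u v. g (cmp C n (inv_into (carrier C) g u) (inv_into (carrier C) g v)))\<rparr>"

lemma carrier_image_cat [simp]: "carrier (image_cat g C) = g ` carrier C"
  by (simp add: image_cat_def)

context
  fixes C :: "'a omega_cat" and g :: "'a \<Rightarrow> 'b"
  assumes C: "omega_category C" and inj: "inj_on g (carrier C)"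
begin

interpretation omega_category C by (rule C)

lemma bd_image_cat: "x \<in> carrier C \<Longrightarrow> bd (image_cat g C) \<alpha> n (g x) = g (bd C \<alpha> n x)"
  by (simp add: image_cat_def inv_into_f_f[OF inj])

lemma cmp_image_cat:
  "x \<in> carrier C \<Longrightarrow> y \<in> carrier C \<Longrightarrow> cmp (image_cat g C) n (g x) (g y) = g (cmp C n x y)"
  by (simp add: image_cat_def inv_into_f_f[OF inj])

lemma composable_image_cat:
  "x \<in> carrier C \<Longrightarrow> y \<in> carrier C
    \<Longrightarrow> composable (image_cat g C) n (g x) (g y) \<longleftrightarrow> composable C n x y"
  using inj_on_eq_iff[OF inj bd_closed bd_closed] by (simp add: composable_def bd_image_cat)

lemma composable_image_catE:
  assumes "composable (image_cat g C) n u v"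
  obtains x y where "u = g x" "v = g y" "composable C n x y" "x \<in> carrier C" "y \<in> carrier C"
proof -
  obtain x y where "u = g x" "v = g y" "x \<in> carrier C" "y \<in> carrier C"
    using assms by (auto simp: composable_def)
  then show thesis using that assms composable_image_cat by blast
qed

lemma omega_category_image_cat: "omega_category (image_cat g C)"
proof
  fix u \<alpha> n assume "u \<in> carrier (image_cat g C)" "\<alpha> \<in> signs"
  then show "bd (image_cat g C) \<alpha> n u \<in> carrier (image_cat g C)"
    by (auto simp: bd_image_cat bd_closed)
next
  fix n u v assume "composable (image_cat g C) n u v"
  then show "cmp (image_cat g C) n u v \<in> carrier (image_cat g C)"
    by (auto elim!: composable_image_catE simp: cmp_image_cat cmp_closed)
next
  fix u \<alpha> \<beta> and m n :: nat
  assume "u \<in> carrier (image_cat g C)" "\<alpha> \<in> signs" "\<beta> \<in> signs" "m < n"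
  then show "bd (image_cat g C) \<beta> m (bd (image_cat g C) \<alpha> n u) = bd (image_cat g C) \<beta> m u"
    by (auto simp: bd_image_cat bd_closed bd_bd_less)
next
  fix u \<alpha> \<beta> and m n :: nat
  assume "u \<in> carrier (image_cat g C)" "\<alpha> \<in> signs" "\<beta> \<in> signs" "n \<le> m"
  then show "bd (image_cat g C) \<beta> m (bd (image_cat g C) \<alpha> n u) = bd (image_cat g C) \<alpha> n u"
    by (auto simp: bd_image_cat bd_closed bd_bd_ge)
next
  fix u n assume "u \<in> carrier (image_cat g C)"
  then show "cmp (image_cat g C) n (src (image_cat g C) n u) u = u"
    "cmp (image_cat g C) n u (tgt (image_cat g C) n u) = u"
    by (auto simp: bd_image_cat bd_closed cmp_image_cat cmp_src cmp_tgt)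
next
  fix n u v assume "composable (image_cat g C) n u v"
  then show "src (image_cat g C) n (cmp (image_cat g C) n u v) = src (image_cat g C) n u"
    "tgt (image_cat g C) n (cmp (image_cat g C) n u v) = tgt (image_cat g C) n v"
    by (auto elim!: composable_image_catE simp: cmp_image_cat cmp_closed bd_image_cat src_cmp tgt_cmp)
next
  fix n u v \<alpha> m assume "composable (image_cat g C) n u v" "\<alpha> \<in> signs" "m \<noteq> n"
  then show "bd (image_cat g C) \<alpha> m (cmp (image_cat g C) n u v)
      = cmp (image_cat g C) n (bd (image_cat g C) \<alpha> m u) (bd (image_cat g C) \<alpha> m v)"
    by (auto elim!: composable_image_catE
        simp: cmp_image_cat cmp_closed bd_image_cat bd_closed bd_cmp)
next
  fix n u v w
  assume c: "composable (image_cat g C) n u v" "composable (image_cat g C) n (cmp (image_cat g C) n u v) w"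
    "composable (image_cat g C) n v w" "composable (image_cat g C) n u (cmp (image_cat g C) n v w)"
  obtain x y where x: "u = g x" "v = g y" "composable C n x y" "x \<in> carrier C" "y \<in> carrier C"
    by (rule composable_image_catE[OF c(1)])
  obtain z where z: "w = g z" "z \<in> carrier C" using c(3) by (auto simp: composable_def)
  have yz: "composable C n y z" using c(3) x z composable_image_cat by simp
  show "cmp (image_cat g C) n (cmp (image_cat g C) n u v) w
      = cmp (image_cat g C) n u (cmp (image_cat g C) n v w)"
    using c x z yz cmp_assoc[of n x y z]
    by (simp add: cmp_image_cat cmp_closed composable_image_cat)
next
  fix n m u v w t
  assume c: "m \<noteq> n" "composable (image_cat g C) n u v" "composable (image_cat g C) n w t"
    "composable (image_cat g C) m (cmp (image_cat g C) n u v) (cmp (image_cat g C) n w t)"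
    "composable (image_cat g C) m u w" "composable (image_cat g C) m v t"
    "composable (image_cat g C) n (cmp (image_cat g C) m u w) (cmp (image_cat g C) m v t)"
  obtain x y where x: "u = g x" "v = g y" "composable C n x y" "x \<in> carrier C" "y \<in> carrier C"
    by (rule composable_image_catE[OF c(2)])
  obtain z s where z: "w = g z" "t = g s" "composable C n z s" "z \<in> carrier C" "s \<in> carrier C"
    by (rule composable_image_catE[OF c(3)])
  have xz: "composable C m x z" "composable C m y s" using c(5,6) x z composable_image_cat by simp_all
  show "cmp (image_cat g C) m (cmp (image_cat g C) n u v) (cmp (image_cat g C) n w t)
     = cmp (image_cat g C) n (cmp (image_cat g C) m u w) (cmp (image_cat g C) m v t)"
    using c x z xz interchange[of m n x y z s]
    by (simp add: cmp_image_cat cmp_closed composable_image_cat)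
next
  fix u assume "u \<in> carrier (image_cat g C)"
  then obtain x where "u = g x" "x \<in> carrier C" by auto
  then show "\<exists>n. src (image_cat g C) n u = u \<and> tgt (image_cat g C) n u = u"
    using finite_dimensional[of x] by (auto simp: bd_image_cat) metis
qed

lemma composites_carrier: "x \<in> composites C S \<Longrightarrow> S \<subseteq> carrier C \<Longrightarrow> x \<in> carrier C"
  by (induction rule: composites.induct) (auto simp: cmp_closed)

lemma composites_image_cat:
  "x \<in> composites C S \<Longrightarrow> S \<subseteq> carrier C \<Longrightarrow> g x \<in> composites (image_cat g C) (g ` S)"
proof (induction rule: composites.induct)
  case (cmp x y p)
  have xy: "x \<in> carrier C" "y \<in> carrier C" using cmp composites_carrier by blast+
  then have "composable (image_cat g C) p (g x) (g y)" using cmp composable_image_cat by simp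
  then have "cmp (image_cat g C) p (g x) (g y) \<in> composites (image_cat g C) (g ` S)"
    using cmp by (intro composites.cmp) auto
  then show ?case using cmp_image_cat[OF xy] by simp
qed (auto intro: composites.base)

end

text \<open>Treats \<open>b_words\<close> (sign -1) and \<open>e_words\<close> (sign 1) together,
  since the two prescribed letters differ by a sign.\<close>

definition facet_words :: "int \<Rightarrow> nat \<Rightarrow> int list set" where
  "facet_words \<gamma> i =
    {y \<in> words i. \<forall>l \<in> {1..i}. y ! (l - 1) \<noteq> 0 \<longrightarrow> y ! (l - 1) = \<gamma> * (-1) ^ (l + 1)}"

lemma b_words_facet_words: "b_words i = facet_words (-1) i"
  by (simp add: b_words_def facet_words_def)

lemma e_words_facet_words: "e_words i = facet_words 1 i"
  by (simp add: e_words_def facet_words_def)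

lemma facet_words_0 [simp]: "facet_words \<gamma> 0 = {[]}"
  by (auto simp: facet_words_def)

text \<open>Counting positions from 0 turns the exponent \<open>l + 1\<close> into
  \<open>l + 2\<close>, which has the parity of \<open>l\<close>.\<close>

lemma facet_words_iff:
  "y \<in> facet_words \<gamma> i \<longleftrightarrow> y \<in> words i \<and> (\<forall>l<i. y ! l \<noteq> 0 \<longrightarrow> y ! l = \<gamma> * (-1) ^ l)"
proof -
  have "{1..i} = Suc ` {..<i}" by (simp add: image_Suc_lessThan)
  then show ?thesis unfolding facet_words_def by auto
qed

lemma facet_words_Cons [simp]:
  assumes "\<gamma> \<in> signs"
  shows "c # y \<in> facet_words \<gamma> (Suc i) \<longleftrightarrow> (c = 0 \<or> c = \<gamma>) \<and> y \<in> facet_words (-\<gamma>) i"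
  using assms by (auto simp: facet_words_iff All_less_Suc2)

lemma facet_words_length: "y \<in> facet_words \<gamma> i \<Longrightarrow> length y = i"
  by (simp add: facet_words_def words_def)

text \<open>The sign in \<open>facet_words\<close> counts all earlier zeros of \<open>x\<close>,
  that in \<open>atom_cell\<close> only the retained ones. The two agree in codimension 1, where
  every earlier zero is retained.\<close>

lemma subst_zeros_facet_words:
  "y \<in> facet_words \<gamma> (word_dim x) \<Longrightarrow> \<gamma> \<in> signs \<Longrightarrow>
    subface (subst_zeros x y) x \<and> word_dim (subst_zeros x y) = word_dim y \<and>
    (word_dim x = word_dim y \<longrightarrow> subst_zeros x y = x) \<and>
    (word_dim x = Suc (word_dim y) \<longrightarrow> atom_cell \<gamma> x (subst_zeros x y))"
proof (induction x arbitrary: y \<gamma>)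
  case (Cons a x)
  show ?case
  proof (cases "a = 0")
    case True
    then obtain c z where [simp]: "y = c # z" using facet_words_length[OF Cons.prems(1)] by (cases y) auto
    have z: "z \<in> facet_words (-\<gamma>) (word_dim x)" "c = 0 \<or> c = \<gamma>" using Cons.prems True by auto
    have "word_dim z \<le> word_dim x" using word_dim_le_length[of z] facet_words_length[OF z(1)] by simp
    then show ?thesis using True z(2) Cons.IH[OF z(1) signs_uminus[OF Cons.prems(2)]] Cons.prems(2)
      by auto
  next
    case False
    then have y: "y \<in> facet_words \<gamma> (word_dim x)" using Cons.prems by simp
    note IH = Cons.IH[OF y Cons.prems(2)]
    show ?thesis
    proof (cases y)
      case Nil
      then have "word_dim x = 0" using facet_words_length[OF y] by simp
      then show ?thesis using Nil False by simp
    qed (use False IH in auto)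
  qed
qed auto

lemma atom_facet_subst_zeros:
  "atom_cell \<gamma> x m \<Longrightarrow> \<gamma> \<in> signs \<Longrightarrow> word_dim x = Suc (word_dim m) \<Longrightarrow>
    \<exists>y \<in> facet_words \<gamma> (word_dim x). subst_zeros x y = m \<and> word_dim y = word_dim m"
proof (induction \<gamma> x m rule: atom_cell.induct)
  case (2 \<gamma> a x b m)
  have rep: "replicate (word_dim x) 0 \<in> facet_words \<delta> (word_dim x)" for \<delta>
    by (auto simp: facet_words_def)
  have self: "subst_zeros z (replicate (word_dim z) 0) = z" for z
  proof (induction z)
    case (Cons b z)
    then show ?case by (cases "word_dim z") auto
  qed simp
  show ?case
  proof (cases "a = 0")
    case True
    show ?thesis
    proof (cases "b = 0")
      case b: True
      then have "\<exists>y \<in> facet_words (-\<gamma>) (word_dim x). subst_zeros x y = m \<and> word_dim y = word_dim m"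
        using 2(1)[OF True] 2(4-6) True signs_uminus[OF 2(5)] by auto
      then obtain y where "y \<in> facet_words (-\<gamma>) (word_dim x)" "subst_zeros x y = m" "word_dim y = word_dim m"
        by blast
      then show ?thesis using True b 2(5) by (intro bexI[of _ "0 # y"]) auto
    next
      case False
      then have b: "b = \<gamma>" "atom_cell \<gamma> x m" "word_dim x = word_dim m" using 2(4,6) True by auto
      then have "m = x" using subface_dim_eq[OF atom_cell_subface[OF b(2) 2(5)]] by simp
      then show ?thesis using True b 2(5) rep self[of x]
        by (intro bexI[of _ "\<gamma> # replicate (word_dim x) 0"]) auto
    qed
  next
    case False
    then have "\<exists>y \<in> facet_words \<gamma> (word_dim x). subst_zeros x y = m \<and> word_dim y = word_dim m"
      using 2(3)[OF False] 2(4-6) by auto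
    then obtain y where y: "y \<in> facet_words \<gamma> (word_dim x)" "subst_zeros x y = m" "word_dim y = word_dim m"
      by blast
    have "y \<noteq> []" using facet_words_length[OF y(1)] 2(6) False by auto
    then show ?thesis using False y 2(4) by (intro bexI[of _ y]) (auto simp: neq_Nil_conv)
  qed
qed auto

definition facets :: "int \<Rightarrow> int list \<Rightarrow> int list set" where
  "facets \<gamma> x = {m. atom_cell \<gamma> x m \<and> word_dim x = Suc (word_dim m)}"

lemma subst_zeros_eq_facets:
  assumes "\<gamma> \<in> signs" "word_dim x = Suc p"
  shows "{subst_zeros x y | y. y \<in> facet_words \<gamma> (Suc p) \<and> word_dim y = p} = facets \<gamma> x"
proof -
  have "\<exists>y. m = subst_zeros x y \<and> y \<in> facet_words \<gamma> (Suc p) \<and> word_dim y = p"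
    if "atom_cell \<gamma> x m" "word_dim m = p" for m
    using atom_facet_subst_zeros[of \<gamma> x m] that assms by auto
  moreover have "atom_cell \<gamma> x (subst_zeros x y)" "word_dim (subst_zeros x y) = p"
    if "y \<in> facet_words \<gamma> (Suc p)" "word_dim y = p" for y
    using subst_zeros_facet_words[of y \<gamma> x] that assms by auto
  ultimately show ?thesis using assms(2) unfolding facets_def by auto
qed

lemma facet_between:
  "subface k x \<Longrightarrow> word_dim k < word_dim x
    \<Longrightarrow> \<exists>m. subface k m \<and> subface m x \<and> word_dim x = Suc (word_dim m)"
proof (induction k x rule: subface.induct)
  case (2 a k b x)
  show ?case
  proof (cases "b = 0 \<and> a \<noteq> 0")
    case True
    then show ?thesis using 2(2) by (intro exI[of _ "a # x"]) auto
  next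
    case False
    then have "\<exists>m. subface k m \<and> subface m x \<and> word_dim x = Suc (word_dim m)" using 2 by auto
    then obtain m where "subface k m" "subface m x" "word_dim x = Suc (word_dim m)" by blast
    then show ?thesis using False 2(2) by (intro exI[of _ "b # m"]) auto
  qed
qed auto

text \<open>A chain of faces of codimension 1 leads from a face to any of its subfaces, and each
  link is an operation \<open>b\<close> or \<open>e\<close> according to the sign of the replaced
  letter.\<close>

lemma R_iff: "R X = {k. \<exists>x\<in>X. subface k x}"
proof -
  have "\<exists>x\<in>X. subface k x" if "k \<in> R X" for k
    using that
  proof (induction rule: R.induct)
    case (base x)
    then show ?case using subface_refl by blast
  next
    case (b x y)
    have "subface (subst_zeros x y) x"
      using subst_zeros_facet_words[of y "-1" x] b(2) b_words_facet_words by simp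
    then show ?case using b(3) subface_trans by blast
  next
    case (e x y)
    have "subface (subst_zeros x y) x"
      using subst_zeros_facet_words[of y 1 x] e(2) e_words_facet_words by simp
    then show ?case using e(3) subface_trans by blast
  qed
  moreover have "subface k x \<Longrightarrow> x \<in> R X \<Longrightarrow> k \<in> R X" for k x
  proof (induction "word_dim x - word_dim k" arbitrary: x)
    case 0
    then show ?case using subface_dim[OF 0(2)] subface_dim_eq[OF 0(2)] by auto
  next
    case (Suc d)
    have "word_dim k < word_dim x" using Suc(2) by simp
    then obtain m where m: "subface k m" "subface m x" "word_dim x = Suc (word_dim m)"
      using facet_between[OF Suc(3)] by blast
    have "m \<in> R X"
    proof (cases "atom_cell 1 x m")
      case True
      then show ?thesis using atom_facet_subst_zeros[OF True _ m(3)] R.e[OF Suc(4)]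
        by (auto simp: e_words_facet_words)
    next
      case False
      then have "atom_cell (-1) x m" using atom_cell_facet[OF m(2,3), of 1] by simp
      then show ?thesis using atom_facet_subst_zeros[OF _ _ m(3), of "-1"] R.b[OF Suc(4)]
        by (auto simp: b_words_facet_words)
    qed
    then show ?case using Suc(1)[of m] Suc(2) m subface_dim[OF m(1)] by auto
  qed
  ultimately show ?thesis using R.base[of _ X] by blast
qed

lemma R_Un: "R (X \<union> Y) = R X \<union> R Y"
  by (auto simp: R_iff)

lemma table_cells_R: "table_cells x = R {m. \<exists>\<alpha>. x \<alpha> m \<noteq> 0}"
  by (auto simp: table_cells_def R_iff)

definition set_cube_cat :: "nat \<Rightarrow> int list set omega_cat" where
  "set_cube_cat n = image_cat table_cells (table_cat n)"

text \<open>Only p-cells of the common boundary \<open>x 1 = y (-1)\<close> can be lost in the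
  formula for the composite. Such a cell either occurs also in \<open>x (-1)\<close>, which is kept,
  or has nonzero boundary coefficient and is thus a face of a cell of \<open>x\<close> of dimension
  p + 1.\<close>

lemma table_cells_cmp:
  assumes c: "composable (table_cat n) p x y"
  shows "table_cells (cmp (table_cat n) p x y) = table_cells x \<union> table_cells y"
proof -
  note t = table_composable[OF c]
  let ?z = "cmp (table_cat n) p x y"
  have z: "is_table n ?z"
    using omega_category.cmp_closed[OF omega_category_table_cat c] by simp
  have zv: "?z \<alpha> k = (if word_dim k < p then x \<alpha> k else if word_dim k = p then if \<alpha> = -1 then x \<alpha> k else y \<alpha> k
      else x \<alpha> k + y \<alpha> k)" if "\<alpha> \<in> signs" for \<alpha> k
    using that t(4)[OF that, of k] t(5)[of k] by (auto simp: table_bd_def)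
  have sg: "\<alpha> \<in> signs" if "x \<alpha> k \<noteq> 0 \<or> y \<alpha> k \<noteq> 0 \<or> ?z \<alpha> k \<noteq> 0" for \<alpha> k
    using that is_tableD(2)[OF t(1), of \<alpha> k] is_tableD(2)[OF t(2), of \<alpha> k] is_tableD(2)[OF z, of \<alpha> k]
    by blast
  have mid: "k \<in> table_cells ?z" if k: "x 1 k \<noteq> 0" "word_dim k = p" for k
  proof (cases "x (-1) k = 0")
    case True
    have kw: "k \<in> words n" using is_tableD(3)[OF t(1)] k by blast
    then have "chain_bd (x 1) k \<noteq> 0" using is_tableD(5)[OF t(1), of 1 k] True k by simp
    then obtain m where m: "subface k m" "word_dim m = Suc (word_dim k)" "x 1 m \<noteq> 0"
      using chain_bd_cong[of k "x 1" "\<lambda>_. 0", OF _ kw] by fastforce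
    then have "?z 1 m \<noteq> 0"
      using zv[of 1 m] k is_tableD(1)[OF t(1), of 1 m] is_tableD(1)[OF t(2), of 1 m] by simp
    then show ?thesis using m(1) unfolding table_cells_def by blast
  next
    case False
    then have "?z (-1) k \<noteq> 0" using zv[of "-1" k] k by simp
    then show ?thesis using subface_refl unfolding table_cells_def by blast
  qed
  have up: "k \<in> table_cells ?z" if "m \<in> table_cells ?z" "subface k m" for k m
    using that subface_trans unfolding table_cells_def by blast
  have "m \<in> table_cells ?z" if m: "x \<alpha> m \<noteq> 0 \<or> y \<alpha> m \<noteq> 0" for \<alpha> m
  proof -
    have al: "\<alpha> \<in> signs" using sg m by blast
    show ?thesis
    proof (cases "?z \<alpha> m = 0")
      case True
      then have "word_dim m = p" "x 1 m \<noteq> 0"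
        using zv[OF al, of m] m t(4)[OF al, of m] t(5)[of m] al
          is_tableD(1)[OF t(1), of \<alpha> m] is_tableD(1)[OF t(2), of \<alpha> m]
        by (auto split: if_splits)
      then show ?thesis using mid by blast
    next
      case False
      then show ?thesis using subface_refl unfolding table_cells_def by blast
    qed
  qed
  then have "table_cells x \<union> table_cells y \<subseteq> table_cells ?z"
    using up unfolding table_cells_def by blast
  moreover have "x \<alpha> m \<noteq> 0 \<or> y \<alpha> m \<noteq> 0" if "?z \<alpha> m \<noteq> 0" for \<alpha> m
    using zv[OF sg, of \<alpha> m m] that by (auto split: if_splits)
  then have "table_cells ?z \<subseteq> table_cells x \<union> table_cells y" unfolding table_cells_def by blast
  ultimately show ?thesis by blast
qed

lemma table_bd_atom_same_dim:
  "x \<in> words n \<Longrightarrow> \<alpha> \<in> signs \<Longrightarrow> table_bd \<alpha> (word_dim x) (atom_table x) = atom_table x"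
proof (intro ext)
  fix \<beta> k assume "\<alpha> \<in> signs"
  then show "table_bd \<alpha> (word_dim x) (atom_table x) \<beta> k = atom_table x \<beta> k"
    using subface_dim[OF atom_cell_subface, of \<beta> x k]
    by (cases "word_dim k = word_dim x")
      (auto simp: table_bd_def atom_table_same_dim, auto simp: atom_table_def)
qed

text \<open>The boundary retains the cells of both signs in dimensions below \<open>p\<close>; each
  lies in a facet of sign \<open>\<gamma>\<close> by \<open>atom_cell_same_coface\<close> or
  \<open>atom_cell_other_coface\<close>.\<close>

lemma table_cells_bd_atom:
  assumes g: "\<gamma> \<in> signs" and p: "word_dim x = Suc p"
  shows "table_cells (table_bd \<gamma> p (atom_table x)) = R (facets \<gamma> x)"
proof -
  let ?b = "table_bd \<gamma> p (atom_table x)"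
  have 1: "k \<in> table_cells ?b" if "u \<in> facets \<gamma> x" "subface k u" for k u
    using that p g unfolding table_cells_def facets_def
    by (auto intro!: exI[of _ \<gamma>] exI[of _ u] simp: table_bd_def atom_table_def)
  have 2: "\<exists>u \<in> facets \<gamma> x. subface m u" if b: "?b \<alpha> m \<noteq> 0" for \<alpha> m
  proof -
    have al: "\<alpha> \<in> signs" "word_dim m \<le> p" using b by (auto simp: table_bd_def split: if_splits)
    show ?thesis
    proof (cases "word_dim m = p")
      case True
      then have "m \<in> facets \<gamma> x" using b p by (auto simp: table_bd_def facets_def atom_table_def split: if_splits)
      then show ?thesis using subface_refl by blast
    next
      case False
      then have at: "atom_cell \<alpha> x m" "Suc (word_dim m) < word_dim x"
        using b al p by (auto simp: table_bd_def atom_table_def split: if_splits)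
      have "\<exists>u. atom_cell \<gamma> x u \<and> word_dim x = Suc (word_dim u) \<and> subface m u"
      proof (cases "\<gamma> = \<alpha>")
        case True
        then show ?thesis using atom_cell_same_coface[OF at(1) al(1)] at(2) by auto
      next
        case False
        then have "\<gamma> = - \<alpha>" using al(1) g by auto
        then show ?thesis using atom_cell_other_coface[OF at(1) al(1) at(2)] by simp
      qed
      then show ?thesis unfolding facets_def by blast
    qed
  qed
  have "table_cells ?b \<subseteq> R (facets \<gamma> x)"
    using 2 subface_trans unfolding table_cells_def R_iff by blast
  then show ?thesis using 1 unfolding R_iff by blast
qed

lemma is_cube_cat_set_cube_cat: "is_cube_cat n (set_cube_cat n)"
proof -
  let ?J = "set_cube_cat n" and ?T = "table_cat n"
  note T = omega_category_table_cat[of n]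
  have inj: "inj_on table_cells (carrier ?T)" using inj_on_table_cells by simp
  have Rx: "R {x} = table_cells (atom_table x)" for x by (simp add: R_iff table_cells_atom)
  have bdx: "bd ?J \<alpha> p (R {x}) = table_cells (table_bd \<alpha> p (atom_table x))" if "x \<in> words n" for \<alpha> p x
    using bd_image_cat[OF T inj, of "atom_table x"] is_table_atom[OF that]
    unfolding set_cube_cat_def Rx by simp
  have 1: "omega_category ?J" unfolding set_cube_cat_def by (rule omega_category_image_cat[OF T inj])
  have 2: "carrier ?J \<subseteq> {R X | X. X \<subseteq> words n}"
  proof -
    have "{m. \<exists>\<alpha>. x \<alpha> m \<noteq> 0} \<subseteq> words n" if "is_table n x" for x
      using is_tableD(3)[OF that] by blast
    then show ?thesis unfolding set_cube_cat_def using table_cells_R by fastforce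
  qed
  have 3: "\<forall>x \<in> words n. R {x} \<in> carrier ?J"
    using is_table_atom by (auto simp: set_cube_cat_def Rx)
  have eqS: "table_cells ` atom_table ` words n = {R {x} | x. x \<in> words n}" by (auto simp: Rx)
  have 4: "carrier ?J \<subseteq> composites ?J {R {x} | x. x \<in> words n}"
  proof
    fix u assume "u \<in> carrier ?J"
    then obtain x where x: "u = table_cells x" "is_table n x" by (auto simp: set_cube_cat_def)
    have "atom_table ` words n \<subseteq> carrier ?T" using is_table_atom by auto
    then show "u \<in> composites ?J {R {x} | x. x \<in> words n}"
      using composites_image_cat[OF T inj table_composite[OF x(2)]] x(1)
      unfolding set_cube_cat_def eqS by simp
  qed
  have 5: "\<forall>x \<in> words n. \<forall>\<alpha> \<in> signs. bd ?J \<alpha> (word_dim x) (R {x}) = R {x}"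
    using bdx table_bd_atom_same_dim[of _ n] Rx by simp
  have 6: "\<forall>x \<in> words n. \<forall>p. word_dim x = Suc p \<longrightarrow>
      src ?J p (R {x}) = R {subst_zeros x y | y. y \<in> b_words (Suc p) \<and> word_dim y = p} \<and>
      tgt ?J p (R {x}) = R {subst_zeros x y | y. y \<in> e_words (Suc p) \<and> word_dim y = p}"
    unfolding b_words_facet_words e_words_facet_words
    by (auto simp: bdx table_cells_bd_atom subst_zeros_eq_facets)
  have 7: "cmp ?J p U V = U \<union> V" if c: "composable ?J p U V" for p U V
  proof -
    obtain x y where "U = table_cells x" "V = table_cells y" "composable ?T p x y" 
      "x \<in> carrier ?T" "y \<in> carrier ?T"
      using composable_image_catE[OF T inj] c unfolding set_cube_cat_def by metis
    then show ?thesis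
      using table_cells_cmp cmp_image_cat[OF T inj] unfolding set_cube_cat_def by metis
  qed
  show ?thesis unfolding is_cube_cat_def
    using 1 2 3 4 5 6 7 by (simp add: R_Un)
qed

section \<open>Functors on the omega-category of the cube\<close>

text \<open>From here on \<open>cube_cat\<close> is used only through the clauses of
  \<open>is_cube_cat\<close>; the model by tables shows that the choice is not void.\<close>

lemma is_cube_cat_cube_cat: "is_cube_cat n (cube_cat n)"
  unfolding cube_cat_def using is_cube_cat_set_cube_cat by (rule someI)

lemma omega_category_cube_cat: "omega_category (cube_cat n)"
  and generator_in_cube_cat: "k \<in> words n \<Longrightarrow> R {k} \<in> carrier (cube_cat n)"
  and cube_cat_composite:
    "U \<in> carrier (cube_cat n) \<Longrightarrow> U \<in> composites (cube_cat n) {R {k} | k. k \<in> words n}"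
  using is_cube_cat_cube_cat[of n] by (auto simp: is_cube_cat_def)

lemma cube_cat_elemE:
  assumes "U \<in> carrier (cube_cat n)"
  obtains X where "X \<subseteq> words n" "U = R X"
  using assms is_cube_cat_cube_cat[of n] by (auto simp: is_cube_cat_def)

lemma cube_cat_subset_words: "U \<in> carrier (cube_cat n) \<Longrightarrow> U \<subseteq> words n"
  using subface_words by (fastforce elim!: cube_cat_elemE simp: R_iff)

lemma cmp_cube_cat:
  assumes c: "composable (cube_cat n) p U V"
  shows "cmp (cube_cat n) p U V = U \<union> V"
proof -
  obtain X Y where "X \<subseteq> words n" "U = R X" "Y \<subseteq> words n" "V = R Y"
    using c by (metis composable_def cube_cat_elemE)
  then show ?thesis using c is_cube_cat_cube_cat[of n] by (auto simp: is_cube_cat_def R_Un)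
qed

lemma bd_generator_facets:
  "k \<in> words n \<Longrightarrow> \<alpha> \<in> signs \<Longrightarrow> word_dim k = Suc p
    \<Longrightarrow> bd (cube_cat n) \<alpha> p (R {k}) = R (facets \<alpha> k)"
  using is_cube_cat_cube_cat[of n] subst_zeros_eq_facets[of \<alpha> k p]
  unfolding is_cube_cat_def b_words_facet_words e_words_facet_words by auto

lemma bd_generator_ge:
  assumes k: "k \<in> words n" "\<alpha> \<in> signs" and le: "word_dim k \<le> j"
  shows "bd (cube_cat n) \<alpha> j (R {k}) = R {k}"
proof -
  have "bd (cube_cat n) \<alpha> (word_dim k) (R {k}) = R {k}"
    using is_cube_cat_cube_cat[of n] k unfolding is_cube_cat_def by blast
  then show ?thesis
    using omega_category.bd_bd_ge[OF omega_category_cube_cat generator_in_cube_cat[OF k(1)] k(2) k(2) le]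
    by simp
qed

text \<open>For m < n both elements have the same m-boundary, which is its own n-boundary; for m > n
  the n-boundaries do not change.\<close>

lemma (in omega_category) composable_bd:
  assumes c: "composable C n x y" and a: "\<alpha> \<in> signs" and ne: "m \<noteq> n"
  shows "composable C n (bd C \<alpha> m x) (bd C \<alpha> m y)"
proof -
  have xy: "x \<in> carrier C" "y \<in> carrier C" "tgt C n x = src C n y"
    using c by (auto simp: composable_def)
  have s: "(1::int) \<in> signs" "(-1::int) \<in> signs" by auto
  have "tgt C n (bd C \<alpha> m x) = src C n (bd C \<alpha> m y)"
  proof (cases "m < n")
    case True
    have "bd C \<alpha> m x = bd C \<alpha> m y"
      using bd_bd_less[OF xy(1) s(1) a True] bd_bd_less[OF xy(2) s(2) a True] xy(3) by simp
    moreover have "tgt C n (bd C \<alpha> m x) = bd C \<alpha> m x" "src C n (bd C \<alpha> m y) = bd C \<alpha> m y"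
      using bd_bd_ge[OF xy(1) a s(1)] bd_bd_ge[OF xy(2) a s(2)] True by simp_all
    ultimately show ?thesis by simp
  next
    case False
    then show ?thesis
      using bd_bd_less[OF xy(1) a s(1)] bd_bd_less[OF xy(2) a s(2)] ne xy(3) by simp
  qed
  then show ?thesis using xy bd_closed a by (simp add: composable_def)
qed

lemma omega_functorD:
  assumes "omega_functor C D f"
  shows "x \<in> carrier C \<Longrightarrow> f x \<in> carrier D"
    "x \<in> carrier C \<Longrightarrow> \<alpha> \<in> signs \<Longrightarrow> f (bd C \<alpha> n x) = bd D \<alpha> n (f x)"
    "composable C n x y \<Longrightarrow> f (cmp C n x y) = cmp D n (f x) (f y)"
    "composable C n x y \<Longrightarrow> composable D n (f x) (f y)"
proof -
  show 1: "x \<in> carrier C \<Longrightarrow> f x \<in> carrier D" for x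
    using assms by (auto simp: omega_functor_def)
  show 2: "x \<in> carrier C \<Longrightarrow> \<alpha> \<in> signs \<Longrightarrow> f (bd C \<alpha> n x) = bd D \<alpha> n (f x)" for \<alpha> x
    using assms unfolding omega_functor_def by blast
  show "composable C n x y \<Longrightarrow> f (cmp C n x y) = cmp D n (f x) (f y)"
    using assms by (auto simp: omega_functor_def)
  show "composable C n x y \<Longrightarrow> composable D n (f x) (f y)"
    unfolding composable_def using 1 2[of x 1] 2[of y "-1"] by (metis insertI1 insertI2)
qed

lemma omega_functor_comp:
  assumes f: "omega_functor C D f" and g: "omega_functor D E g"
  shows "omega_functor C E (g \<circ> f)"
  using omega_functorD[OF f] omega_functorD[OF g]
  unfolding omega_functor_def[of C E] by (simp add: Pi_iff del: insert_iff)

text \<open>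
  The lower boundaries of a generator are boundaries of elements of smaller dimension, so only the
  top-dimensional ones have to be checked.
\<close>

lemma omega_functor_cube_catI:
  assumes C: "omega_category C"
    and gen: "\<And>k. k \<in> words n \<Longrightarrow> F (R {k}) \<in> carrier C"
    and same: "\<And>k \<alpha>. k \<in> words n \<Longrightarrow> \<alpha> \<in> signs \<Longrightarrow> bd C \<alpha> (word_dim k) (F (R {k})) = F (R {k})"
    and fac: "\<And>k \<alpha> p. k \<in> words n \<Longrightarrow> \<alpha> \<in> signs \<Longrightarrow> word_dim k = Suc p
      \<Longrightarrow> F (R (facets \<alpha> k)) = bd C \<alpha> p (F (R {k}))"
    and un: "\<And>U V p. U \<in> carrier (cube_cat n) \<Longrightarrow> V \<in> carrier (cube_cat n)
      \<Longrightarrow> composable C p (F U) (F V) \<Longrightarrow> F (U \<union> V) = cmp C p (F U) (F V)"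
  shows "omega_functor (cube_cat n) C F"
proof -
  interpret C: omega_category C by (rule C)
  let ?I = "cube_cat n"
  interpret I: omega_category ?I by (rule omega_category_cube_cat)
  have s: "(1::int) \<in> signs" "(-1::int) \<in> signs" by auto
  have comp: "composable C p (F U) (F V)"
    if "composable ?I p U V" "F U \<in> carrier C" "F V \<in> carrier C"
      "F (tgt ?I p U) = tgt C p (F U)" "F (src ?I p V) = src C p (F V)" for p U V
    using that by (auto simp: composable_def)
  \<comment> \<open>The outer induction, on a bound for the dimensions of the words in
    \<open>U\<close>, reaches the boundaries of a generator; structural induction alone would not,
    because these are not among the factors of the composite.\<close>
  have claim: "U \<in> carrier ?I \<Longrightarrow> (\<And>k. k \<in> U \<Longrightarrow> word_dim k \<le> d)
    \<Longrightarrow> F U \<in> carrier C \<and> (\<forall>\<alpha>\<in>signs. \<forall>j. F (bd ?I \<alpha> j U) = bd C \<alpha> j (F U))" for U d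
  proof (induction d arbitrary: U rule: less_induct)
    case (less d)
    from cube_cat_composite[OF less.prems(1)] less.prems(2) show ?case
    proof (induction U rule: composites.induct)
      case (base U)
      then obtain k where U: "U = R {k}" and k: "k \<in> words n" by auto
      have kd: "word_dim k \<le> d" using base(2)[of k] by (simp add: U R_iff)
      have FU: "F U \<in> carrier C" using gen[OF k] U by simp
      have "F (bd ?I \<alpha> j U) = bd C \<alpha> j (F U)" if a: "\<alpha> \<in> signs" for \<alpha> j
      proof -
        consider "word_dim k \<le> j" | "word_dim k = Suc j" | p where "word_dim k = Suc p" "j < p"
          by (metis Suc_lessE not_less less_antisym not_less_eq)
        then show ?thesis
        proof cases
          case 1
          have "bd C \<alpha> j (F U) = F U"
            using C.bd_bd_ge[OF FU a a 1] same[OF k a] U by simp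
          then show ?thesis using bd_generator_ge[OF k a 1] U by simp
        next
          case 2
          then show ?thesis using fac[OF k a 2] bd_generator_facets[OF k a 2] U by simp
        next
          case (3 p)
          let ?V = "bd ?I \<alpha> p U"
          have V: "?V = R (facets \<alpha> k)" using bd_generator_facets[OF k a 3(1)] U by simp
          have Vc: "?V \<in> carrier ?I" using I.bd_closed generator_in_cube_cat[OF k] a U by simp
          have "word_dim l \<le> p" if "l \<in> ?V" for l
            using that 3(1) subface_dim unfolding V by (fastforce simp: R_iff facets_def)
          then have IH: "F (bd ?I \<alpha> j ?V) = bd C \<alpha> j (F ?V)"
            using less.IH[of p ?V] Vc kd 3(1) a by auto
          have FV: "F ?V = bd C \<alpha> p (F U)" using fac[OF k a 3(1)] V U by simp
          have "bd ?I \<alpha> j U = bd ?I \<alpha> j ?V"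
            using I.bd_bd_less[OF _ a a 3(2)] generator_in_cube_cat[OF k] U by simp
          then show ?thesis using IH FV C.bd_bd_less[OF FU a a 3(2)] by simp
        qed
      qed
      then show ?case using FU by blast
    next
      case (cmp U V p)
      have UV: "cmp ?I p U V = U \<union> V" by (rule cmp_cube_cat[OF cmp(3)])
      have c: "U \<in> carrier ?I" "V \<in> carrier ?I" using cmp(3) by (auto simp: composable_def)
      have FU: "F U \<in> carrier C" "\<And>\<alpha> j. \<alpha> \<in> signs \<Longrightarrow> F (bd ?I \<alpha> j U) = bd C \<alpha> j (F U)"
        and FV: "F V \<in> carrier C" "\<And>\<alpha> j. \<alpha> \<in> signs \<Longrightarrow> F (bd ?I \<alpha> j V) = bd C \<alpha> j (F V)"
        using cmp(4,5,6) UV by auto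
      have Fc: "composable C p (F U) (F V)" using comp[OF cmp(3) FU(1) FV(1)] FU(2) FV(2) s by blast
      have Feq: "F (cmp ?I p U V) = cmp C p (F U) (F V)" using un[OF c Fc] UV by simp
      have "F (bd ?I \<alpha> j (cmp ?I p U V)) = bd C \<alpha> j (F (cmp ?I p U V))" if a: "\<alpha> \<in> signs" for \<alpha> j
      proof (cases "j = p")
        case True
        have "\<alpha> = -1 \<or> \<alpha> = 1" using a by auto
        then show ?thesis unfolding Feq True
          using I.src_cmp[OF cmp(3)] I.tgt_cmp[OF cmp(3)] C.src_cmp[OF Fc] C.tgt_cmp[OF Fc] FU(2) FV(2)
          by auto
      next
        case False
        have c': "composable ?I p (bd ?I \<alpha> j U) (bd ?I \<alpha> j V)"
          by (rule I.composable_bd[OF cmp(3) a False])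
        have Fc': "composable C p (F (bd ?I \<alpha> j U)) (F (bd ?I \<alpha> j V))"
          using C.composable_bd[OF Fc a False] FU(2)[OF a] FV(2)[OF a] by simp
        have "F (bd ?I \<alpha> j U \<union> bd ?I \<alpha> j V) = cmp C p (F (bd ?I \<alpha> j U)) (F (bd ?I \<alpha> j V))"
          by (rule un[OF _ _ Fc']) (use c' in \<open>auto simp: composable_def\<close>)
        then show ?thesis unfolding Feq
          using I.bd_cmp[OF cmp(3) a False] C.bd_cmp[OF Fc a False] cmp_cube_cat[OF c']
            FU(2)[OF a] FV(2)[OF a] by simp
      qed
      then show ?case using C.cmp_closed[OF Fc] Feq by auto
    qed
  qed
  have all: "F U \<in> carrier C \<and> (\<forall>\<alpha>\<in>signs. \<forall>j. F (bd ?I \<alpha> j U) = bd C \<alpha> j (F U))"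
    if U: "U \<in> carrier ?I" for U
    using claim[OF U, of n] cube_cat_subset_words[OF U] word_dim_le_length length_words
    by (metis subset_iff)
  show ?thesis
    unfolding omega_functor_def
  proof (intro conjI ballI allI impI)
    fix p U V assume c: "composable ?I p U V"
    then have UV: "U \<in> carrier ?I" "V \<in> carrier ?I" by (auto simp: composable_def)
    show "F (cmp ?I p U V) = cmp C p (F U) (F V)"
      using un[OF UV comp[OF c]] all[OF UV(1)] all[OF UV(2)] cmp_cube_cat[OF c] s by auto
  qed (use all in auto)
qed

lemma nerve_functor: "x \<in> nerve C n \<Longrightarrow> omega_functor (cube_cat n) C x"
  by (simp add: nerve_def)

lemma nerve_ext:
  assumes x: "x \<in> nerve C n" and y: "y \<in> nerve C n"
    and eq: "\<And>k. k \<in> words n \<Longrightarrow> x (R {k}) = y (R {k})"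
  shows "x = y"
proof (rule extensionalityI)
  show "x \<in> extensional (carrier (cube_cat n))" "y \<in> extensional (carrier (cube_cat n))"
    using x y by (auto simp: nerve_def)
  fix U assume "U \<in> carrier (cube_cat n)"
  then have "U \<in> composites (cube_cat n) {R {k} | k. k \<in> words n}" by (rule cube_cat_composite)
  then show "x U = y U"
  proof induction
    case (cmp U V p)
    then show ?case
      using omega_functorD(3)[OF nerve_functor[OF x] cmp(3)] omega_functorD(3)[OF nerve_functor[OF y] cmp(3)]
      by simp
  qed (use eq in auto)
qed

lemma restrict_functor_nerve:
  assumes F: "omega_functor (cube_cat n) C F"
  shows "restrict F (carrier (cube_cat n)) \<in> nerve C n"
proof -
  interpret I: omega_category "cube_cat n" by (rule omega_category_cube_cat)
  have "U \<in> carrier (cube_cat n) \<and> V \<in> carrier (cube_cat n)" if "composable (cube_cat n) p U V" for p U V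
    using that by (simp add: composable_def)
  then show ?thesis
    using omega_functorD[OF F] I.bd_closed I.cmp_closed
    unfolding nerve_def omega_functor_def by auto
qed

text \<open>Any functor with the right values on generators resolves the definite description,
  whatever it does outside the carrier: restricting it makes it extensional, and
  \<open>nerve_ext\<close> gives uniqueness.\<close>

lemma cube_with_values:
  assumes F: "omega_functor (cube_cat n) C F" and v: "\<And>k. k \<in> words n \<Longrightarrow> F (R {k}) = v k"
  shows "cube_with_values C n v \<in> nerve C n"
    and "k \<in> words n \<Longrightarrow> cube_with_values C n v (R {k}) = v k"
proof -
  let ?P = "\<lambda>x. x \<in> nerve C n \<and> (\<forall>k \<in> words n. x (R {k}) = v k)"
  let ?G = "restrict F (carrier (cube_cat n))"
  have G: "?P ?G"
    using restrict_functor_nerve[OF F] v generator_in_cube_cat by simp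
  have "x = ?G" if "?P x" for x using nerve_ext[of x C n ?G] that G by auto
  then have "\<exists>!x. ?P x" using ex1I[where P = ?P, OF G] by blast
  then have "?P (cube_with_values C n v)" unfolding cube_with_values_def by (rule theI')
  then show "cube_with_values C n v \<in> nerve C n"
    "k \<in> words n \<Longrightarrow> cube_with_values C n v (R {k}) = v k" by auto
qed

section \<open>Functors induced by maps of words\<close>

lemma facets_Nil [simp]: "facets \<alpha> [] = {}"
  by (auto simp: facets_def)

lemma facets_Cons [simp]:
  assumes a: "\<alpha> \<in> signs"
  shows "facets \<alpha> (b # k) =
    (if b = 0 then insert (\<alpha> # k) ((#) 0 ` facets (-\<alpha>) k) else (#) b ` facets \<alpha> k)"
proof -
  have eq: "l = k" if "atom_cell \<alpha> k l" "word_dim k = word_dim l" for l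
    using subface_dim_eq[OF atom_cell_subface[OF that(1) a]] that(2) by simp
  have "m \<in> facets \<alpha> (b # k) \<longleftrightarrow>
    m \<in> (if b = 0 then insert (\<alpha> # k) ((#) 0 ` facets (-\<alpha>) k) else (#) b ` facets \<alpha> k)" for m
  proof (cases m)
    case (Cons c l)
    then show ?thesis using a eq[of l] by (auto simp: facets_def)
  qed (auto simp: facets_def)
  then show ?thesis by blast
qed

text \<open>Conditions under which taking images and closing under \<open>R\<close> is a functor. If
  \<open>g\<close> keeps the dimension of \<open>k\<close>, facets must correspond sign by sign. If
  \<open>g\<close> lowers it, the image of \<open>k\<close> is its own boundary, so a facet of each
  sign must already be sent to \<open>g k\<close>.\<close>

definition word_map :: "nat \<Rightarrow> nat \<Rightarrow> (int list \<Rightarrow> int list) \<Rightarrow> bool" where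
  "word_map m n g \<longleftrightarrow> (\<forall>k \<in> words m. g k \<in> words n \<and> word_dim (g k) \<le> word_dim k \<and>
    (\<forall>l. subface l k \<longrightarrow> subface (g l) (g k)) \<and>
    (\<forall>\<alpha> \<in> signs. if word_dim (g k) = word_dim k
      then g ` facets \<alpha> k = facets \<alpha> (g k)
      else g k \<in> g ` facets \<alpha> k))"

lemma word_mapI:
  assumes "\<And>k. k \<in> words m \<Longrightarrow> g k \<in> words n \<and> word_dim (g k) \<le> word_dim k"
    and "\<And>k l. k \<in> words m \<Longrightarrow> subface l k \<Longrightarrow> subface (g l) (g k)"
    and "\<And>k \<alpha>. k \<in> words m \<Longrightarrow> \<alpha> \<in> signs \<Longrightarrow> if word_dim (g k) = word_dim k
      then g ` facets \<alpha> k = facets \<alpha> (g k) else g k \<in> g ` facets \<alpha> k"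
  shows "word_map m n g"
  unfolding word_map_def using assms by blast

lemma word_mapD:
  assumes "word_map m n g" "k \<in> words m"
  shows "g k \<in> words n" "word_dim (g k) \<le> word_dim k" "subface l k \<Longrightarrow> subface (g l) (g k)"
    "\<alpha> \<in> signs \<Longrightarrow> word_dim (g k) = word_dim k \<Longrightarrow> g ` facets \<alpha> k = facets \<alpha> (g k)"
    "\<alpha> \<in> signs \<Longrightarrow> word_dim (g k) \<noteq> word_dim k \<Longrightarrow> g k \<in> g ` facets \<alpha> k"
  using assms unfolding word_map_def by metis+

lemma facets_subface: "u \<in> facets \<alpha> k \<Longrightarrow> \<alpha> \<in> signs \<Longrightarrow> subface u k"
  unfolding facets_def using atom_cell_subface by blast

lemma word_map_cong:
  assumes g: "word_map m n g" and eq: "\<And>k. k \<in> words m \<Longrightarrow> g k = h k"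
  shows "word_map m n h"
proof (rule word_mapI)
  fix k assume k: "k \<in> words m"
  have sub: "g l = h l" if "subface l k" for l using eq[OF subface_words[OF that k]] .
  show "h k \<in> words n \<and> word_dim (h k) \<le> word_dim k" using word_mapD(1,2)[OF g k] eq[OF k] by simp
  show "subface (h l) (h k)" if "subface l k" for l
    using word_mapD(3)[OF g k that] sub[OF that] eq[OF k] by simp
  fix \<alpha> assume a: "\<alpha> \<in> signs"
  have "g ` facets \<alpha> k = h ` facets \<alpha> k" using sub facets_subface[OF _ a] by force
  then show "if word_dim (h k) = word_dim k
      then h ` facets \<alpha> k = facets \<alpha> (h k) else h k \<in> h ` facets \<alpha> k"
    using word_mapD(4,5)[OF g k a] eq[OF k] by simp
qed

lemma R_word_map:
  assumes g: "word_map m n g" and X: "X \<subseteq> words m"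
  shows "R (g ` R X) = R (g ` X)"
proof -
  have "subface l (g x)" if "x \<in> X" "subface k x" "subface l (g k)" for l k x
    using word_mapD(3)[OF g, of x k] that X subface_trans by blast
  then show ?thesis unfolding R_iff using subface_refl by blast
qed

lemma omega_functor_word_map:
  assumes g: "word_map m n g"
  shows "omega_functor (cube_cat m) (cube_cat n) (\<lambda>U. R (g ` U))"
proof (rule omega_functor_cube_catI[OF omega_category_cube_cat])
  fix k assume k: "k \<in> words m"
  have eq: "R (g ` R {k}) = R {g k}" using R_word_map[OF g, of "{k}"] k by simp
  show "R (g ` R {k}) \<in> carrier (cube_cat n)"
    unfolding eq using word_mapD(1)[OF g k] by (rule generator_in_cube_cat)
  fix \<alpha> assume a: "\<alpha> \<in> signs"
  show "bd (cube_cat n) \<alpha> (word_dim k) (R (g ` R {k})) = R (g ` R {k})"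
    unfolding eq by (rule bd_generator_ge[OF word_mapD(1)[OF g k] a word_mapD(2)[OF g k]])
  fix p assume p: "word_dim k = Suc p"
  have sub: "facets \<alpha> k \<subseteq> words m" using facets_subface[OF _ a] subface_words[OF _ k] by blast
  show "R (g ` R (facets \<alpha> k)) = bd (cube_cat n) \<alpha> p (R (g ` R {k}))"
  proof (cases "word_dim (g k) = word_dim k")
    case True
    then show ?thesis unfolding eq R_word_map[OF g sub]
      using word_mapD(4)[OF g k a] bd_generator_facets[OF word_mapD(1)[OF g k] a] p by simp
  next
    case False
    have "bd (cube_cat n) \<alpha> p (R {g k}) = R {g k}"
      using False word_mapD(2)[OF g k] p by (intro bd_generator_ge[OF word_mapD(1)[OF g k] a]) simp
    moreover have "R (g ` facets \<alpha> k) = R {g k}"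
    proof -
      have "subface (g u) (g k)" if "u \<in> facets \<alpha> k" for u
        using word_mapD(3)[OF g k facets_subface[OF that a]] .
      then show ?thesis using word_mapD(5)[OF g k a False] subface_trans unfolding R_iff by blast
    qed
    ultimately show ?thesis unfolding eq R_word_map[OF g sub] by simp
  qed
next
  fix U V p assume "composable (cube_cat n) p (R (g ` U)) (R (g ` V))"
  then show "R (g ` (U \<union> V)) = cmp (cube_cat n) p (R (g ` U)) (R (g ` V))"
    by (simp add: cmp_cube_cat image_Un R_Un)
qed

lemma cube_with_values_word_map:
  assumes g: "word_map m n g" and x: "x \<in> nerve C n"
  shows "cube_with_values C m (\<lambda>k. x (R {g k})) \<in> nerve C m"
    and "k \<in> words m \<Longrightarrow> cube_with_values C m (\<lambda>k. x (R {g k})) (R {k}) = x (R {g k})"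
proof -
  have F: "omega_functor (cube_cat m) C (x \<circ> (\<lambda>U. R (g ` U)))"
    by (rule omega_functor_comp[OF omega_functor_word_map[OF g] nerve_functor[OF x]])
  have v: "(x \<circ> (\<lambda>U. R (g ` U))) (R {k}) = x (R {g k})" if "k \<in> words m" for k
    using R_word_map[OF g, of "{k}"] that by simp
  show "cube_with_values C m (\<lambda>k. x (R {g k})) \<in> nerve C m"
    "k \<in> words m \<Longrightarrow> cube_with_values C m (\<lambda>k. x (R {g k})) (R {k}) = x (R {g k})"
    using cube_with_values[OF F v] by auto
qed

lemma words_SucE:
  assumes "k \<in> words (Suc n)"
  obtains a l where "k = a # l" "a = -1 \<or> a = 0 \<or> a = 1" "l \<in> words n"
  using assms by (cases k) auto

text \<open>Passes from position i to position i + 1, so that the three kinds of maps need to be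
  examined only at the first letter.\<close>

lemma word_map_Cons:
  assumes g: "word_map m n g"
  shows "word_map (Suc m) (Suc n) (\<lambda>k. hd k # g (tl k))"
proof (rule word_mapI)
  fix k assume "k \<in> words (Suc m)"
  then obtain a l where k: "k = a # l" "a = -1 \<or> a = 0 \<or> a = 1" and l: "l \<in> words m"
    by (rule words_SucE)
  note gl = word_mapD[OF g l]
  show "hd k # g (tl k) \<in> words (Suc n) \<and> word_dim (hd k # g (tl k)) \<le> word_dim k"
    using gl(1,2) k by auto
  show "subface (hd u # g (tl u)) (hd k # g (tl k))" if "subface u k" for u
    using that gl(3) k by (cases u) auto
  fix \<alpha> assume al: "\<alpha> \<in> signs"
  have im: "(\<lambda>k. hd k # g (tl k)) ` (#) b ` X = (#) b ` g ` X" for b X by (auto simp: image_image)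
  show "if word_dim (hd k # g (tl k)) = word_dim k
      then (\<lambda>k. hd k # g (tl k)) ` facets \<alpha> k = facets \<alpha> (hd k # g (tl k))
      else hd k # g (tl k) \<in> (\<lambda>k. hd k # g (tl k)) ` facets \<alpha> k"
    using gl(4,5)[OF al] gl(4,5)[OF signs_uminus[OF al]] k facets_Cons[OF al]
    by (auto simp: im simp del: facets_Cons)
qed

lemma word_map_insert_0: "\<alpha> \<in> signs \<Longrightarrow> word_map n (Suc n) (\<lambda>k. \<alpha> # k)"
  by (rule word_mapI) auto

lemma word_map_delete_0: "word_map (Suc n) n tl"
proof (rule word_mapI)
  fix k assume "k \<in> words (Suc n)"
  then obtain a l where k: "k = a # l" "a = -1 \<or> a = 0 \<or> a = 1" and l: "l \<in> words n"
    by (rule words_SucE)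
  show "tl k \<in> words n \<and> word_dim (tl k) \<le> word_dim k" using k l by auto
  show "subface (tl u) (tl k)" if "subface u k" for u using that k by (cases u) auto
  fix \<alpha> assume "\<alpha> \<in> signs"
  then show "if word_dim (tl k) = word_dim k
      then tl ` facets \<alpha> k = facets \<alpha> (tl k) else tl k \<in> tl ` facets \<alpha> k"
    using k by (auto simp: image_image)
qed

text \<open>The critical case is that of two merged zeros, where the dimension drops. The word 0 0 l
  has the facet - 0 l of sign - and the facet 0 - l of sign +, and both are sent to 0 l because - is
  the least letter.\<close>

lemma word_map_max_0: "word_map (Suc (Suc n)) (Suc n) (\<lambda>k. max (hd k) (hd (tl k)) # tl (tl k))"
proof (rule word_mapI)
  let ?g = "\<lambda>k::int list. max (hd k) (hd (tl k)) # tl (tl k)"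
  fix k assume "k \<in> words (Suc (Suc n))"
  then obtain a b l where k: "k = a # b # l" and ab: "a = -1 \<or> a = 0 \<or> a = 1" "b = -1 \<or> b = 0 \<or> b = 1"
    and l: "l \<in> words n" by (metis words_SucE)
  show "?g k \<in> words (Suc n) \<and> word_dim (?g k) \<le> word_dim k" using l ab unfolding k by auto
  show "subface (?g u) (?g k)" if s: "subface u k" for u
  proof -
    obtain c v where u: "u = c # v" using s k by (cases u) auto
    then obtain d w where v: "v = d # w" using s k by (cases v) auto
    show ?thesis using s ab unfolding k u v by auto
  qed
  fix \<alpha> assume "\<alpha> \<in> signs"
  then have "\<alpha> = -1 \<or> \<alpha> = 1" by auto
  then show "if word_dim (?g k) = word_dim k then ?g ` facets \<alpha> k = facets \<alpha> (?g k)
      else ?g k \<in> ?g ` facets \<alpha> k"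
    using ab unfolding k by (elim disjE; simp add: image_image insert_commute)
qed

lemma word_map_insert:
  "i \<le> n \<Longrightarrow> \<alpha> \<in> signs \<Longrightarrow> word_map n (Suc n) (\<lambda>k. take i k @ [\<alpha>] @ drop i k)"
proof (induction i arbitrary: n)
  case 0
  then show ?case using word_map_insert_0 by simp
next
  case (Suc i)
  then obtain n' where n: "n = Suc n'" by (cases n) auto
  show ?case unfolding n
    by (rule word_map_cong[OF word_map_Cons[OF Suc.IH]]) (use Suc.prems n in \<open>auto elim!: words_SucE\<close>)
qed

lemma word_map_delete: "i \<le> n \<Longrightarrow> word_map (Suc n) n (\<lambda>k. take i k @ drop (Suc i) k)"
proof (induction i arbitrary: n)
  case 0
  show ?case by (rule word_map_cong[OF word_map_delete_0]) (auto elim!: words_SucE)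
next
  case (Suc i)
  then obtain n' where n: "n = Suc n'" by (cases n) auto
  show ?case unfolding n
    by (rule word_map_cong[OF word_map_Cons[OF Suc.IH]]) (use Suc.prems n in \<open>auto elim!: words_SucE\<close>)
qed

lemma word_map_max:
  "i \<le> n \<Longrightarrow> word_map (Suc (Suc n)) (Suc n)
    (\<lambda>k. take i k @ [max (k ! i) (k ! Suc i)] @ drop (Suc (Suc i)) k)"
proof (induction i arbitrary: n)
  case 0
  show ?case by (rule word_map_cong[OF word_map_max_0]) (auto elim!: words_SucE)
next
  case (Suc i)
  then obtain n' where n: "n = Suc n'" by (cases n) auto
  show ?case unfolding n
    by (rule word_map_cong[OF word_map_Cons[OF Suc.IH]]) (use Suc.prems n in \<open>auto elim!: words_SucE\<close>)
qed

lemma face_nerve: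
  assumes "x \<in> nerve C (Suc n)" "i \<in> {1..Suc n}" "\<alpha> \<in> signs"
  shows "face C (Suc n) i \<alpha> x \<in> nerve C n"
    and "k \<in> words n \<Longrightarrow> face C (Suc n) i \<alpha> x (R {k}) = x (R {take (i - 1) k @ [\<alpha>] @ drop (i - 1) k})"
  unfolding face_def diff_Suc_1
  using cube_with_values_word_map[OF word_map_insert[of "i - 1" n \<alpha>] assms(1)] assms(2,3) by auto

lemma degeneracy_nerve:
  assumes "x \<in> nerve C n" "i \<in> {1..Suc n}"
  shows "degeneracy C n i x \<in> nerve C (Suc n)"
    and "k \<in> words (Suc n) \<Longrightarrow> degeneracy C n i x (R {k}) = x (R {take (i - 1) k @ drop i k})"
  unfolding degeneracy_def
  using cube_with_values_word_map[OF word_map_delete[of "i - 1" n] assms(1)] assms(2) by auto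

lemma connection_nerve:
  assumes "x \<in> nerve C n" "i \<in> {1..n}"
  shows "connection C n i x \<in> nerve C (Suc n)"
    and "k \<in> words (Suc n) \<Longrightarrow> connection C n i x (R {k})
      = x (R {take (i - 1) k @ [max (k ! (i - 1)) (k ! i)] @ drop (i + 1) k})"
proof -
  obtain n' where n: "n = Suc n'" using assms(2) by (cases n) auto
  show "connection C n i x \<in> nerve C (Suc n)"
    "k \<in> words (Suc n) \<Longrightarrow> connection C n i x (R {k})
      = x (R {take (i - 1) k @ [max (k ! (i - 1)) (k ! i)] @ drop (i + 1) k})"
    unfolding connection_def
    using cube_with_values_word_map[OF word_map_max[of "i - 1" n'], folded n, OF _ assms(1)] assms(2) n
    by auto
qed

section \<open>Cubical identities and initial edges\<close>

text \<open>Positions are counted from 0, which suits recursion on words; faces and connections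
  count from 1, hence the \<open>Suc\<close> in their indices below.\<close>

definition insert_at :: "nat \<Rightarrow> 'c \<Rightarrow> 'c list \<Rightarrow> 'c list" where
  "insert_at i a k = take i k @ [a] @ drop i k"

definition merge_at :: "nat \<Rightarrow> int list \<Rightarrow> int list" where
  "merge_at i k = take i k @ [max (k ! i) (k ! Suc i)] @ drop (Suc (Suc i)) k"

lemma insert_at_simps [simp]:
  "insert_at 0 a k = a # k" "insert_at (Suc i) a (b # k) = b # insert_at i a k"
  by (auto simp: insert_at_def)

lemma merge_at_simps [simp]:
  "merge_at 0 (a # b # k) = max a b # k" "merge_at (Suc i) (a # k) = a # merge_at i k"
  by (auto simp: merge_at_def)

lemma insert_at_words:
  "i \<le> n \<Longrightarrow> \<alpha> \<in> signs \<Longrightarrow> k \<in> words n \<Longrightarrow> insert_at i \<alpha> k \<in> words (Suc n)"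
  using word_mapD(1)[OF word_map_insert] unfolding insert_at_def by blast

lemma merge_at_words: "i < n \<Longrightarrow> k \<in> words (Suc n) \<Longrightarrow> merge_at i k \<in> words n"
  using word_mapD(1)[OF word_map_max, of i "n - 1" k] unfolding merge_at_def by simp

lemma insert_at_insert_at:
  "i \<le> j \<Longrightarrow> j \<le> length k
    \<Longrightarrow> insert_at (Suc j) a (insert_at i b k) = insert_at i b (insert_at j a k)"
proof (induction i arbitrary: j k)
  case (Suc i)
  then show ?case by (cases j; cases k) auto
qed simp

lemma merge_at_insert_at_less:
  "i \<le> j \<Longrightarrow> Suc j < length k
    \<Longrightarrow> merge_at (Suc j) (insert_at i a k) = insert_at i a (merge_at j k)"
proof (induction i arbitrary: j k)
  case (Suc i)
  then show ?case by (cases j; cases k) auto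
qed simp

lemma merge_at_insert_at_greater:
  "Suc j \<le> i \<Longrightarrow> i < length k
    \<Longrightarrow> merge_at j (insert_at (Suc i) a k) = insert_at i a (merge_at j k)"
proof (induction j arbitrary: i k)
  case 0
  then obtain b c l i' where "k = b # c # l" "i = Suc i'"
    by (metis Suc_le_D Suc_less_eq2 length_Suc_conv less_imp_Suc_add list.exhaust list.size(3) not_less0 Suc_le_eq)
  then show ?case by simp
next
  case (Suc j)
  then show ?case by (cases i; cases k) auto
qed

text \<open>The letter -1 is neutral for \<open>max\<close>; this is why the connection is undone by
  two negative faces.\<close>

lemma merge_at_insert_at_same:
  assumes "k \<in> words n" "j < n"
  shows "merge_at j (insert_at j (-1) k) = k" "merge_at j (insert_at (Suc j) (-1) k) = k"
proof -
  have "merge_at j (insert_at j (-1) k) = k \<and> merge_at j (insert_at (Suc j) (-1) k) = k"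
    using assms
  proof (induction j arbitrary: k n)
    case 0
    then obtain m where "n = Suc m" by (cases n) auto
    then obtain a l where "k = a # l" "a = -1 \<or> a = 0 \<or> a = 1" using 0 words_SucE by metis
    then show ?case by auto
  next
    case (Suc j)
    then obtain m where m: "n = Suc m" by (cases n) auto
    then obtain a l where "k = a # l" "l \<in> words m" using Suc words_SucE by metis
    then show ?case using Suc.IH[of l m] Suc.prems m by auto
  qed
  then show "merge_at j (insert_at j (-1) k) = k" "merge_at j (insert_at (Suc j) (-1) k) = k" by auto
qed

lemma merge_at_merge_at:
  "i \<le> j \<Longrightarrow> Suc (Suc j) < length k
    \<Longrightarrow> merge_at i (merge_at (Suc j) k) = merge_at j (merge_at i k)"
proof (induction i arbitrary: j k)
  case 0
  then obtain a b c l where k: "k = a # b # c # l"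
    by (metis Suc_lessE length_Suc_conv Suc_less_eq2 less_nat_zero_code list.exhaust list.size(3))
  then show ?case by (cases j) (auto simp: max.assoc)
next
  case (Suc i)
  then show ?case by (cases j; cases k) auto
qed

lemma face_values:
  assumes "x \<in> nerve C (Suc n)" "i \<le> n" "\<alpha> \<in> signs"
  shows "face C (Suc n) (Suc i) \<alpha> x \<in> nerve C n"
    and "k \<in> words n \<Longrightarrow> face C (Suc n) (Suc i) \<alpha> x (R {k}) = x (R {insert_at i \<alpha> k})"
  using face_nerve[OF assms(1) _ assms(3), of "Suc i"] assms(2) by (auto simp: insert_at_def)

lemma connection_values:
  assumes "x \<in> nerve C n" "i < n"
  shows "connection C n (Suc i) x \<in> nerve C (Suc n)"
    and "k \<in> words (Suc n) \<Longrightarrow> connection C n (Suc i) x (R {k}) = x (R {merge_at i k})"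
  using connection_nerve[OF assms(1), of "Suc i"] assms(2) by (auto simp: merge_at_def)

text \<open>For the sign -1, this lemma and the four that follow are the identities between faces
  and degeneracies of a simplicial object, with connections as degeneracies and (n+1)-cubes as
  n-simplices.\<close>

lemma face_face:
  assumes x: "x \<in> nerve C (Suc (Suc n))" and ij: "i \<le> j" "j \<le> n" and s: "\<alpha> \<in> signs" "\<beta> \<in> signs"
  shows "face C (Suc n) (Suc i) \<alpha> (face C (Suc (Suc n)) (Suc (Suc j)) \<beta> x)
    = face C (Suc n) (Suc j) \<beta> (face C (Suc (Suc n)) (Suc i) \<alpha> x)"
proof (rule nerve_ext)
  have le: "Suc j \<le> Suc n" "i \<le> n" "i \<le> Suc n" using ij by auto
  note f1 = face_values[OF x le(1) s(2)] and f2 = face_values[OF x le(3) s(1)]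
  note g1 = face_values[OF f1(1) le(2) s(1)] and g2 = face_values[OF f2(1) ij(2) s(2)]
  show "face C (Suc n) (Suc i) \<alpha> (face C (Suc (Suc n)) (Suc (Suc j)) \<beta> x) \<in> nerve C n" by (rule g1)
  show "face C (Suc n) (Suc j) \<beta> (face C (Suc (Suc n)) (Suc i) \<alpha> x) \<in> nerve C n" by (rule g2)
  fix k assume k: "k \<in> words n"
  show "face C (Suc n) (Suc i) \<alpha> (face C (Suc (Suc n)) (Suc (Suc j)) \<beta> x) (R {k})
    = face C (Suc n) (Suc j) \<beta> (face C (Suc (Suc n)) (Suc i) \<alpha> x) (R {k})"
    using g1(2)[OF k] g2(2)[OF k] f1(2)[OF insert_at_words[OF le(2) s(1) k]]
      f2(2)[OF insert_at_words[OF ij(2) s(2) k]] insert_at_insert_at[OF ij(1), of k \<beta> \<alpha>] ij(2) length_words[OF k]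
    by simp
qed

lemma face_connection_less:
  assumes x: "x \<in> nerve C (Suc n)" and ij: "i \<le> j" "j < n" and s: "\<alpha> \<in> signs"
  shows "face C (Suc (Suc n)) (Suc i) \<alpha> (connection C (Suc n) (Suc (Suc j)) x)
    = connection C n (Suc j) (face C (Suc n) (Suc i) \<alpha> x)"
proof (rule nerve_ext)
  have le: "Suc j < Suc n" "i \<le> n" "i \<le> Suc n" using ij by auto
  note f1 = connection_values[OF x le(1)] and f2 = face_values[OF x le(2) s]
  note g1 = face_values[OF f1(1) le(3) s] and g2 = connection_values[OF f2(1) ij(2)]
  show "face C (Suc (Suc n)) (Suc i) \<alpha> (connection C (Suc n) (Suc (Suc j)) x) \<in> nerve C (Suc n)"
    by (rule g1)
  show "connection C n (Suc j) (face C (Suc n) (Suc i) \<alpha> x) \<in> nerve C (Suc n)" by (rule g2)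
  fix k assume k: "k \<in> words (Suc n)"
  show "face C (Suc (Suc n)) (Suc i) \<alpha> (connection C (Suc n) (Suc (Suc j)) x) (R {k})
    = connection C n (Suc j) (face C (Suc n) (Suc i) \<alpha> x) (R {k})"
    using g1(2)[OF k] g2(2)[OF k] f1(2)[OF insert_at_words[OF le(3) s k]]
      f2(2)[OF merge_at_words[OF ij(2) k]] merge_at_insert_at_less[OF ij(1)] ij(2) length_words[OF k]
    by simp
qed

lemma face_connection_greater:
  assumes x: "x \<in> nerve C (Suc n)" and ij: "Suc j \<le> i" "i \<le> n" and s: "\<alpha> \<in> signs"
  shows "face C (Suc (Suc n)) (Suc (Suc i)) \<alpha> (connection C (Suc n) (Suc j) x)
    = connection C n (Suc j) (face C (Suc n) (Suc i) \<alpha> x)"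
proof (rule nerve_ext)
  have le: "j < Suc n" "j < n" "Suc i \<le> Suc n" using ij by auto
  note f1 = connection_values[OF x le(1)] and f2 = face_values[OF x ij(2) s]
  note g1 = face_values[OF f1(1) le(3) s] and g2 = connection_values[OF f2(1) le(2)]
  show "face C (Suc (Suc n)) (Suc (Suc i)) \<alpha> (connection C (Suc n) (Suc j) x) \<in> nerve C (Suc n)"
    by (rule g1)
  show "connection C n (Suc j) (face C (Suc n) (Suc i) \<alpha> x) \<in> nerve C (Suc n)" by (rule g2)
  fix k assume k: "k \<in> words (Suc n)"
  show "face C (Suc (Suc n)) (Suc (Suc i)) \<alpha> (connection C (Suc n) (Suc j) x) (R {k})
    = connection C n (Suc j) (face C (Suc n) (Suc i) \<alpha> x) (R {k})"
    using g1(2)[OF k] g2(2)[OF k] f1(2)[OF insert_at_words[OF le(3) s k]]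
      f2(2)[OF merge_at_words[OF le(2) k]] merge_at_insert_at_greater[OF ij(1)] ij(2) length_words[OF k]
    by simp
qed

lemma face_connection_same:
  assumes x: "x \<in> nerve C n" and j: "j < n" and i: "i = j \<or> i = Suc j"
  shows "face C (Suc n) (Suc i) (-1) (connection C n (Suc j) x) = x"
proof (rule nerve_ext)
  have s: "(-1::int) \<in> signs" and le: "i \<le> n" using i j by auto
  note f = connection_values[OF x j]
  note g = face_values[OF f(1) le s]
  show "face C (Suc n) (Suc i) (-1) (connection C n (Suc j) x) \<in> nerve C n" by (rule g)
  show "x \<in> nerve C n" by (rule x)
  fix k assume k: "k \<in> words n"
  show "face C (Suc n) (Suc i) (-1) (connection C n (Suc j) x) (R {k}) = x (R {k})"
    using g(2)[OF k] f(2)[OF insert_at_words[OF le s k]] merge_at_insert_at_same[OF k j] i by auto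
qed

lemma connection_connection:
  assumes x: "x \<in> nerve C n" and ij: "i \<le> j" "j < n"
  shows "connection C (Suc n) (Suc (Suc j)) (connection C n (Suc i) x)
    = connection C (Suc n) (Suc i) (connection C n (Suc j) x)"
proof (rule nerve_ext)
  have le: "i < n" "Suc j < Suc n" "i < Suc n" using ij by auto
  note f1 = connection_values[OF x le(1)] and f2 = connection_values[OF x ij(2)]
  note g1 = connection_values[OF f1(1) le(2)] and g2 = connection_values[OF f2(1) le(3)]
  show "connection C (Suc n) (Suc (Suc j)) (connection C n (Suc i) x) \<in> nerve C (Suc (Suc n))"
    by (rule g1)
  show "connection C (Suc n) (Suc i) (connection C n (Suc j) x) \<in> nerve C (Suc (Suc n))" by (rule g2)
  fix k assume k: "k \<in> words (Suc (Suc n))"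
  show "connection C (Suc n) (Suc (Suc j)) (connection C n (Suc i) x) (R {k})
    = connection C (Suc n) (Suc i) (connection C n (Suc j) x) (R {k})"
    using g1(2)[OF k] g2(2)[OF k] f1(2)[OF merge_at_words[OF le(2) k]]
      f2(2)[OF merge_at_words[OF le(3) k]] merge_at_merge_at[OF ij(1)] ij(2) length_words[OF k]
    by simp
qed

section \<open>Edges at the initial corner\<close>

definition initial_edge :: "nat \<Rightarrow> nat \<Rightarrow> int list" where
  "initial_edge n i = (replicate n (-1))[i := 0]"

lemma length_initial_edge [simp]: "length (initial_edge n i) = n"
  by (simp add: initial_edge_def)

lemma nth_initial_edge: "l < n \<Longrightarrow> initial_edge n i ! l = (if l = i then 0 else -1)"
  by (simp add: initial_edge_def nth_list_update)

lemma initial_edge_words [simp]: "initial_edge n i \<in> words n"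
  using set_update_subset_insert[of "replicate n (-1::int)" i 0]
  by (force simp: initial_edge_def words_def)

lemma word_dim_replicate_minus [simp]: "word_dim (replicate n (-1)) = 0"
  by (induction n) auto

lemma word_dim_initial_edge: "i < n \<Longrightarrow> word_dim (initial_edge n i) = 1"
proof (induction n arbitrary: i)
  case (Suc n)
  then show ?case by (cases i) (auto simp: initial_edge_def)
qed simp

lemma nth_insert_at:
  "i \<le> length k \<Longrightarrow> l \<le> length k
    \<Longrightarrow> insert_at i a k ! l = (if l < i then k ! l else if l = i then a else k ! (l - 1))"
  by (auto simp: insert_at_def nth_append nth_Cons')

lemma nth_merge_at:
  "Suc i < length k \<Longrightarrow> l < length k - 1
    \<Longrightarrow> merge_at i k ! l = (if l < i then k ! l else if l = i then max (k ! i) (k ! Suc i) else k ! Suc l)"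
  by (auto simp: merge_at_def nth_append nth_Cons')

lemma length_insert_at [simp]: "length (insert_at i a k) = Suc (length k)"
  by (simp add: insert_at_def)

lemma length_merge_at: "Suc i < length k \<Longrightarrow> length (merge_at i k) = length k - 1"
  by (simp add: merge_at_def)

lemma insert_at_initial_edge:
  "i < n \<Longrightarrow> j \<le> n \<Longrightarrow> insert_at j (-1) (initial_edge n i) = initial_edge (Suc n) (if i < j then i else Suc i)"
  by (rule nth_equalityI) (auto simp: nth_insert_at nth_initial_edge)

lemma merge_at_initial_edge:
  "i \<le> n \<Longrightarrow> j < n \<Longrightarrow> merge_at j (initial_edge (Suc n) i) = initial_edge n (if i \<le> j then i else i - 1)"
  by (rule nth_equalityI) (auto simp: nth_merge_at nth_initial_edge length_merge_at)

lemma delete_initial_edge: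
  assumes "i < Suc n"
  shows "take i (initial_edge (Suc n) i) @ drop (Suc i) (initial_edge (Suc n) i) = replicate n (-1)"
  using assms by (simp add: initial_edge_def take_update_cancel drop_update_cancel replicate_add[symmetric] del: replicate_Suc)

lemma nerve_bd_generator_ge:
  assumes x: "x \<in> nerve C n" and k: "k \<in> words n" and a: "\<alpha> \<in> signs" and j: "word_dim k \<le> j"
  shows "bd C \<alpha> j (x (R {k})) = x (R {k})"
  using omega_functorD(2)[OF nerve_functor[OF x] generator_in_cube_cat[OF k] a, of j]
    bd_generator_ge[OF k a j] by simp

lemma nerve_carrier: "x \<in> nerve C n \<Longrightarrow> k \<in> words n \<Longrightarrow> x (R {k}) \<in> carrier C"
  using omega_functorD(1)[OF nerve_functor generator_in_cube_cat] by blast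

lemma nerve_0I:
  assumes C: "omega_category C" and v: "v \<in> carrier C" "src C 0 v = v" "tgt C 0 v = v"
  shows "cube_with_values C 0 (\<lambda>_. v) \<in> nerve C 0" "cube_with_values C 0 (\<lambda>_. v) (R {[]}) = v"
proof -
  interpret omega_category C by (rule C)
  have src_v: "src C p v = v" for p
    using bd_bd_ge[OF v(1), of "-1" "-1" 0 p] v(2) by simp
  have F: "omega_functor (cube_cat 0) C (\<lambda>_. v)"
  proof (rule omega_functor_cube_catI[OF C])
    fix U V p assume "composable C p v v"
    show "v = cmp C p v v" using cmp_src[OF v(1), of p] src_v by simp
  qed (use v in auto)
  show "cube_with_values C 0 (\<lambda>_. v) \<in> nerve C 0" "cube_with_values C 0 (\<lambda>_. v) (R {[]}) = v"
    using cube_with_values[OF F, of "\<lambda>_. v"] by auto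
qed

text \<open>
  A degenerate cube has a 0-dimensional edge at its initial corner, and conversely the initial edges
  of a cube are its iterated negative faces of dimension 1, which are degenerate if they are
  0-dimensional.
\<close>

lemma degenerate_initial_edge:
  assumes d: "degenerate C n x"
  shows "\<exists>i<n. src C 0 (x (R {initial_edge n i})) = x (R {initial_edge n i})"
proof -
  obtain m i y where n: "n = Suc m" and i: "i \<in> {1..n}" and y: "y \<in> nerve C m"
    and x: "x = degeneracy C m i y"
    using d by (auto simp: degenerate_def)
  define j where "j = i - 1"
  have ij: "i = Suc j" "j < Suc m" using i n by (auto simp: j_def)
  have "x (R {initial_edge n j}) = y (R {replicate m (-1)})"
    using degeneracy_nerve(2)[OF y, of i "initial_edge n j"] delete_initial_edge[OF ij(2)] ij n x
    by simp
  moreover have "replicate m (-1) \<in> words m" by (auto simp: words_def)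
  then have "src C 0 (y (R {replicate m (-1)})) = y (R {replicate m (-1)})"
    using nerve_bd_generator_ge[OF y] by simp
  ultimately show ?thesis using ij n by auto
qed

lemma face_initial_edge:
  assumes x: "x \<in> nerve C (Suc n)" and "i < n" "j \<le> n"
  shows "face C (Suc n) (Suc j) (-1) x (R {initial_edge n i})
    = x (R {initial_edge (Suc n) (if i < j then i else Suc i)})"
  using face_values(2)[OF x assms(3)] insert_at_initial_edge[OF assms(2,3)] by simp

lemma connection_initial_edge:
  assumes x: "x \<in> nerve C n" and "i \<le> n" "j < n"
  shows "connection C n (Suc j) x (R {initial_edge (Suc n) i})
    = x (R {initial_edge n (if i \<le> j then i else i - 1)})"
  using connection_values(2)[OF x assms(3)] merge_at_initial_edge[OF assms(2,3)] by simp

text \<open>By \<open>neg_nerve_iff\<close> this describes \<open>neg_nerve\<close> without iterated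
  faces. It tests only sources: an element that is its own 0-source is also its own
  0-target.\<close>

definition proper_initial_edges :: "'a omega_cat \<Rightarrow> nat \<Rightarrow> 'a cube \<Rightarrow> bool" where
  "proper_initial_edges C n x \<longleftrightarrow>
    (\<forall>i<n. src C 0 (x (R {initial_edge n i})) \<noteq> x (R {initial_edge n i}))"

lemma face_proper_initial_edges:
  assumes x: "x \<in> nerve C (Suc n)" and p: "proper_initial_edges C (Suc n) x" and j: "j \<le> n"
  shows "proper_initial_edges C n (face C (Suc n) (Suc j) (-1) x)"
  using face_initial_edge[OF x _ j] p by (auto simp: proper_initial_edges_def)

lemma neg_face_proper:
  assumes x: "x \<in> nerve C n" and p: "proper_initial_edges C n x"
  shows "neg_face C n x m y \<Longrightarrow> y \<in> nerve C m \<and> proper_initial_edges C m y"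
proof (induction rule: neg_face.induct)
  case (step m y i)
  then obtain j where "i = Suc j" "j \<le> m" by (cases i) auto
  then show ?case using step face_values(1)[of y C m j "-1"] face_proper_initial_edges[of y C m j] by simp
qed (use x p in auto)

lemma neg_face_trans:
  assumes x: "neg_face C n x m y"
  shows "neg_face C m y p z \<Longrightarrow> neg_face C n x p z"
  by (induction rule: neg_face.induct) (use x in \<open>auto intro: neg_face.step\<close>)

lemma neg_nerve_face:
  assumes x: "x \<in> neg_nerve C (Suc n)" and i: "i \<le> n"
  shows "face C (Suc n) (Suc i) (-1) x \<in> neg_nerve C n"
proof -
  have "neg_face C (Suc n) x n (face C (Suc n) (Suc i) (-1) x)"
    using i by (intro neg_face.step neg_face.refl) auto
  then show ?thesis using x face_values(1)[of x C n i "-1"] i neg_face_trans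
    unfolding neg_nerve_def by blast
qed

lemma neg_nerve_initial_edge:
  assumes C: "omega_category C"
  shows "x \<in> neg_nerve C n \<Longrightarrow> i < n \<Longrightarrow>
    src C 0 (x (R {initial_edge n i})) \<noteq> x (R {initial_edge n i})"
proof (induction n arbitrary: x i)
  case (Suc n)
  interpret omega_category C by (rule C)
  have x: "x \<in> nerve C (Suc n)" using Suc.prems by (simp add: neg_nerve_def)
  show ?case
  proof (cases "n = 0")
    case True
    have nondeg: "\<not> degenerate C 1 x"
      using Suc.prems True neg_face.refl[of C 1 x] by (auto simp: neg_nerve_def)
    have edge: "initial_edge (Suc n) i = [0]" using Suc.prems True by (simp add: initial_edge_def)
    have x1: "x \<in> nerve C 1" using x True by simp
    let ?v = "x (R {[0]})"
    have vc: "?v \<in> carrier C" by (rule nerve_carrier[OF x1]) simp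
    have bdv: "bd C \<alpha> 0 ?v = x (R {[\<alpha>]})" if a: "\<alpha> \<in> signs" for \<alpha>
      using omega_functorD(2)[OF nerve_functor[OF x1] generator_in_cube_cat a, of "[0]" 0]
        bd_generator_facets[of "[0]" 1 \<alpha> 0] a by simp
    have "src C 0 ?v \<noteq> ?v"
    proof
      assume eq: "src C 0 ?v = ?v"
      have "tgt C 0 (src C 0 ?v) = src C 0 ?v" by (rule bd_bd_ge[OF vc]) auto
      then have vals: "x (R {[-1]}) = ?v" "x (R {[1]}) = ?v" "tgt C 0 ?v = ?v"
        using eq bdv[of "-1"] bdv[of 1] by auto
      let ?z = "cube_with_values C 0 (\<lambda>_. ?v)"
      note z = nerve_0I[OF C vc eq vals(3)]
      have "x = degeneracy C 0 1 ?z"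
      proof (rule nerve_ext[OF x1])
        show "degeneracy C 0 1 ?z \<in> nerve C 1" using degeneracy_nerve(1)[OF z(1)] by simp
        fix k assume k: "k \<in> words 1"
        then obtain a where a: "k = [a]" "a = -1 \<or> a = 0 \<or> a = 1"
          unfolding One_nat_def by (elim words_SucE) auto
        have "degeneracy C 0 1 ?z (R {k}) = ?v"
          using degeneracy_nerve(2)[OF z(1), of 1 k] z(2) k a(1) by simp
        then show "x (R {k}) = degeneracy C 0 1 ?z (R {k})" using a vals by auto
      qed
      then show False using nondeg z(1) unfolding degenerate_def by force
    qed
    then show ?thesis using edge by simp
  next
    case False
    \<comment> \<open>A face transverse to the edge contains it: for \<open>i = 0\<close> the last
      negative face is taken, otherwise the first.\<close>
    obtain j l where jl: "j \<le> n" "l < n" "i = (if l < j then l else Suc l)"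
    proof (cases "i = 0")
      case True
      then show thesis using that[of n 0] False by simp
    next
      case i: False
      then show thesis using that[of 0 "i - 1"] Suc.prems(2) by auto
    qed
    show ?thesis
      using Suc.IH[OF neg_nerve_face[OF Suc.prems(1) jl(1)] jl(2)] face_initial_edge[OF x jl(2,1)] jl(3)
      by simp
  qed
qed simp

lemma neg_nerve_iff:
  assumes C: "omega_category C"
  shows "x \<in> neg_nerve C n \<longleftrightarrow> x \<in> nerve C n \<and> proper_initial_edges C n x"
proof (intro iffI conjI)
  assume x: "x \<in> neg_nerve C n"
  then show "x \<in> nerve C n" by (simp add: neg_nerve_def)
  show "proper_initial_edges C n x"
    using neg_nerve_initial_edge[OF C x] by (simp add: proper_initial_edges_def)
next
  assume x: "x \<in> nerve C n \<and> proper_initial_edges C n x"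
  have "\<not> degenerate C m y" if "neg_face C n x m y" for m y
    using neg_face_proper[OF _ _ that] x degenerate_initial_edge[of C m y]
    by (auto simp: proper_initial_edges_def)
  then show "x \<in> neg_nerve C n" using x by (simp add: neg_nerve_def)
qed

text \<open>Merging two letters of an initial edge gives an initial edge, so the initial edges of
  the connection are those of \<open>x\<close>, with one repeated.\<close>

lemma neg_nerve_connection:
  assumes C: "omega_category C" and x: "x \<in> neg_nerve C n" and i: "i < n"
  shows "connection C n (Suc i) x \<in> neg_nerve C (Suc n)"
proof -
  have xn: "x \<in> nerve C n" "proper_initial_edges C n x" using x neg_nerve_iff[OF C] by auto
  have "proper_initial_edges C (Suc n) (connection C n (Suc i) x)"
    unfolding proper_initial_edges_def
  proof (intro allI impI)
    fix l assume l: "l < Suc n"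
    have "(if l \<le> i then l else l - 1) < n" using l i by auto
    then show "src C 0 (connection C n (Suc i) x (R {initial_edge (Suc n) l}))
        \<noteq> connection C n (Suc i) x (R {initial_edge (Suc n) l})"
      using xn(2) connection_initial_edge[OF xn(1) _ i, of l] l unfolding proper_initial_edges_def by simp
  qed
  then show ?thesis using connection_values(1)[OF xn(1) i] neg_nerve_iff[OF C] by blast
qed

section \<open>Acyclicity of the connection subcomplex\<close>

definition frags :: "'c set \<Rightarrow> ('c \<Rightarrow>\<^sub>0 int) set" where
  "frags S = {c. Poly_Mapping.keys c \<subseteq> S}"

lemma carrier_free_Abelian_group_frags: "carrier (free_Abelian_group S) = frags S"
  by (simp add: frags_def free_Abelian_group_def)

lemma frags_0 [simp]: "0 \<in> frags S"
  by (simp add: frags_def)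

lemma frags_of [simp]: "frag_of x \<in> frags S \<longleftrightarrow> x \<in> S"
  by (simp add: frags_def)

lemma frags_add: "c \<in> frags S \<Longrightarrow> e \<in> frags S \<Longrightarrow> c + e \<in> frags S"
  unfolding frags_def using keys_add[of c e] by blast

lemma frags_cmul: "c \<in> frags S \<Longrightarrow> frag_cmul k c \<in> frags S"
  unfolding frags_def using keys_cmul[of k c] by blast

lemma frags_uminus: "c \<in> frags S \<Longrightarrow> - c \<in> frags S"
  using frags_cmul[of c S "-1"] by simp

lemma frags_diff: "c \<in> frags S \<Longrightarrow> e \<in> frags S \<Longrightarrow> c - e \<in> frags S"
  unfolding frags_def using keys_diff[of c e] by blast

lemma frags_sum: "(\<And>i. i \<in> I \<Longrightarrow> f i \<in> frags S) \<Longrightarrow> sum f I \<in> frags S"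
  by (induction I rule: infinite_finite_induct) (auto intro: frags_add)

lemma frags_mono: "c \<in> frags S \<Longrightarrow> S \<subseteq> T \<Longrightarrow> c \<in> frags T"
  by (auto simp: frags_def)

lemma frags_induct [consumes 1, case_names zero one diff]:
  assumes "c \<in> frags S" "P 0" "\<And>x. x \<in> S \<Longrightarrow> P (frag_of x)" "\<And>a b. P a \<Longrightarrow> P b \<Longrightarrow> P (a - b)"
  shows "P c"
  using assms(1) unfolding frags_def mem_Collect_eq by (rule frag_induction) (use assms in auto)

lemma frags_extend:
  assumes "c \<in> frags S" "\<And>x. x \<in> S \<Longrightarrow> f x \<in> frags T"
  shows "frag_extend f c \<in> frags T"
  using assms(1) by (induction rule: frags_induct) (auto simp: frag_extend_diff assms(2) intro: frags_diff)

lemma frags_Un: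
  assumes "c \<in> frags (A \<union> B)"
  obtains a b where "a \<in> frags A" "b \<in> frags B" "c = a + b"
proof -
  have "\<exists>a \<in> frags A. \<exists>b \<in> frags B. c = a + b" using assms
  proof (induction rule: frags_induct)
    case (one x)
    then consider "x \<in> A" | "x \<in> B" by blast
    then show ?case
    proof cases
      case 1
      then show ?thesis by (intro bexI[of _ "frag_of x"] bexI[of _ 0]) auto
    next
      case 2
      then show ?thesis by (intro bexI[of _ 0] bexI[of _ "frag_of x"]) auto
    qed
  next
    case (diff c e)
    then obtain a b a' b' where "a \<in> frags A" "b \<in> frags B" "c = a + b"
      "a' \<in> frags A" "b' \<in> frags B" "e = a' + b'" by blast
    then show ?case by (intro bexI[of _ "a - a'"] bexI[of _ "b - b'"]) (auto intro: frags_diff)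
  qed (auto intro!: bexI[of _ 0])
  then show thesis using that by blast
qed

lemma frags_image:
  assumes "c \<in> frags (g ` A)"
  obtains u where "u \<in> frags A" "c = frag_extend (\<lambda>x. frag_of (g x)) u"
proof -
  have "\<exists>u \<in> frags A. c = frag_extend (\<lambda>x. frag_of (g x)) u" using assms
  proof (induction rule: frags_induct)
    case (one y)
    then obtain x where "x \<in> A" "y = g x" by blast
    then show ?case by (intro bexI[of _ "frag_of x"]) auto
  next
    case (diff c e)
    then obtain u v where "u \<in> frags A" "v \<in> frags A" "c = frag_extend (\<lambda>x. frag_of (g x)) u"
      "e = frag_extend (\<lambda>x. frag_of (g x)) v" by blast
    then show ?case by (intro bexI[of _ "u - v"]) (auto simp: frag_extend_diff intro: frags_diff)
  qed (auto intro!: bexI[of _ 0])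
  then show thesis using that by blast
qed

lemma frag_cmul_alternating_sum:
  "frag_cmul ((-1) ^ j) (\<Sum>i\<in>I. frag_cmul ((-1) ^ i) (f i)) = (\<Sum>i\<in>I. frag_cmul ((-1) ^ (j + i)) (f i))"
  by (simp add: frag_cmul_sum power_add)

text \<open>The cancellation behind the vanishing of the squared boundary: the pairs (j, i) with i <
  j correspond to those with j \<le> i by sending (j, i) to (i, j - 1), with equal terms and
  opposite signs.\<close>

lemma alternating_double_sum_zero:
  fixes g :: "nat \<Rightarrow> nat \<Rightarrow> 'c \<Rightarrow>\<^sub>0 int"
  assumes g: "\<And>i j. i \<le> j \<Longrightarrow> j < n \<Longrightarrow> g (Suc j) i = g i j"
  shows "(\<Sum>j<Suc n. \<Sum>i<n. frag_cmul ((-1) ^ (j + i)) (g j i)) = 0"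
proof -
  let ?f = "\<lambda>(j, i). frag_cmul ((-1) ^ (j + i)) (g j i)"
  let ?A = "{(j, i). i < j \<and> j < Suc n}" and ?B = "{(j, i). j \<le> i \<and> i < n}"
  have fin: "finite ?A" "finite ?B"
    by (rule finite_subset[of _ "{..<Suc n} \<times> {..<Suc n}"]; force)+
  have "(\<Sum>j<Suc n. \<Sum>i<n. frag_cmul ((-1) ^ (j + i)) (g j i)) = sum ?f ({..<Suc n} \<times> {..<n})"
    by (simp add: sum.cartesian_product)
  also have "{..<Suc n} \<times> {..<n} = ?A \<union> ?B"
  proof (rule Set.set_eqI)
    fix p :: "nat \<times> nat"
    obtain j i where p: "p = (j, i)" by (cases p)
    show "p \<in> {..<Suc n} \<times> {..<n} \<longleftrightarrow> p \<in> ?A \<union> ?B" unfolding p by simp arith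
  qed
  also have "sum ?f (?A \<union> ?B) = sum ?f ?A + sum ?f ?B"
    by (rule sum.union_disjoint[OF fin]) fastforce
  also have "sum ?f ?A = sum (\<lambda>p. - ?f p) ?B"
    by (rule sum.reindex_bij_witness[of _ "\<lambda>(a, b). (Suc b, a)" "\<lambda>(j, i). (i, j - 1)"])
      (auto simp: g add.commute dest!: less_imp_Suc_add)
  finally show ?thesis by (simp add: sum_negf)
qed

text \<open>The boundary of a generator. With faces counted from 0 the exponent of the sign is
  shifted by 2.\<close>

definition corner_bd :: "'a omega_cat \<Rightarrow> nat \<Rightarrow> 'a cube \<Rightarrow> ('a cube \<Rightarrow>\<^sub>0 int)" where
  "corner_bd C n x = (\<Sum>i<n. frag_cmul ((-1) ^ i) (frag_of (face C n (Suc i) (-1) x)))"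

lemma bdry_corner_complex: "bdry (corner_complex C) n = frag_extend (corner_bd C n)"
  unfolding corner_complex_def corner_bd_def by (simp add: sum.atLeast1_atMost_eq)

lemma grp_corner_complex: "grp (corner_complex C) n = free_Abelian_group (neg_nerve C n)"
  by (simp add: corner_complex_def)

lemma corner_bd_frags: "x \<in> neg_nerve C (Suc n) \<Longrightarrow> corner_bd C (Suc n) x \<in> frags (neg_nerve C n)"
  unfolding corner_bd_def by (intro frags_sum frags_cmul) (simp add: neg_nerve_face)

lemma frag_extend_corner_bd_corner_bd:
  assumes c: "c \<in> frags (neg_nerve C (Suc (Suc n)))"
  shows "frag_extend (corner_bd C (Suc n)) (frag_extend (corner_bd C (Suc (Suc n))) c) = 0"
  using c
proof (induction rule: frags_induct)
  case (one x)
  then have x: "x \<in> nerve C (Suc (Suc n))" by (simp add: neg_nerve_def)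
  let ?g = "\<lambda>j i. frag_of (face C (Suc n) (Suc i) (-1) (face C (Suc (Suc n)) (Suc j) (-1) x))"
  have "frag_extend (corner_bd C (Suc n)) (corner_bd C (Suc (Suc n)) x)
    = (\<Sum>j<Suc (Suc n). frag_cmul ((-1) ^ j) (corner_bd C (Suc n) (face C (Suc (Suc n)) (Suc j) (-1) x)))"
    unfolding corner_bd_def[of _ "Suc (Suc n)"]
    by (subst frag_extend_sum) (auto simp: frag_extend_cmul)
  also have "\<dots> = (\<Sum>j<Suc (Suc n). \<Sum>i<Suc n. frag_cmul ((-1) ^ (j + i)) (?g j i))"
    unfolding corner_bd_def frag_cmul_alternating_sum ..
  also have "\<dots> = 0"
    by (rule alternating_double_sum_zero) (simp add: face_face[OF x])
  finally show ?case by simp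
qed (auto simp: frag_extend_diff)

lemma generate_frag_of:
  assumes S: "S \<subseteq> T"
  shows "generate (free_Abelian_group T) (frag_of ` S) = frags S"
proof
  let ?G = "free_Abelian_group T"
  interpret comm_group ?G by (rule abelian_free_Abelian_group)
  have car: "frag_of ` S \<subseteq> carrier ?G" using S by (auto simp: carrier_free_Abelian_group_frags)
  show "generate ?G (frag_of ` S) \<subseteq> frags S"
  proof
    fix c assume "c \<in> generate ?G (frag_of ` S)"
    then show "c \<in> frags S"
    proof induction
      case (inv h)
      then have "h \<in> frags T" "h \<in> frags S" using S by auto
      then show ?case by (simp add: frags_def frags_uminus[unfolded frags_def, simplified])
    qed (auto intro: frags_add)
  qed
  show "frags S \<subseteq> generate ?G (frag_of ` S)"
  proof
    fix c assume "c \<in> frags S"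
    then show "c \<in> generate ?G (frag_of ` S)"
    proof (induction rule: frags_induct)
      case zero
      then show ?case using generate.one[of ?G] by simp
    next
      case (one x)
      then show ?case by (auto intro: generate.incl)
    next
      case (diff a b)
      have b: "b \<in> carrier ?G" using diff(2) generate_incl[OF car] by blast
      have "inv\<^bsub>?G\<^esub> b \<in> generate ?G (frag_of ` S)" by (rule generate_m_inv_closed[OF car diff(2)])
      then have "a \<otimes>\<^bsub>?G\<^esub> inv\<^bsub>?G\<^esub> b \<in> generate ?G (frag_of ` S)" by (rule generate.eng[OF diff(1)])
      moreover have "inv\<^bsub>?G\<^esub> b = - b" using b by simp
      ultimately show ?case by simp
    qed
  qed
qed

text \<open>The connections with index at most \<open>p\<close>, in the numbering that starts with 1.\<close>

definition connections :: "'a omega_cat \<Rightarrow> nat \<Rightarrow> nat \<Rightarrow> 'a cube set" where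
  "connections C p m = {connection C m (Suc i) y | i y. i < p \<and> i < m \<and> y \<in> neg_nerve C m}"

lemma connections_neg_nerve: "omega_category C \<Longrightarrow> connections C p m \<subseteq> neg_nerve C (Suc m)"
  by (auto simp: connections_def neg_nerve_connection)

lemma connections_mono: "p \<le> q \<Longrightarrow> connections C p m \<subseteq> connections C q m"
  unfolding connections_def by (fastforce intro: less_le_trans)

lemma connections_stable: "m \<le> p \<Longrightarrow> connections C p m = connections C m m"
  unfolding connections_def by (fastforce intro: less_le_trans)

lemma D_minus_0: "omega_category C \<Longrightarrow> D_minus C 0 = {0}"
  using generate_frag_of[of "{}" "neg_nerve C 0"] by (auto simp: D_minus_def frags_def)

lemma D_minus_Suc:
  assumes C: "omega_category C"
  shows "D_minus C (Suc m) = frags (connections C m m)"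
proof -
  have "{frag_of (connection C (Suc m - 1) i y) | i y.
      Suc m \<ge> 2 \<and> i \<in> {1..Suc m - 1} \<and> y \<in> neg_nerve C (Suc m - 1)} = frag_of ` connections C m m"
    (is "?L = ?R")
  proof
    show "?L \<subseteq> ?R"
    proof
      fix c assume "c \<in> ?L"
      then obtain i y where c: "c = frag_of (connection C m i y)" "i \<in> {1..m}" "y \<in> neg_nerve C m" by auto
      then obtain j where "i = Suc j" "j < m" by (cases i) auto
      then show "c \<in> ?R" using c unfolding connections_def by blast
    qed
    show "?R \<subseteq> ?L" unfolding connections_def by fastforce
  qed
  then show ?thesis unfolding D_minus_def
    using generate_frag_of[OF connections_neg_nerve[OF C]] by simp
qed

definition connect :: "'a omega_cat \<Rightarrow> nat \<Rightarrow> nat \<Rightarrow> ('a cube \<Rightarrow>\<^sub>0 int) \<Rightarrow> ('a cube \<Rightarrow>\<^sub>0 int)" where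
  "connect C n p = frag_extend (\<lambda>y. frag_of (connection C n (Suc p) y))"

lemma connect_diff: "connect C n p (v - w) = connect C n p v - connect C n p w"
  by (simp add: connect_def frag_extend_diff)

text \<open>The part of the boundary that survives when it is applied to a connection of index
  \<open>p\<close>, counted from 0, modulo connections of smaller index.\<close>

definition upper_faces :: "'a omega_cat \<Rightarrow> nat \<Rightarrow> nat \<Rightarrow> 'a cube \<Rightarrow> ('a cube \<Rightarrow>\<^sub>0 int)" where
  "upper_faces C n p y =
    (\<Sum>j\<in>{Suc p..<Suc n}. frag_cmul ((-1) ^ j) (frag_of (face C (Suc n) (Suc j) (-1) y)))"

lemma connect_upper_faces:
  "connect C n p (upper_faces C n p y)
    = (\<Sum>j\<in>{Suc p..<Suc n}. frag_cmul ((-1) ^ j) (frag_of (connection C n (Suc p) (face C (Suc n) (Suc j) (-1) y))))"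
  unfolding connect_def upper_faces_def by (subst frag_extend_sum) (auto simp: frag_extend_cmul)

lemma upper_faces_frags:
  "y \<in> neg_nerve C (Suc n) \<Longrightarrow> upper_faces C n p y \<in> frags (neg_nerve C n)"
  unfolding upper_faces_def by (intro frags_sum frags_cmul) (simp add: neg_nerve_face)

lemma connect_frags:
  "omega_category C \<Longrightarrow> p < n \<Longrightarrow> c \<in> frags (neg_nerve C n) \<Longrightarrow> connect C n p c \<in> frags (neg_nerve C (Suc n))"
  unfolding connect_def by (erule frags_extend) (simp add: neg_nerve_connection)

text \<open>Faces of index below \<open>p\<close> give connections of smaller index, the faces
  \<open>p\<close> and \<open>p + 1\<close> cancel, and the remaining ones commute with the
  connection at the cost of an index shift, hence of a sign.\<close>

lemma corner_bd_connection:
  assumes y: "y \<in> neg_nerve C (Suc n)" and p: "p < Suc n"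
  shows "corner_bd C (Suc (Suc n)) (connection C (Suc n) (Suc p) y) + connect C n p (upper_faces C n p y)
    \<in> frags (connections C p n)"
proof -
  have yn: "y \<in> nerve C (Suc n)" using y by (simp add: neg_nerve_def)
  let ?d = "\<lambda>j. frag_cmul ((-1) ^ j) (frag_of (face C (Suc (Suc n)) (Suc j) (-1) (connection C (Suc n) (Suc p) y)))"
  let ?u = "\<lambda>j. frag_cmul ((-1) ^ j) (frag_of (connection C n (Suc p) (face C (Suc n) (Suc j) (-1) y)))"
  have "{..<Suc (Suc n)} = {..<p} \<union> ({p, Suc p} \<union> {Suc (Suc p)..<Suc (Suc n)})" using p by auto
  then have "corner_bd C (Suc (Suc n)) (connection C (Suc n) (Suc p) y)
    = sum ?d ({..<p} \<union> ({p, Suc p} \<union> {Suc (Suc p)..<Suc (Suc n)}))" unfolding corner_bd_def by simp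
  also have "\<dots> = sum ?d {..<p} + (sum ?d {p, Suc p} + sum ?d {Suc (Suc p)..<Suc (Suc n)})"
    by (subst sum.union_disjoint; force)+
  also have "sum ?d {p, Suc p} = 0"
    using face_connection_same[OF yn p, of p] face_connection_same[OF yn p, of "Suc p"]
    by (simp flip: minus_frag_cmul)
  also have "sum ?d {Suc (Suc p)..<Suc (Suc n)} = sum (\<lambda>j. ?d (Suc j)) {Suc p..<Suc n}"
    by (rule sum.shift_bounds_Suc_ivl)
  also have "\<dots> = sum (\<lambda>j. - ?u j) {Suc p..<Suc n}"
    using face_connection_greater[OF yn] by (intro sum.cong) auto
  finally have "corner_bd C (Suc (Suc n)) (connection C (Suc n) (Suc p) y) + connect C n p (upper_faces C n p y)
    = sum ?d {..<p}" 
    unfolding connect_upper_faces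
    by (simp only: sum_negf diff_0 add_uminus_conv_diff diff_add_cancel)
  also have "\<dots> \<in> frags (connections C p n)"
  proof (intro frags_sum frags_cmul)
    fix j assume j: "j \<in> {..<p}"
    then obtain q where q: "p = Suc q" by (cases p) auto
    have "face C (Suc (Suc n)) (Suc j) (-1) (connection C (Suc n) (Suc p) y)
      = connection C n (Suc q) (face C (Suc n) (Suc j) (-1) y)"
      unfolding q by (rule face_connection_less[OF yn]) (use j p q in auto)
    moreover have "face C (Suc n) (Suc j) (-1) y \<in> neg_nerve C n"
      using j p by (intro neg_nerve_face[OF y]) simp
    ultimately show "frag_of (face C (Suc (Suc n)) (Suc j) (-1) (connection C (Suc n) (Suc p) y))
      \<in> frags (connections C p n)"
      using p q unfolding connections_def frags_of by blast
  qed
  finally show ?thesis .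
qed

lemma corner_bd_connect:
  assumes u: "u \<in> frags (neg_nerve C (Suc n))" and p: "p < Suc n"
  shows "frag_extend (corner_bd C (Suc (Suc n))) (connect C (Suc n) p u)
      + connect C n p (frag_extend (upper_faces C n p) u) \<in> frags (connections C p n)"
  using u
proof (induction rule: frags_induct)
  case (one y)
  then show ?case using corner_bd_connection[OF _ p] by (simp add: connect_def)
next
  case (diff a b)
  then show ?case using frags_diff[OF diff] 
    unfolding frag_extend_diff connect_diff by (simp add: algebra_simps)
qed (simp add: connect_def)

text \<open>A connection of index \<open>p\<close> after one of smaller index i is, by the
  simplicial identity, a connection of index i again.\<close>

lemma connect_connections:
  assumes C: "omega_category C" and c: "c \<in> frags (connections C p n)" and p: "p < Suc n"
  shows "connect C (Suc n) p c \<in> frags (connections C p (Suc n))"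
  unfolding connect_def using c
proof (rule frags_extend)
  fix x assume "x \<in> connections C p n"
  then obtain i y where x: "x = connection C n (Suc i) y" "i < p" "i < n" "y \<in> neg_nerve C n"
    by (auto simp: connections_def)
  obtain q where q: "p = Suc q" using x(2) by (cases p) auto
  have yn: "y \<in> nerve C n" using x(4) by (simp add: neg_nerve_def)
  have "connection C (Suc n) (Suc p) x = connection C (Suc n) (Suc i) (connection C n (Suc q) y)"
    unfolding q x(1) by (rule connection_connection[OF yn]) (use x p q in auto)
  moreover have "connection C n (Suc q) y \<in> neg_nerve C (Suc n)"
    using p q by (intro neg_nerve_connection[OF C x(4)]) simp
  ultimately show "frag_of (connection C (Suc n) (Suc p) x) \<in> frags (connections C p (Suc n))"
    using x(2,3) unfolding connections_def frags_of by fastforce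
qed

lemma frags_connections_Suc:
  assumes c: "c \<in> frags (connections C (Suc p) m)" and p: "p < m"
  obtains u e where "u \<in> frags (neg_nerve C m)" "e \<in> frags (connections C p m)" "c = connect C m p u + e"
proof -
  have "connections C (Suc p) m = connection C m (Suc p) ` neg_nerve C m \<union> connections C p m"
    using p by (auto simp: connections_def less_Suc_eq)
  then obtain a e where a: "a \<in> frags (connection C m (Suc p) ` neg_nerve C m)"
    "e \<in> frags (connections C p m)" "c = a + e" using c frags_Un by metis
  then obtain u where "u \<in> frags (neg_nerve C m)" "a = connect C m p u"
    unfolding connect_def by (metis frags_image)
  then show thesis using that a by blast
qed

lemma corner_bd_connections:
  assumes C: "omega_category C"
  shows "c \<in> frags (connections C p (Suc n))
    \<Longrightarrow> frag_extend (corner_bd C (Suc (Suc n))) c \<in> frags (connections C p n)"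
proof (induction p arbitrary: c)
  case 0
  then have "c = 0" by (simp add: connections_def frags_def)
  then show ?case by simp
next
  case (Suc p)
  show ?case
  proof (cases "p < Suc n")
    case True
    obtain u e where u: "u \<in> frags (neg_nerve C (Suc n))" and e: "e \<in> frags (connections C p (Suc n))"
      and c: "c = connect C (Suc n) p u + e" by (rule frags_connections_Suc[OF Suc.prems True])
    \<comment> \<open>For \<open>p = n\<close> an n-cube has no connection of this index, but then
      the sum of the upper faces is empty. Both cases are expressed by the support.\<close>
    have up: "frag_extend (upper_faces C n p) u \<in> frags (if p < n then neg_nerve C n else {})"
    proof (cases "p < n")
      case False
      then show ?thesis using True by (intro frags_extend[OF u]) (simp add: upper_faces_def)
    qed (simp add: frags_extend[OF u upper_faces_frags])
    have "connect C n p (frag_extend (upper_faces C n p) u) \<in> frags (connections C (Suc p) n)"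
      unfolding connect_def by (rule frags_extend[OF up]) (auto simp: connections_def split: if_splits)
    moreover have "frag_extend (corner_bd C (Suc (Suc n))) (connect C (Suc n) p u)
        + connect C n p (frag_extend (upper_faces C n p) u) \<in> frags (connections C (Suc p) n)"
      using frags_mono[OF corner_bd_connect[OF u True] connections_mono] by simp
    ultimately have "frag_extend (corner_bd C (Suc (Suc n))) (connect C (Suc n) p u)
        \<in> frags (connections C (Suc p) n)" using frags_diff by fastforce
    moreover have "frag_extend (corner_bd C (Suc (Suc n))) e \<in> frags (connections C (Suc p) n)"
      using frags_mono[OF Suc.IH[OF e] connections_mono] by simp
    ultimately show ?thesis unfolding c frag_extend_add by (rule frags_add)
  next
    case False
    then have "connections C (Suc p) (Suc n) = connections C p (Suc n)"
      using connections_stable[of "Suc n" p C] connections_stable[of "Suc n" "Suc p" C] by simp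
    then show ?thesis using frags_mono[OF Suc.IH connections_mono[of p "Suc p" C n]] Suc.prems by simp
  qed
qed

text \<open>
  Modulo \<open>connections C p\<close>, the maps \<open>\<plusminus>connect p\<close> form a contracting homotopy of the chains of
  \<open>connections C (Suc p)\<close>, as in the normalization theorem for simplicial abelian groups.
\<close>

lemma connections_contraction:
  assumes C: "omega_category C" and c: "c \<in> frags (connections C (Suc p) (Suc n))"
    and bd: "frag_extend (corner_bd C (Suc (Suc n))) c \<in> frags (connections C p n)"
  shows "\<exists>b \<in> frags (connections C (Suc p) (Suc (Suc n))).
    c - frag_extend (corner_bd C (Suc (Suc (Suc n)))) b \<in> frags (connections C p (Suc n))"
proof (cases "p < Suc n")
  case False
  then have "connections C (Suc p) (Suc n) = connections C p (Suc n)"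
      using connections_stable[of "Suc n" p C] connections_stable[of "Suc n" "Suc p" C] by simp
  then show ?thesis using c by (intro bexI[of _ 0]) auto
next
  case p: True
  let ?d2 = "frag_extend (corner_bd C (Suc (Suc n)))" and ?d3 = "frag_extend (corner_bd C (Suc (Suc (Suc n))))"
  let ?F = "frags (connections C p (Suc n))"
  obtain u e where u: "u \<in> frags (neg_nerve C (Suc n))" and e: "e \<in> ?F"
    and ce: "c = connect C (Suc n) p u + e" by (rule frags_connections_Suc[OF c p])
  let ?Su = "connect C (Suc n) p u" and ?up = "connect C n p (frag_extend (upper_faces C n p) u)"
  have Su: "?Su \<in> frags (neg_nerve C (Suc (Suc n)))" by (rule connect_frags[OF C p u])
  have "?d2 ?Su = ?d2 c - ?d2 e" by (simp add: ce frag_extend_add)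
  \<comment> \<open>The boundaries of \<open>c\<close> and \<open>e\<close> lie in the lower stage,
    hence so does that of \<open>?Su\<close>, and by \<open>corner_bd_connect\<close> also
    \<open>?up\<close>. This makes the second term of \<open>upS\<close> negligible.\<close>
  then have "?d2 ?Su \<in> frags (connections C p n)"
    using frags_diff[OF bd corner_bd_connections[OF C e]] by simp
  then have "?up \<in> frags (connections C p n)"
    using frags_diff[OF corner_bd_connect[OF u p]] by fastforce
  then have S_up: "connect C (Suc n) p ?up \<in> ?F" by (rule connect_connections[OF C _ p])
  \<comment> \<open>Among the upper faces of a connection, the one of index \<open>p + 1\<close>
    returns the cube and the others commute with the connection. Thus the repeated connection of
    \<open>u\<close> bounds \<open>?Su\<close> up to sign, modulo the lower stage.\<close>
  have upS: "connect C (Suc n) p (frag_extend (upper_faces C (Suc n) p) ?Su)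
    = frag_cmul ((-1) ^ Suc p) ?Su - connect C (Suc n) p ?up"
    using u
  proof (induction rule: frags_induct)
    case (one y)
    then have yn: "y \<in> nerve C (Suc n)" by (simp add: neg_nerve_def)
    let ?y = "connection C (Suc n) (Suc p) y"
    let ?t = "\<lambda>j. frag_cmul ((-1) ^ j) (frag_of (connection C (Suc n) (Suc p) (face C (Suc (Suc n)) (Suc j) (-1) ?y)))"
    let ?w = "\<lambda>j. frag_cmul ((-1) ^ j) (frag_of (connection C (Suc n) (Suc p) (connection C n (Suc p) (face C (Suc n) (Suc j) (-1) y))))"
    have w: "connect C (Suc n) p (connect C n p (upper_faces C n p y)) = sum ?w {Suc p..<Suc n}"
      unfolding connect_upper_faces connect_def[of C "Suc n"]
      by (subst frag_extend_sum) (simp_all add: frag_extend_cmul del: sum.op_ivl_Suc)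
    have "connect C (Suc n) p (upper_faces C (Suc n) p ?y) = sum ?t {Suc p..<Suc (Suc n)}"
      by (rule connect_upper_faces)
    also have "\<dots> = ?t (Suc p) + sum ?t {Suc (Suc p)..<Suc (Suc n)}"
      using p by (simp only: sum.atLeast_Suc_lessThan Suc_less_eq)
    also have "?t (Suc p) = frag_cmul ((-1) ^ Suc p) (frag_of ?y)"
      using face_connection_same[OF yn p, of "Suc p"] by simp
    also have "sum ?t {Suc (Suc p)..<Suc (Suc n)} = sum (\<lambda>j. ?t (Suc j)) {Suc p..<Suc n}"
      by (rule sum.shift_bounds_Suc_ivl)
    also have "\<dots> = sum (\<lambda>j. - ?w j) {Suc p..<Suc n}"
      using face_connection_greater[OF yn] by (intro sum.cong) auto
    also have "\<dots> = - connect C (Suc n) p (connect C n p (upper_faces C n p y))"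
      unfolding w by (rule sum_negf)
    finally show ?case by (simp add: connect_def)
  next
    case (diff a b)
    have "frag_cmul k (v - w) = frag_cmul k v - frag_cmul k w" for k and v w :: "'a cube \<Rightarrow>\<^sub>0 int"
      using frag_cmul_distrib2[of k v "- w"] frag_cmul_distrib2[of k "v - w" w] by (simp add: algebra_simps)
    then show ?case using diff by (simp add: frag_extend_diff connect_diff)
  qed (simp add: connect_def)
  let ?SSu = "connect C (Suc (Suc n)) p ?Su"
  have "?d3 ?SSu + connect C (Suc n) p (frag_extend (upper_faces C (Suc n) p) ?Su) \<in> ?F"
    by (rule corner_bd_connect[OF Su]) (use p in simp)
  then have "?d3 ?SSu + frag_cmul ((-1) ^ Suc p) ?Su \<in> ?F"
    using frags_add[OF _ S_up] unfolding upS by fastforce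
  then have "frag_cmul (- ((-1) ^ p)) (?d3 ?SSu + frag_cmul (- ((-1) ^ p)) ?Su) \<in> ?F"
    by (intro frags_cmul) simp
  moreover have "frag_cmul (- k) (v + frag_cmul (- k) w) = w - frag_cmul k v"
    if "k * k = 1" for k and v w :: "'a cube \<Rightarrow>\<^sub>0 int"
    using that by (simp add: frag_cmul_distrib2)
  moreover have "(-1) ^ p * (-1) ^ p = (1::int)" by (simp flip: power_add)
  ultimately have "?Su - ?d3 (frag_cmul ((-1) ^ p) ?SSu) \<in> ?F"
    unfolding frag_extend_cmul by metis
  then have "c - ?d3 (frag_cmul ((-1) ^ p) ?SSu) \<in> ?F"
    using frags_add[OF _ e] unfolding ce by (fastforce simp: algebra_simps)
  moreover have "frag_cmul ((-1) ^ p) ?SSu \<in> frags (connections C (Suc p) (Suc (Suc n)))"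
    unfolding connect_def[of C "Suc (Suc n)"]
    using p by (intro frags_cmul frags_extend[OF Su]) (auto simp: connections_def intro!: exI[of _ p])
  ultimately show ?thesis by blast
qed

text \<open>Subtracting the boundary supplied by the contraction moves a cycle one stage down, and
  stage 0 is zero.\<close>

lemma connections_acyclic:
  assumes C: "omega_category C"
  shows "c \<in> frags (connections C p (Suc n)) \<Longrightarrow> frag_extend (corner_bd C (Suc (Suc n))) c = 0
    \<Longrightarrow> \<exists>b \<in> frags (connections C p (Suc (Suc n))). frag_extend (corner_bd C (Suc (Suc (Suc n)))) b = c"
proof (induction p arbitrary: c)
  case 0
  then have "c = 0" by (simp add: connections_def frags_def)
  then show ?case by (intro bexI[of _ 0]) auto
next
  case (Suc p)
  let ?d2 = "frag_extend (corner_bd C (Suc (Suc n)))" and ?d3 = "frag_extend (corner_bd C (Suc (Suc (Suc n))))"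
  obtain b where b: "b \<in> frags (connections C (Suc p) (Suc (Suc n)))"
    "c - ?d3 b \<in> frags (connections C p (Suc n))"
    using connections_contraction[OF C Suc.prems(1)] Suc.prems(2) by auto
  have "b \<in> frags (neg_nerve C (Suc (Suc (Suc n))))"
    using frags_mono[OF b(1) connections_neg_nerve[OF C]] .
  then have "?d2 (c - ?d3 b) = 0"
    using frag_extend_corner_bd_corner_bd Suc.prems(2) by (simp add: frag_extend_diff)
  then obtain b' where b': "b' \<in> frags (connections C p (Suc (Suc n)))" "?d3 b' = c - ?d3 b"
    using Suc.IH[OF b(2)] by blast
  have "b + b' \<in> frags (connections C (Suc p) (Suc (Suc n)))"
    using frags_add[OF b(1) frags_mono[OF b'(1) connections_mono]] by simp
  moreover have "?d3 (b + b') = c" using b'(2) by (simp add: frag_extend_add)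
  ultimately show ?case by blast
qed

lemma connections_0 [simp]: "connections C p 0 = {}"
  by (simp add: connections_def)

lemma D_minus_frags: "omega_category C \<Longrightarrow> D_minus C n = frags (if n = 0 then {} else connections C (n - 1) (n - 1))"
  by (cases n) (auto simp: D_minus_0 D_minus_Suc frags_def)

lemma D_minus_subcomplex:
  assumes C: "omega_category C" and c: "c \<in> D_minus C (Suc n)"
  shows "bdry (corner_complex C) (Suc n) c \<in> D_minus C n"
proof (cases n)
  case 0
  then have "c = 0" using c by (simp add: D_minus_Suc[OF C] frags_def)
  then show ?thesis by (simp add: bdry_corner_complex D_minus_frags[OF C])
next
  case (Suc m)
  have "connections C (Suc m) m = connections C m m" by (rule connections_stable) simp
  then show ?thesis using corner_bd_connections[OF C, of c "Suc m" m] c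
    unfolding Suc D_minus_Suc[OF C] bdry_corner_complex by simp
qed

lemma D_minus_acyclic:
  assumes C: "omega_category C" and c: "c \<in> D_minus C n"
    and cyc: "n = 0 \<or> bdry (corner_complex C) n c = 0"
  shows "\<exists>b \<in> D_minus C (Suc n). bdry (corner_complex C) (Suc n) b = c"
proof -
  have triv: ?thesis if "c = 0"
    using that D_minus_Suc[OF C] by (intro bexI[of _ 0]) (simp_all add: bdry_corner_complex)
  show ?thesis
  proof (cases n)
    case 0
    then show ?thesis using triv c by (simp add: D_minus_frags[OF C] frags_def)
  next
    case (Suc m)
    show ?thesis
    proof (cases m)
      case 0
      then show ?thesis using triv c Suc by (simp add: D_minus_frags[OF C] frags_def)
    next
      case (Suc r)
      have "c \<in> frags (connections C (Suc r) (Suc r))"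
        using c \<open>n = Suc m\<close> Suc by (simp add: D_minus_Suc[OF C])
      moreover have "frag_extend (corner_bd C (Suc (Suc r))) c = 0"
        using cyc \<open>n = Suc m\<close> Suc by (simp add: bdry_corner_complex)
      ultimately obtain b where b: "b \<in> frags (connections C (Suc r) (Suc (Suc r)))"
        "frag_extend (corner_bd C (Suc (Suc (Suc r)))) b = c"
        using connections_acyclic[OF C] by blast
      have "b \<in> D_minus C (Suc n)"
        using frags_mono[OF b(1) connections_mono[of "Suc r" "Suc (Suc r)"]] \<open>n = Suc m\<close> Suc
        by (simp add: D_minus_Suc[OF C])
      then show ?thesis using b(2) \<open>n = Suc m\<close> Suc by (auto simp: bdry_corner_complex)
    qed
  qed
qed

section \<open>Cubes that factor through the globe\<close>

text \<open>The infinite globe, with one cell for each sign and dimension. Of two cells composable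
  along dimension n at most one has dimension above n, and it is the composite; otherwise the two
  are equal.\<close>

definition globe_cat :: "(int \<times> nat) omega_cat" where
  "globe_cat = \<lparr>carrier = signs \<times> UNIV,
    bd = (\<lambda>\<alpha> n c. if n < snd c then (\<alpha>, n) else c),
    cmp = (\<lambda>n c d. if snd c \<le> n then d else c)\<rparr>"

lemma globe_cat_simps [simp]:
  "carrier globe_cat = signs \<times> UNIV"
  "bd globe_cat \<alpha> n c = (if n < snd c then (\<alpha>, n) else c)"
  "cmp globe_cat n c d = (if snd c \<le> n then d else c)"
  by (simp_all add: globe_cat_def)

lemma composable_globe_cat:
  "composable globe_cat n c d \<longleftrightarrow> c \<in> signs \<times> UNIV \<and> d \<in> signs \<times> UNIV \<and>
    (if n < snd c then d = (1, n) else if n < snd d then c = (-1, n) else c = d)"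
  unfolding composable_def by (cases c; cases d) auto

lemma composable_globe_catD:
  assumes "composable globe_cat n c d"
  shows "if n < snd c then d = (1, n) else if n < snd d then c = (-1, n) else c = d"
  using assms unfolding composable_globe_cat by blast

lemma omega_category_globe_cat: "omega_category globe_cat"
proof
  fix m n :: nat and x y z w
  assume mn: "m \<noteq> n" and c: "composable globe_cat n x y" "composable globe_cat n z w"
    "composable globe_cat m x z" "composable globe_cat m y w"
  note d = c[THEN composable_globe_catD]
  show "cmp globe_cat m (cmp globe_cat n x y) (cmp globe_cat n z w)
    = cmp globe_cat n (cmp globe_cat m x z) (cmp globe_cat m y w)"
  proof -
    \<comment> \<open>If both dimensions were too large, \<open>w\<close> would have dimension n and
      also dimension m.\<close>
    have "w = (1, n)" if "n < snd z" using that d(2) by simp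
    moreover have "w = (1, m)" if "m < snd y" using that d(4) by simp
    ultimately have zy: "snd z \<le> n \<or> snd y \<le> m" using mn by fastforce
    have xz: "snd z = m" if "m < snd x" using that d(3) by simp
    have xy: "snd y = n" if "n < snd x" using that d(1) by simp
    consider "snd x \<le> n" "snd x \<le> m" | "snd x \<le> n" "m < snd x" | "n < snd x" "snd x \<le> m"
      | "n < snd x" "m < snd x" by linarith
    then show ?thesis
    proof cases
      case 1
      then show ?thesis unfolding globe_cat_simps using zy by auto
    next
      case 2
      then show ?thesis unfolding globe_cat_simps using xz by simp
    next
      case 3
      then show ?thesis unfolding globe_cat_simps using xy by simp
    next
      case 4
      then show ?thesis unfolding globe_cat_simps by simp
    qed
  qed
next
  fix n x y \<alpha> m assume c: "composable globe_cat n x y" and a: "\<alpha> \<in> signs" "m \<noteq> n"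
  show "bd globe_cat \<alpha> m (cmp globe_cat n x y) = cmp globe_cat n (bd globe_cat \<alpha> m x) (bd globe_cat \<alpha> m y)"
    unfolding globe_cat_simps using a composable_globe_catD[OF c] by (simp split: if_splits)
next
  fix x assume "x \<in> carrier globe_cat"
  show "\<exists>n. src globe_cat n x = x \<and> tgt globe_cat n x = x" by (auto intro!: exI[of _ "snd x"])
next
  fix n x y assume c: "composable globe_cat n x y"
  show "cmp globe_cat n x y \<in> carrier globe_cat" using c by (simp add: composable_def)
  show "src globe_cat n (cmp globe_cat n x y) = src globe_cat n x"
    "tgt globe_cat n (cmp globe_cat n x y) = tgt globe_cat n y"
    unfolding globe_cat_simps using composable_globe_catD[OF c] by (simp_all split: if_splits)
next
  fix n x y z assume c: "composable globe_cat n x y" "composable globe_cat n y z"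
  note d = c[THEN composable_globe_catD]
  show "cmp globe_cat n (cmp globe_cat n x y) z = cmp globe_cat n x (cmp globe_cat n y z)"
    unfolding globe_cat_simps using d by simp
qed auto

text \<open>The functor that classifies \<open>x\<close>: iterated boundaries of an arbitrary
  element are related like the cells of the globe.\<close>

lemma omega_functor_globe_cat:
  assumes C: "omega_category C" and x: "x \<in> carrier C"
  shows "omega_functor globe_cat C (\<lambda>c. bd C (fst c) (snd c) x)"
proof -
  interpret omega_category C by (rule C)
  have s: "(1::int) \<in> signs" "(-1::int) \<in> signs" by auto
  show ?thesis
    unfolding omega_functor_def
  proof (intro conjI ballI allI impI)
    show "(\<lambda>c. bd C (fst c) (snd c) x) \<in> carrier globe_cat \<rightarrow> carrier C"
      using bd_closed[OF x] by auto
    fix c n and \<alpha> :: int assume c: "c \<in> carrier globe_cat" and a: "\<alpha> \<in> signs"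
    have f: "fst c \<in> signs" using c by auto
    show "bd C (fst (bd globe_cat \<alpha> n c)) (snd (bd globe_cat \<alpha> n c)) x = bd C \<alpha> n (bd C (fst c) (snd c) x)"
      using bd_bd_less[OF x f a, of n "snd c"] bd_bd_ge[OF x f a, of "snd c" n] by auto
  next
    fix n c d assume cd: "composable globe_cat n c d"
    have f: "fst c \<in> signs" "fst d \<in> signs" using cd by (auto simp: composable_globe_cat)
    consider "n < snd c" "d = (1, n)" | "snd c \<le> n" "n < snd d" "c = (-1, n)" | "snd c \<le> n" "c = d"
      using composable_globe_catD[OF cd] by (metis not_less)
    then show "bd C (fst (cmp globe_cat n c d)) (snd (cmp globe_cat n c d)) x
        = cmp C n (bd C (fst c) (snd c) x) (bd C (fst d) (snd d) x)"
    proof cases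
      case 1
      then show ?thesis
        using cmp_tgt[OF bd_closed[OF x f(1)], of n "snd c"] bd_bd_less[OF x f(1) s(1) 1(1)] by simp
    next
      case 2
      then show ?thesis
        using cmp_src[OF bd_closed[OF x f(2)], of n "snd d"] bd_bd_less[OF x f(2) s(2) 2(2)] by simp
    next
      case 3
      then show ?thesis
        using cmp_src[OF bd_closed[OF x f(1)], of n "snd c"] bd_bd_ge[OF x f(1) s(2) 3(1)] by simp
    qed
  qed
qed

text \<open>
  All values of \<open>\<box>\<^sub>n\<^sup>-(x)\<close> are iterated boundaries of \<open>x\<close>: the face \<open>k\<close> is sent to \<open>d_j\<^sup>\<beta>(x)\<close> for
  \<open>(\<beta>, j) = globe_code k\<close>, so the functor factors through the globe.
\<close>

fun globe_code :: "int list \<Rightarrow> int \<times> nat" where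
  "globe_code [] = (-1, 0)"
| "globe_code (a # k) =
    (if 1 \<in> set (a # k) then (1, 0)
     else if a = -1 then (-1, if 0 \<in> set k then 1 else 0)
     else (- fst (globe_code k), Suc (snd (globe_code k))))"

lemma globe_code_pos: "1 \<in> set k \<Longrightarrow> globe_code k = (1, 0)"
  by (cases k) auto

lemma globe_code_sign: "fst (globe_code k) \<in> signs"
  by (induction k) auto

lemma word_dim_pos: "0 < word_dim k \<longleftrightarrow> 0 \<in> set k"
  by (induction k) auto

lemma globe_code_le_dim: "k \<in> words n \<Longrightarrow> snd (globe_code k) \<le> word_dim k"
proof (induction n arbitrary: k)
  case (Suc n)
  then obtain a l where k: "k = a # l" "a = -1 \<or> a = 0 \<or> a = 1" "l \<in> words n" using words_SucE by metis
  then show ?case using Suc.IH[of l] word_dim_pos[of l] by auto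
qed auto

lemma globe_code_0:
  "k \<in> words n \<Longrightarrow> 1 \<notin> set k \<Longrightarrow> snd (globe_code k) = 0 \<Longrightarrow> 0 \<notin> set k \<and> fst (globe_code k) = -1"
  by (cases k; cases n) (auto split: if_splits)

text \<open>The face order of the globe, in which the two cells of one dimension are
  incomparable.\<close>

definition globe_below :: "int \<times> nat \<Rightarrow> int \<times> nat \<Rightarrow> bool" where
  "globe_below c d \<longleftrightarrow> c = d \<or> snd c < snd d"

lemma globe_below_trans: "globe_below b c \<Longrightarrow> globe_below c d \<Longrightarrow> globe_below b d"
  by (auto simp: globe_below_def)

lemma globe_below_antisym: "globe_below c d \<Longrightarrow> globe_below d c \<Longrightarrow> c = d"
  by (auto simp: globe_below_def)

lemma subface_letter: "subface l k \<Longrightarrow> a \<in> set k \<Longrightarrow> a \<noteq> 0 \<Longrightarrow> a \<in> set l"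
  by (induction l k rule: subface.induct) auto

lemma subface_no_zero: "subface l k \<Longrightarrow> 0 \<notin> set k \<Longrightarrow> l = k"
  by (induction l k rule: subface.induct) auto

lemma subface_zero: "subface l k \<Longrightarrow> 0 \<in> set l \<Longrightarrow> 0 \<in> set k"
  by (induction l k rule: subface.induct) auto

lemma globe_code_mono:
  "subface l k \<Longrightarrow> k \<in> words n \<Longrightarrow> globe_below (globe_code l) (globe_code k)"
proof (induction n arbitrary: l k)
  case (Suc n)
  then obtain a k' where k: "k = a # k'" "a = -1 \<or> a = 0 \<or> a = 1" "k' \<in> words n" using words_SucE by metis
  then obtain b l' where l: "l = b # l'" using Suc.prems(1) by (cases l) auto
  have sub: "subface l' k'" using Suc.prems(1) k l by simp
  show ?case
  proof (cases "1 \<in> set k")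
    case True
    then show ?thesis using globe_code_pos subface_letter[OF Suc.prems(1) True]
      by (simp add: globe_below_def del: globe_code.simps)
  next
    case no1: False
    show ?thesis
    proof (cases "1 \<in> set l")
      case True
      then have "0 \<in> set k" using subface_no_zero[OF Suc.prems(1)] no1 by auto
      then have "snd (globe_code k) \<noteq> 0" using globe_code_0[OF Suc.prems(2) no1] by blast
      then show ?thesis using globe_code_pos[OF True] by (simp add: globe_below_def)
    next
      case nol: False
      consider "a = -1" | "a = 0" "b = 0" | "a = 0" "b = -1"
        using Suc.prems(1) k l no1 nol by auto
      then show ?thesis
      proof cases
        case 1
        then have "b = -1" using Suc.prems(1) k l by simp
        then show ?thesis using 1 no1 nol subface_no_zero[OF sub] unfolding k l
          by (auto simp: globe_below_def)
      next
        case 2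
        then show ?thesis using Suc.IH[OF sub k(3)] no1 nol unfolding k l
          by (auto simp: globe_below_def)
      next
        case 3
        have "0 \<notin> set l'" if "snd (globe_code k') = 0"
          using globe_code_0[OF k(3) _ that] no1 k subface_zero[OF sub] by auto
        then show ?thesis using 3 no1 nol unfolding k l by (auto simp: globe_below_def)
      qed
    qed
  qed
qed (auto simp: globe_below_def dest: subface_length)

lemma facets_nonempty:
  "k \<in> words n \<Longrightarrow> \<alpha> \<in> signs \<Longrightarrow> 0 \<in> set k \<Longrightarrow> facets \<alpha> k \<noteq> {}"
proof (induction n arbitrary: k \<alpha>)
  case (Suc n)
  then obtain a l where k: "k = a # l" "l \<in> words n" using words_SucE by metis
  then show ?case using Suc.IH[OF k(2) Suc.prems(2)] Suc.prems facets_Cons[OF Suc.prems(2), of a l] by auto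
qed simp

lemma facets_no_pos:
  "k \<in> words n \<Longrightarrow> 1 \<notin> set k \<Longrightarrow> 0 \<in> set k \<Longrightarrow> \<exists>u \<in> facets (-1) k. 1 \<notin> set u"
proof (induction n arbitrary: k)
  case (Suc n)
  then obtain a l where k: "k = a # l" "l \<in> words n" "a = -1 \<or> a = 0" using words_SucE
    by (metis list.set_intros(1))
  then show ?case using Suc.IH[OF k(2)] Suc.prems by auto
qed simp

lemma facets_no_pos_zero:
  "k \<in> words n \<Longrightarrow> \<alpha> \<in> signs \<Longrightarrow> 1 \<notin> set k \<Longrightarrow> 2 \<le> word_dim k
    \<Longrightarrow> \<exists>u \<in> facets \<alpha> k. 1 \<notin> set u \<and> 0 \<in> set u"
proof (induction n arbitrary: k)
  case (Suc n)
  then obtain a l where k: "k = a # l" "l \<in> words n" "a = -1 \<or> a = 0" using words_SucE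
    by (metis list.set_intros(1))
  show ?case
  proof (cases "a = 0")
    case False
    then show ?thesis using Suc.IH[OF k(2) Suc.prems(2)] Suc.prems k
      by (auto simp: facets_Cons[OF Suc.prems(2)] simp del: facets_Cons)
  next
    case True
    then have z: "0 \<in> set l" "1 \<notin> set l" using Suc.prems k word_dim_pos[of l] by auto
    show ?thesis
    proof (cases "\<alpha> = -1")
      case a: True
      then show ?thesis using z True k by auto
    next
      case False
      then have "\<alpha> = 1" using Suc.prems by auto
      then show ?thesis using facets_no_pos[OF k(2) z(2,1)] True k by auto
    qed
  qed
qed simp

lemma facets_dim_1:
  "k \<in> words n \<Longrightarrow> \<alpha> \<in> signs \<Longrightarrow> 1 \<notin> set k \<Longrightarrow> word_dim k = 1 \<Longrightarrow> u \<in> facets \<alpha> k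
    \<Longrightarrow> (1 \<in> set u \<longleftrightarrow> \<alpha> = 1) \<and> 0 \<notin> set u"
proof (induction n arbitrary: k u)
  case (Suc n)
  then obtain a l where k: "k = a # l" "l \<in> words n" "a = -1 \<or> a = 0" using words_SucE
    by (metis list.set_intros(1))
  show ?case
  proof (cases "a = 0")
    case True
    then have l: "word_dim l = 0" "0 \<notin> set l" "1 \<notin> set l" using Suc.prems k word_dim_pos[of l] by auto
    then have "facets (-\<alpha>) l = {}" by (auto simp: facets_def)
    then have "u = \<alpha> # l" using Suc.prems(5) True k facets_Cons[OF Suc.prems(2)] by simp
    then show ?thesis using l Suc.prems(2) by auto
  next
    case False
    then obtain v where "u = -1 # v" "v \<in> facets \<alpha> l"
      using Suc.prems(5) k facets_Cons[OF Suc.prems(2)] by auto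
    then show ?thesis using Suc.IH[OF k(2) Suc.prems(2)] Suc.prems k False by auto
  qed
qed simp

text \<open>The case where the code keeps the dimension of \<open>k\<close>. The facets of sign
  \<open>\<alpha>\<close> then generate the cell \<open>(\<alpha>, p)\<close>: at least one of them
  reaches it, and those that do not have a code of lower dimension.\<close>

lemma globe_code_facets_full:
  "k \<in> words n \<Longrightarrow> \<alpha> \<in> signs \<Longrightarrow> snd (globe_code k) = Suc p \<Longrightarrow> word_dim k = Suc p \<Longrightarrow>
    (\<exists>u \<in> facets \<alpha> k. globe_code u = (\<alpha>, p)) \<and>
    (\<forall>u \<in> facets \<alpha> k. snd (globe_code u) = p \<longrightarrow> globe_code u = (\<alpha>, p))"
proof (induction n arbitrary: k \<alpha> p)
  case (Suc n)
  have no1: "1 \<notin> set k" using Suc.prems(3) globe_code_pos by auto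
  then obtain a l where k: "k = a # l" "l \<in> words n" "a = -1 \<or> a = 0" using words_SucE[OF Suc.prems(1)]
    by (metis list.set_intros(1))
  have no1l: "1 \<notin> set l" using no1 k by simp
  show ?case
  proof (cases "a = 0")
    case False
    then have a: "a = -1" using k by simp
    then have p: "p = 0" "0 \<in> set l" "word_dim l = 1"
      using Suc.prems(3,4) no1 k by (auto split: if_splits)
    have "globe_code (-1 # u) = (\<alpha>, 0)" if "u \<in> facets \<alpha> l" for u
      using facets_dim_1[OF k(2) Suc.prems(2) no1l p(3) that] Suc.prems(2) by auto
    then show ?thesis using facets_nonempty[OF k(2) Suc.prems(2) p(2)] p(1) a k
      by (auto simp: facets_Cons[OF Suc.prems(2)] simp del: facets_Cons globe_code.simps)
  next
    case True
    have l: "snd (globe_code l) = p" "word_dim l = p" using Suc.prems(3,4) no1 k True by auto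
    have fac: "facets \<alpha> k = insert (\<alpha> # l) ((#) 0 ` facets (-\<alpha>) l)"
      using k True facets_Cons[OF Suc.prems(2)] by simp
    show ?thesis
    proof (cases p)
      case 0
      then have "facets (-\<alpha>) l = {}" "0 \<notin> set l" using l word_dim_pos[of l] by (auto simp: facets_def)
      then show ?thesis using 0 fac no1l Suc.prems(2) by auto
    next
      case (Suc q)
      note IH = Suc.IH[OF k(2) signs_uminus[OF Suc.prems(2)], of q]
      have zl: "0 \<in> set l" using l Suc word_dim_pos[of l] by simp
      obtain u where u: "u \<in> facets (-\<alpha>) l" "globe_code u = (-\<alpha>, q)" using IH l Suc by auto
      have ex: "\<exists>w \<in> facets \<alpha> k. globe_code w = (\<alpha>, p)"
      \<comment> \<open>A facet \<open>u\<close> with the letter 1 has the code (1, 0), which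
        happens only for \<open>\<alpha> = -1\<close> and \<open>p = 1\<close>. Then the facet that
        replaces the leading zero is taken instead.\<close>
      proof (cases "1 \<in> set u")
        case True
        then have "\<alpha> = -1" "q = 0" using u(2) globe_code_pos[OF True] by auto
        then have "globe_code (\<alpha> # l) = (\<alpha>, p)" using Suc zl no1l by simp
        then show ?thesis using fac by blast
      next
        case False
        then have "globe_code (0 # u) = (\<alpha>, p)" using u(2) Suc by simp
        then show ?thesis using fac u(1) by blast
      qed
      have "globe_code w = (\<alpha>, p)" if w: "w \<in> facets \<alpha> k" "snd (globe_code w) = p" for w
      proof -
        consider "w = \<alpha> # l" | v where "w = 0 # v" "v \<in> facets (-\<alpha>) l" using w(1) fac by auto
        then show ?thesis
        proof cases
          case 1
          then show ?thesis using w(2) Suc Suc.prems(2) no1l zl by auto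
        next
          case (2 v)
          have no1v: "1 \<notin> set v" using w(2) Suc 2(1) by auto
          then have "snd (globe_code v) = q" using w(2) Suc 2(1) by simp
          moreover have "\<forall>u \<in> facets (-\<alpha>) l. snd (globe_code u) = q \<longrightarrow> globe_code u = (-\<alpha>, q)"
            using IH l Suc by simp
          ultimately have "globe_code v = (-\<alpha>, q)" using 2(2) by blast
          then show ?thesis using no1v Suc 2(1) by simp
        qed
      qed
      then show ?thesis using ex by blast
    qed
  qed
qed simp

text \<open>The case where the code has smaller dimension than \<open>k\<close>. A letter 1 survives
  in every facet; after a leading -1 there are two further zeros, and some facet keeps one of them
  without introducing 1; after a leading 0 the tail is treated with the opposite sign.\<close>

lemma globe_code_facets_collapse:
  "k \<in> words n \<Longrightarrow> \<alpha> \<in> signs \<Longrightarrow> snd (globe_code k) < word_dim k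
    \<Longrightarrow> \<exists>u \<in> facets \<alpha> k. globe_code u = globe_code k"
proof (induction n arbitrary: k \<alpha>)
  case (Suc n)
  have zk: "0 \<in> set k" using Suc.prems(3) word_dim_pos[of k] by simp
  show ?case
  proof (cases "1 \<in> set k")
    case True
    obtain u where u: "u \<in> facets \<alpha> k" using facets_nonempty[OF Suc.prems(1,2) zk] by blast
    then have "1 \<in> set u" using subface_letter[OF facets_subface[OF u Suc.prems(2)] True] by simp
    then show ?thesis using u True globe_code_pos by auto
  next
    case no1: False
    then obtain a l where k: "k = a # l" "l \<in> words n" "a = -1 \<or> a = 0"
      using words_SucE[OF Suc.prems(1)] by (metis list.set_intros(1))
    show ?thesis
    proof (cases "a = 0")
      case False
      then have a: "a = -1" using k by simp
      have "0 \<in> set l" "2 \<le> word_dim l" using zk Suc.prems(3) no1 k a by (auto split: if_splits)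
      then obtain u where "u \<in> facets \<alpha> l" "1 \<notin> set u" "0 \<in> set u"
        using facets_no_pos_zero[OF k(2) Suc.prems(2)] no1 k by auto
      then have "-1 # u \<in> facets \<alpha> k" "globe_code (-1 # u) = globe_code k"
        using k a no1 \<open>0 \<in> set l\<close> facets_Cons[OF Suc.prems(2)] by auto
      then show ?thesis by blast
    next
      case True
      have "snd (globe_code l) < word_dim l" using Suc.prems(3) no1 k True by auto
      then obtain u where u: "u \<in> facets (-\<alpha>) l" "globe_code u = globe_code l"
        using Suc.IH[OF k(2) signs_uminus[OF Suc.prems(2)]] by blast
      have "1 \<notin> set u"
        using globe_code_pos[of u] u(2) globe_code_0[OF k(2)] no1 k by auto
      then have "0 # u \<in> facets \<alpha> k" "globe_code (0 # u) = globe_code k"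
        using k True no1 u facets_Cons[OF Suc.prems(2)] by auto
      then show ?thesis by blast
    qed
  qed
qed simp

text \<open>
  The value \<open>(0, 0)\<close>, which is not a cell of the globe, is only taken on sets that are not elements
  of the cube category.
\<close>

definition globe_top :: "int list set \<Rightarrow> int \<times> nat" where
  "globe_top U =
    (if \<exists>c \<in> globe_code ` U. \<forall>d \<in> globe_code ` U. globe_below d c
     then THE c. c \<in> globe_code ` U \<and> (\<forall>d \<in> globe_code ` U. globe_below d c) else (0, 0))"

lemma globe_top_eqI:
  assumes "u \<in> U" "globe_code u = c" "\<And>v. v \<in> U \<Longrightarrow> globe_below (globe_code v) c"
  shows "globe_top U = c"
proof -
  have "(THE c. c \<in> globe_code ` U \<and> (\<forall>d \<in> globe_code ` U. globe_below d c)) = c"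
  proof (rule the_equality)
    show "c \<in> globe_code ` U \<and> (\<forall>d \<in> globe_code ` U. globe_below d c)" using assms by blast
    fix d assume d: "d \<in> globe_code ` U \<and> (\<forall>e \<in> globe_code ` U. globe_below e d)"
    then have "globe_below d c" "globe_below c d" using assms by blast+
    then show "d = c" by (rule globe_below_antisym)
  qed
  then show ?thesis unfolding globe_top_def using assms by auto
qed

lemma globe_topE:
  assumes "globe_top U \<in> carrier globe_cat"
  obtains u where "u \<in> U" "globe_code u = globe_top U"
    "\<And>v. v \<in> U \<Longrightarrow> globe_below (globe_code v) (globe_top U)"
proof -
  obtain u where u: "u \<in> U" "\<And>v. v \<in> U \<Longrightarrow> globe_below (globe_code v) (globe_code u)"
    using assms by (auto simp: globe_top_def split: if_splits)
  then show thesis using that globe_top_eqI[OF u(1) HOL.refl u(2)] by simp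
qed

lemma omega_functor_globe_top: "omega_functor (cube_cat n) globe_cat globe_top"
proof (rule omega_functor_cube_catI[OF omega_category_globe_cat])
  fix k assume k: "k \<in> words n"
  have top: "globe_top (R {k}) = globe_code k"
    using globe_code_mono[OF _ k] by (intro globe_top_eqI[of k]) (auto simp: R_iff)
  show "globe_top (R {k}) \<in> carrier globe_cat"
    unfolding top using globe_code_sign[of k] by (cases "globe_code k") auto
  fix \<alpha> assume a: "\<alpha> \<in> signs"
  show "bd globe_cat \<alpha> (word_dim k) (globe_top (R {k})) = globe_top (R {k})"
    unfolding top using globe_code_le_dim[OF k] by simp
  fix p assume p: "word_dim k = Suc p"
  have sub: "subface w k" if "w \<in> R (facets \<alpha> k)" for w
    using that facets_subface[OF _ a] subface_trans unfolding R_iff by blast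
  show "globe_top (R (facets \<alpha> k)) = bd globe_cat \<alpha> p (globe_top (R {k}))"
  proof (cases "snd (globe_code k) = Suc p")
    case True
    note f = globe_code_facets_full[OF k a True p]
    obtain u where u: "u \<in> facets \<alpha> k" "globe_code u = (\<alpha>, p)" using f by blast
    have "globe_top (R (facets \<alpha> k)) = (\<alpha>, p)"
    proof (rule globe_top_eqI[OF _ u(2)])
      show "u \<in> R (facets \<alpha> k)" using u(1) by (rule R.base)
      fix w assume "w \<in> R (facets \<alpha> k)"
      then obtain v where v: "v \<in> facets \<alpha> k" "subface w v" by (auto simp: R_iff)
      have vw: "v \<in> words n" using subface_words[OF facets_subface[OF v(1) a] k] .
      have "word_dim v = p" using v(1) p by (simp add: facets_def)
      then have "globe_below (globe_code v) (\<alpha>, p)"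
        using globe_code_le_dim[OF vw] f v(1) by (auto simp: globe_below_def)
      then show "globe_below (globe_code w) (\<alpha>, p)"
        using globe_code_mono[OF v(2) vw] globe_below_trans by blast
    qed
    then show ?thesis unfolding top using True by simp
  next
    case False
    then have lt: "snd (globe_code k) < word_dim k" using globe_code_le_dim[OF k] p by simp
    obtain u where u: "u \<in> facets \<alpha> k" "globe_code u = globe_code k"
      using globe_code_facets_collapse[OF k a lt] by blast
    have "globe_top (R (facets \<alpha> k)) = globe_code k"
      using globe_code_mono[OF sub k] by (intro globe_top_eqI[OF R.base[OF u(1)] u(2)])
    then show ?thesis unfolding top using lt p by simp
  qed
next
  fix U V p assume c: "composable globe_cat p (globe_top U) (globe_top V)"
  then have car: "globe_top U \<in> carrier globe_cat" "globe_top V \<in> carrier globe_cat"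
    by (auto simp: composable_def)
  obtain u where u: "u \<in> U" "globe_code u = globe_top U"
    "\<And>v. v \<in> U \<Longrightarrow> globe_below (globe_code v) (globe_top U)" using globe_topE[OF car(1)] by blast
  obtain v where v: "v \<in> V" "globe_code v = globe_top V"
    "\<And>w. w \<in> V \<Longrightarrow> globe_below (globe_code w) (globe_top V)" using globe_topE[OF car(2)] by blast
  show "globe_top (U \<union> V) = cmp globe_cat p (globe_top U) (globe_top V)"
  \<comment> \<open>Composability forces one of the two top cells below the other; the larger one is
    the composite and the top of the union.\<close>
  proof (cases "snd (globe_top U) \<le> p")
    case True
    then have "globe_below (globe_top U) (globe_top V)"
      using composable_globe_catD[OF c] unfolding globe_below_def by (metis not_less prod.sel(2))
    then have "globe_top (U \<union> V) = globe_top V"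
      using u v globe_below_trans by (intro globe_top_eqI[of v]) blast+
    then show ?thesis using True by simp
  next
    case False
    then have "globe_below (globe_top V) (globe_top U)"
      using composable_globe_catD[OF c] unfolding globe_below_def by (metis not_less prod.sel(2))
    then have "globe_top (U \<union> V) = globe_top U"
      using u v globe_below_trans by (intro globe_top_eqI[of u]) blast+
    then show ?thesis using False by simp
  qed
qed

definition globe_cube :: "'a omega_cat \<Rightarrow> nat \<Rightarrow> 'a \<Rightarrow> 'a cube" where
  "globe_cube C n x = cube_with_values C n (\<lambda>k. bd C (fst (globe_code k)) (snd (globe_code k)) x)"

lemma globe_cube_values:
  assumes C: "omega_category C" and x: "x \<in> carrier C"
  shows "globe_cube C n x \<in> nerve C n"
    and "k \<in> words n \<Longrightarrow> globe_cube C n x (R {k}) = bd C (fst (globe_code k)) (snd (globe_code k)) x"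
proof -
  let ?F = "(\<lambda>c. bd C (fst c) (snd c) x) \<circ> globe_top"
  have F: "omega_functor (cube_cat n) C ?F"
    by (rule omega_functor_comp[OF omega_functor_globe_top omega_functor_globe_cat[OF C x]])
  have "globe_top (R {k}) = globe_code k" if "k \<in> words n" for k
    using globe_code_mono[OF _ that] by (intro globe_top_eqI[of k]) (auto simp: R_iff)
  then have v: "?F (R {k}) = bd C (fst (globe_code k)) (snd (globe_code k)) x" if "k \<in> words n" for k
    using that by simp
  show "globe_cube C n x \<in> nerve C n"
    "k \<in> words n \<Longrightarrow> globe_cube C n x (R {k}) = bd C (fst (globe_code k)) (snd (globe_code k)) x"
    unfolding globe_cube_def using cube_with_values[OF F v] by auto
qed

lemma words_Suc_SucE:
  assumes k: "k \<in> words (Suc (Suc n))"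
  obtains a b l where "k = a # b # l" "a = -1 \<or> a = 0 \<or> a = 1" "b = -1 \<or> b = 0 \<or> b = 1" "l \<in> words n"
proof -
  obtain a k' where a: "k = a # k'" "a = -1 \<or> a = 0 \<or> a = 1" "k' \<in> words (Suc n)"
    using k by (rule words_SucE)
  obtain b l where "k' = b # l" "b = -1 \<or> b = 0 \<or> b = 1" "l \<in> words n" using a(3) by (rule words_SucE)
  then show thesis using that a by blast
qed

section \<open>Faces of the cubes that factor through the globe\<close>

lemma merge_at_letters:
  "k \<in> words n \<Longrightarrow> Suc i < n \<Longrightarrow> (1 \<in> set (merge_at i k) \<longleftrightarrow> 1 \<in> set k) \<and>
    (1 \<notin> set k \<longrightarrow> (0 \<in> set (merge_at i k) \<longleftrightarrow> 0 \<in> set k))"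
proof (induction i arbitrary: n k)
  case 0
  define m where "m = n - 2"
  have "n = Suc (Suc m)" using 0 by (simp add: m_def)
  then have "k \<in> words (Suc (Suc m))" using 0 by simp
  then obtain a b l where "k = a # b # l" "a = -1 \<or> a = 0 \<or> a = 1" "b = -1 \<or> b = 0 \<or> b = 1"
    by (rule words_Suc_SucE)
  then show ?case by (elim disjE) auto
next
  case (Suc i)
  then obtain m where m: "n = Suc m" by (cases n) auto
  then obtain a l where "k = a # l" "l \<in> words m" using Suc.prems words_SucE by metis
  then show ?case using Suc.IH[of l m] Suc.prems m by auto
qed

text \<open>Merging can alter the code only when the code has dimension at least m + 1 before and
  after, that is, where an element of dimension at most m + 1 is its own boundary. A nonzero letter
  among the first m excludes this exception.\<close>

lemma globe_code_merge_at:
  "k \<in> words (Suc (Suc m)) \<Longrightarrow>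
    (globe_code (merge_at m k) = globe_code k \<or>
      Suc m \<le> snd (globe_code k) \<and> Suc m \<le> snd (globe_code (merge_at m k))) \<and>
    ((\<exists>l<m. k ! l \<noteq> 0) \<longrightarrow> snd (globe_code k) \<le> m)"
proof (induction m arbitrary: k)
  case 0
  then obtain a b l where "k = a # b # l" "a = -1 \<or> a = 0 \<or> a = 1" "b = -1 \<or> b = 0 \<or> b = 1" "l \<in> words 0"
    by (rule words_Suc_SucE)
  then show ?case by (elim disjE) auto
next
  case (Suc m)
  then obtain a l where k: "k = a # l" "a = -1 \<or> a = 0 \<or> a = 1" "l \<in> words (Suc (Suc m))"
    using words_SucE by metis
  note ml = merge_at_letters[OF k(3), of m]
  show ?case
  proof (cases "1 \<in> set k")
    case True
    then show ?thesis using merge_at_letters[OF Suc.prems, of "Suc m"] globe_code_pos by auto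
  next
    case False
    show ?thesis
    proof (cases "a = 0")
      case True
      have "(\<exists>l'<Suc m. k ! l' \<noteq> 0) \<longleftrightarrow> (\<exists>l'<m. l ! l' \<noteq> 0)"
        using True k by (auto simp: less_Suc_eq_0_disj)
      then show ?thesis using True False k ml Suc.IH[OF k(3)] by auto
    next
      case a: False
      then show ?thesis using False k ml by auto
    qed
  qed
qed

text \<open>On the last two negative faces only codes of full dimension m + 1 change, and their sign
  becomes (-)^j for the index j counted from 1. This is the origin of the sign in the recursion for
  these faces.\<close>

lemma globe_code_insert_neg:
  "k \<in> words (Suc m) \<Longrightarrow> i = m \<or> i = Suc m \<Longrightarrow>
    if snd (globe_code k) = Suc m then globe_code (insert_at i (-1) k) = ((-1) ^ Suc i, Suc m)
    else globe_code (insert_at i (-1) k) = globe_code k"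
proof (induction m arbitrary: k i)
  case 0
  then obtain a where "k = [a]" "a = -1 \<or> a = 0 \<or> a = 1" by (metis words_SucE words_0 singletonD)
  then show ?case using 0 by auto
next
  case (Suc m)
  then obtain a l where k: "k = a # l" "a = -1 \<or> a = 0 \<or> a = 1" "l \<in> words (Suc m)"
    using words_SucE by metis
  obtain j where j: "i = Suc j" "j = m \<or> j = Suc m" using Suc.prems by auto
  have set: "set (insert_at j (-1) l) = insert (-1) (set l)"
  proof -
    have "set (insert_at j (-1) l) = insert (-1) (set (take j l @ drop j l))"
      unfolding insert_at_def set_append by auto
    then show ?thesis by simp
  qed
  show ?case using Suc.IH[OF k(3) j(2)] k j set
    by (cases "1 \<in> set k"; cases "a = 0") (auto split: if_splits)
qed

lemma snd_globe_code_zeros [simp]: "snd (globe_code (replicate n 0)) = n"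
  by (induction n) auto

lemma snd_globe_code_le: "k \<in> words n \<Longrightarrow> snd (globe_code k) \<le> n"
  using globe_code_le_dim word_dim_le_length[of k] length_words[of k n] by fastforce

text \<open>A word other than 0...0 has a nonzero letter and so lies in a face. This gives the
  uniqueness in the recursive definition of \<open>box_minus\<close>.\<close>

lemma nerve_eq_by_faces:
  assumes x: "x \<in> nerve C (Suc n)" and y: "y \<in> nerve C (Suc n)"
    and top: "x (R {replicate (Suc n) 0}) = y (R {replicate (Suc n) 0})"
    and faces: "\<And>i \<alpha>. i \<le> n \<Longrightarrow> \<alpha> \<in> signs \<Longrightarrow> face C (Suc n) (Suc i) \<alpha> x = face C (Suc n) (Suc i) \<alpha> y"
  shows "x = y"
proof (rule nerve_ext[OF x y])
  fix k assume k: "k \<in> words (Suc n)"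
  show "x (R {k}) = y (R {k})"
  proof (cases "\<exists>i\<le>n. k ! i \<noteq> 0")
    case False
    then have "k = replicate (Suc n) 0"
      using length_words[OF k] by (intro nth_equalityI) (auto simp del: replicate_Suc)
    then show ?thesis using top by simp
  next
    case True
    then obtain i where i: "i \<le> n" "k ! i \<noteq> 0" by blast
    have len: "length k = Suc n" by (rule length_words[OF k])
    let ?l = "take i k @ drop (Suc i) k"
    have l: "?l \<in> words n" using word_mapD(1)[OF word_map_delete[OF i(1)] k] .
    have "k ! i \<in> set k" using i len by simp
    moreover have "set k \<subseteq> {-1, 0, 1}" using k by (simp add: words_def)
    ultimately have "k ! i \<in> {-1, 0, 1}" by blast
    then have a: "k ! i \<in> signs" using i(2) by simp
    have "insert_at i (k ! i) ?l = k"
      using i len by (simp add: insert_at_def Cons_nth_drop_Suc)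
    then show ?thesis
      using face_values(2)[OF x i(1) a l] face_values(2)[OF y i(1) a l] faces[OF i(1) a] by simp
  qed
qed

context
  fixes C :: "'a omega_cat"
  assumes C: "omega_category C"
begin

interpretation omega_category C by (rule C)

lemma bd_globe_code_bd:
  assumes x: "x \<in> carrier C" and a: "\<alpha> \<in> signs" and le: "snd (globe_code k) < m"
  shows "bd C (fst (globe_code k)) (snd (globe_code k)) (bd C \<alpha> m x)
    = bd C (fst (globe_code k)) (snd (globe_code k)) x"
  using bd_bd_less[OF x a globe_code_sign le] .

lemma globe_cube_face_low:
  assumes x: "x \<in> carrier C" and i: "i < m" and a: "\<alpha> \<in> signs"
  shows "face C (Suc (Suc m)) (Suc i) \<alpha> (globe_cube C (Suc (Suc m)) x)
    = connection C m m (face C (Suc m) (Suc i) \<alpha> (globe_cube C (Suc m) (src C (Suc m) x)))"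
proof -
  obtain m' where m: "m = Suc m'" using i by (cases m) auto
  have s: "(-1::int) \<in> signs" by simp
  have le: "i \<le> Suc m" "i \<le> m" "m' < m" using i m by auto
  have sx: "src C (Suc m) x \<in> carrier C" by (rule bd_closed[OF x s])
  note g1 = globe_cube_values[OF C x, where n = "Suc (Suc m)"] and g2 = globe_cube_values[OF C sx, where n = "Suc m"]
  note f1 = face_values[OF g1(1) le(1) a] and f2 = face_values[OF g2(1) le(2) a]
  note c2 = connection_values[OF f2(1) le(3), folded m]
  show ?thesis
  proof (rule nerve_ext)
    show "face C (Suc (Suc m)) (Suc i) \<alpha> (globe_cube C (Suc (Suc m)) x) \<in> nerve C (Suc m)" by (rule f1)
    show "connection C m m (face C (Suc m) (Suc i) \<alpha> (globe_cube C (Suc m) (src C (Suc m) x)))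
      \<in> nerve C (Suc m)" by (rule c2)
    fix k assume k: "k \<in> words (Suc m)"
    let ?k = "insert_at i \<alpha> k"
    have kw: "?k \<in> words (Suc (Suc m))" by (rule insert_at_words[OF le(1) a k])
    have mk: "merge_at m' k \<in> words m" by (rule merge_at_words[OF le(3) k])
    have mm: "merge_at m ?k = insert_at i \<alpha> (merge_at m' k)"
      unfolding m by (rule merge_at_insert_at_less) (use i m length_words[OF k] in auto)
    have "?k ! i = \<alpha>" using i length_words[OF k] by (simp add: nth_insert_at)
    then have nz: "\<exists>l<m. ?k ! l \<noteq> 0" using i a by auto
    then have "snd (globe_code ?k) \<le> m" "globe_code (merge_at m ?k) = globe_code ?k"
      using globe_code_merge_at[OF kw] by auto
    then show "face C (Suc (Suc m)) (Suc i) \<alpha> (globe_cube C (Suc (Suc m)) x) (R {k})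
      = connection C m m (face C (Suc m) (Suc i) \<alpha> (globe_cube C (Suc m) (src C (Suc m) x))) (R {k})"
      using f1(2)[OF k] g1(2)[OF kw] c2(2)[OF k] f2(2)[OF mk] g2(2)[OF insert_at_words[OF le(2) a mk]]
        bd_globe_code_bd[OF x s, of ?k "Suc m"] mm by simp
  qed
qed

lemma globe_cube_face_neg:
  assumes x: "x \<in> carrier C" and i: "i = m \<or> i = Suc m"
  shows "face C (Suc (Suc m)) (Suc i) (-1) (globe_cube C (Suc (Suc m)) x)
    = globe_cube C (Suc m) (bd C ((-1) ^ Suc i) (Suc m) x)"
proof (rule nerve_ext)
  have s: "(-1::int) \<in> signs" "(-1::int) ^ Suc i \<in> signs" by (auto simp: minus_one_power_iff)
  have le: "i \<le> Suc m" using i by auto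
  have bx: "bd C ((-1) ^ Suc i) (Suc m) x \<in> carrier C" by (rule bd_closed[OF x s(2)])
  note g1 = globe_cube_values[OF C x, where n = "Suc (Suc m)"] and g2 = globe_cube_values[OF C bx, where n = "Suc m"]
  note f1 = face_values[OF g1(1) le s(1)]
  show "face C (Suc (Suc m)) (Suc i) (-1) (globe_cube C (Suc (Suc m)) x) \<in> nerve C (Suc m)" by (rule f1)
  show "globe_cube C (Suc m) (bd C ((-1) ^ Suc i) (Suc m) x) \<in> nerve C (Suc m)" by (rule g2)
  fix k assume k: "k \<in> words (Suc m)"
  note v = f1(2)[OF k] g1(2)[OF insert_at_words[OF le s(1) k]] g2(2)[OF k]
  show "face C (Suc (Suc m)) (Suc i) (-1) (globe_cube C (Suc (Suc m)) x) (R {k})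
    = globe_cube C (Suc m) (bd C ((-1) ^ Suc i) (Suc m) x) (R {k})"
  proof (cases "snd (globe_code k) = Suc m")
    case True
    have "bd C (fst (globe_code k)) (Suc m) (bd C ((-1) ^ Suc i) (Suc m) x) = bd C ((-1) ^ Suc i) (Suc m) x"
      by (rule bd_bd_ge[OF x s(2) globe_code_sign]) simp
    then show ?thesis using v globe_code_insert_neg[OF k i] True by simp
  next
    case False
    then have "snd (globe_code k) < Suc m" using snd_globe_code_le[OF k] by simp
    then show ?thesis
      using v globe_code_insert_neg[OF k i] False bd_globe_code_bd[OF x s(2)] by simp
  qed
qed

text \<open>Words that contain 1 have the code (1, 0), so both sides are constant with value
  \<open>tgt C 0 x\<close>.\<close>

lemma globe_cube_face_pos:
  assumes x: "x \<in> carrier C" and i: "i = m \<or> i = Suc m"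
  shows "face C (Suc (Suc m)) (Suc i) 1 (globe_cube C (Suc (Suc m)) x)
    = degeneracy C m (Suc m) (face C (Suc m) (Suc m) 1 (globe_cube C (Suc m) (src C (Suc m) x)))"
proof -
  have s: "(-1::int) \<in> signs" "(1::int) \<in> signs" by auto
  have le: "i \<le> Suc m" "m \<le> m" "Suc m \<in> {1..Suc m}" using i by auto
  have sx: "src C (Suc m) x \<in> carrier C" by (rule bd_closed[OF x s(1)])
  note g1 = globe_cube_values[OF C x, where n = "Suc (Suc m)"] and g2 = globe_cube_values[OF C sx, where n = "Suc m"]
  note f1 = face_values[OF g1(1) le(1) s(2)] and f2 = face_values[OF g2(1) le(2) s(2)]
  note d2 = degeneracy_nerve[OF f2(1) le(3)]
  show ?thesis
  proof (rule nerve_ext)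
    show "face C (Suc (Suc m)) (Suc i) 1 (globe_cube C (Suc (Suc m)) x) \<in> nerve C (Suc m)" by (rule f1)
    show "degeneracy C m (Suc m) (face C (Suc m) (Suc m) 1 (globe_cube C (Suc m) (src C (Suc m) x)))
      \<in> nerve C (Suc m)" by (rule d2)
    fix k assume k: "k \<in> words (Suc m)"
    let ?l = "take m k @ drop (Suc m) k"
    have l: "?l \<in> words m" using word_mapD(1)[OF word_map_delete[of m m] k] by simp
    have "1 \<in> set (insert_at i 1 k)" "1 \<in> set (insert_at m 1 ?l)" by (auto simp: insert_at_def)
    then have c: "globe_code (insert_at i 1 k) = (1, 0)" "globe_code (insert_at m 1 ?l) = (1, 0)"
      using globe_code_pos by blast+
    show "face C (Suc (Suc m)) (Suc i) 1 (globe_cube C (Suc (Suc m)) x) (R {k})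
      = degeneracy C m (Suc m) (face C (Suc m) (Suc m) 1 (globe_cube C (Suc m) (src C (Suc m) x))) (R {k})"
      using f1(2)[OF k] g1(2)[OF insert_at_words[OF le(1) s(2) k]] d2(2)[OF k] f2(2)[OF l]
        g2(2)[OF insert_at_words[OF le(2) s(2) l]] c bd_bd_less[OF x s(1) s(2), of 0 "Suc m"] by simp
  qed
qed

lemma globe_cube_top:
  assumes x: "x \<in> carrier C" and fix_x: "\<And>\<alpha>. \<alpha> \<in> signs \<Longrightarrow> bd C \<alpha> n x = x"
  shows "globe_cube C n x (R {replicate n 0}) = x"
  using globe_cube_values(2)[OF C x replicate_in_words] fix_x[OF globe_code_sign] by simp

text \<open>Dimension at most \<open>n\<close>, rather than equal to \<open>n\<close>, is the
  condition that passes to the boundaries in the recursion.\<close>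

lemma box_minus_globe_cube:
  "x \<in> carrier C \<Longrightarrow> (\<And>\<alpha>. \<alpha> \<in> signs \<Longrightarrow> bd C \<alpha> n x = x) \<Longrightarrow> box_minus C n x = globe_cube C n x"
proof (induction n arbitrary: x rule: induct_nat_012)
  case 0
  have "x = bd C (fst (globe_code k)) (snd (globe_code k)) x" if "k \<in> words 0" for k
    using that 0(2) by simp
  then have "(\<lambda>y. y \<in> nerve C 0 \<and> (\<forall>k \<in> words 0. y (R {k}) = x))
    = (\<lambda>y. y \<in> nerve C 0 \<and> (\<forall>k \<in> words 0. y (R {k}) = bd C (fst (globe_code k)) (snd (globe_code k)) x))"
    by simp
  then show ?case by (simp add: globe_cube_def cube_with_values_def)
next
  case 1
  note g = globe_cube_values[OF C 1(1), where n = 1]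
  show ?case
    unfolding box_minus.simps
  proof (rule the_equality)
    show "globe_cube C (Suc 0) x \<in> nerve C 1 \<and> globe_cube C (Suc 0) x (R {[-1]}) = src C 0 x \<and>
      globe_cube C (Suc 0) x (R {[0]}) = x \<and> globe_cube C (Suc 0) x (R {[1]}) = tgt C 0 x"
      using g 1(2)[of 1] by simp
    fix z assume z: "z \<in> nerve C 1 \<and> z (R {[-1]}) = src C 0 x \<and> z (R {[0]}) = x \<and> z (R {[1]}) = tgt C 0 x"
    have "z = globe_cube C 1 x"
    proof (rule nerve_ext[OF _ g(1)])
      fix k assume k: "k \<in> words 1"
      then obtain a where "k = [a]" "a = -1 \<or> a = 0 \<or> a = 1"
        unfolding One_nat_def by (metis words_SucE words_0 singletonD)
      then show "z (R {k}) = globe_cube C 1 x (R {k})" using g(2)[OF k] z 1(2)[of 1] by auto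
    qed (use z in simp)
    then show "z = globe_cube C (Suc 0) x" by simp
  qed
next
  case (ge2 m)
  note x = ge2(3)
  have IH: "box_minus C (Suc m) (bd C \<alpha> (Suc m) x) = globe_cube C (Suc m) (bd C \<alpha> (Suc m) x)"
    if "\<alpha> \<in> signs" for \<alpha>
    using ge2(2)[OF bd_closed[OF x that]] bd_bd_ge[OF x that] by blast
  have pw: "(-1::int) ^ i \<in> signs" for i by (auto simp: minus_one_power_iff)
  let ?g = "globe_cube C (Suc m) (src C (Suc m) x)"
  let ?P = "\<lambda>z. z \<in> nerve C (Suc (Suc m)) \<and> z (R {replicate (Suc (Suc m)) 0}) = x \<and>
      (\<forall>i \<in> {1..m}. \<forall>\<alpha> \<in> signs.
        face C (Suc (Suc m)) i \<alpha> z = connection C m m (face C (Suc m) i \<alpha> ?g)) \<and>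
      (\<forall>i \<in> {Suc m..Suc (Suc m)}.
        face C (Suc (Suc m)) i (-1) z = globe_cube C (Suc m) (bd C ((-1) ^ i) (Suc m) x) \<and>
        face C (Suc (Suc m)) i 1 z = degeneracy C m (Suc m) (face C (Suc m) (Suc m) 1 ?g))"
  have eq: "box_minus C (Suc (Suc m)) x = (THE z. ?P z)"
    using IH[of "-1"] IH[OF pw] by simp
  have g: "globe_cube C (Suc (Suc m)) x \<in> nerve C (Suc (Suc m))" by (rule globe_cube_values[OF C x])
  have Pg: "?P (globe_cube C (Suc (Suc m)) x)"
  proof (intro conjI ballI)
    show "globe_cube C (Suc (Suc m)) x (R {replicate (Suc (Suc m)) 0}) = x"
      by (rule globe_cube_top[OF x ge2(4)])
    fix i :: nat and \<alpha> :: int assume "i \<in> {1..m}" "\<alpha> \<in> signs"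
    then show "face C (Suc (Suc m)) i \<alpha> (globe_cube C (Suc (Suc m)) x)
      = connection C m m (face C (Suc m) i \<alpha> ?g)"
      using globe_cube_face_low[OF x, of "i - 1" m \<alpha>] by fastforce
  next
    fix i assume "i \<in> {Suc m..Suc (Suc m)}"
    then have i: "i = Suc (i - 1)" "i - 1 = m \<or> i - 1 = Suc m" by auto
    show "face C (Suc (Suc m)) i (-1) (globe_cube C (Suc (Suc m)) x)
        = globe_cube C (Suc m) (bd C ((-1) ^ i) (Suc m) x)"
      using globe_cube_face_neg[OF x i(2)] i(1) by simp
    show "face C (Suc (Suc m)) i 1 (globe_cube C (Suc (Suc m)) x)
        = degeneracy C m (Suc m) (face C (Suc m) (Suc m) 1 ?g)"
      using globe_cube_face_pos[OF x i(2)] i(1) by simp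
  qed (rule g)
  have "z = globe_cube C (Suc (Suc m)) x" if z: "?P z" for z
  proof (rule nerve_eq_by_faces[OF _ g])
    show "z \<in> nerve C (Suc (Suc m))" using z by blast
    show "z (R {replicate (Suc (Suc m)) 0}) = globe_cube C (Suc (Suc m)) x (R {replicate (Suc (Suc m)) 0})"
      using z Pg by metis
    fix i :: nat and \<alpha> :: int assume i: "i \<le> Suc m" and a: "\<alpha> \<in> signs"
    show "face C (Suc (Suc m)) (Suc i) \<alpha> z = face C (Suc (Suc m)) (Suc i) \<alpha> (globe_cube C (Suc (Suc m)) x)"
    proof (cases "i < m")
      case True
      then have "Suc i \<in> {1..m}" by simp
      then show ?thesis using z Pg a by metis
    next
      case False
      then have "Suc i \<in> {Suc m..Suc (Suc m)}" using i by simp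
      moreover have "\<alpha> = -1 \<or> \<alpha> = 1" using a by auto
      ultimately show ?thesis using z Pg by metis
    qed
  qed
  then show ?case unfolding eq using the_equality[of ?P, OF Pg] by blast
qed

text \<open>Applied below to an image \<open>f x\<close> of smaller dimension than \<open>x\<close>,
  for which the cube becomes zero modulo connections.\<close>

lemma globe_cube_connection:
  assumes x: "x \<in> carrier C" and fix_x: "\<And>\<alpha>. \<alpha> \<in> signs \<Longrightarrow> bd C \<alpha> (Suc m) x = x"
  shows "globe_cube C (Suc (Suc m)) x = connection C (Suc m) (Suc m) (globe_cube C (Suc m) x)"
proof -
  note g1 = globe_cube_values[OF C x, where n = "Suc (Suc m)"] and g2 = globe_cube_values[OF C x, where n = "Suc m"]
  have le: "m < Suc m" by simp
  note c2 = connection_values[OF g2(1) le]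
  have stable: "bd C \<alpha> j x = x" if "\<alpha> \<in> signs" "Suc m \<le> j" for \<alpha> j
    using bd_bd_ge[OF x that(1) that(1) that(2)] fix_x[OF that(1)] by simp
  show ?thesis
  proof (rule nerve_ext[OF g1(1) c2(1)])
    fix k assume k: "k \<in> words (Suc (Suc m))"
    show "globe_cube C (Suc (Suc m)) x (R {k}) = connection C (Suc m) (Suc m) (globe_cube C (Suc m) x) (R {k})"
      using globe_code_merge_at[OF k] g1(2)[OF k] c2(2)[OF k] g2(2)[OF merge_at_words[OF le k]]
        stable[OF globe_code_sign] by auto
  qed
qed

lemma globe_code_initial_edge: "i < n \<Longrightarrow> snd (globe_code (initial_edge n i)) = 1"
proof (induction n arbitrary: i)
  case (Suc n)
  have r: "1 \<notin> set (replicate n (-1::int))" "globe_code (replicate n (-1)) = (-1, 0)"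
    by (cases n; simp)+
  show ?case
  proof (cases i)
    case 0
    then show ?thesis using r by (simp add: initial_edge_def)
  next
    case (Suc j)
    then have "0 \<in> set (initial_edge n j)" "1 \<notin> set (initial_edge n j)"
      using Suc.prems set_update_subset_insert[of "replicate n (-1::int)" j 0]
      by (auto simp: initial_edge_def set_update_memI)
    then show ?thesis using Suc by (simp add: initial_edge_def)
  qed
qed simp

text \<open>Initial edges have codes of dimension 1, so they are sent to 1-boundaries of
  \<open>x\<close>.\<close>

lemma globe_cube_neg_nerve:
  assumes x: "x \<in> carrier C" and ne: "\<And>\<beta>. \<beta> \<in> signs \<Longrightarrow> src C 0 (bd C \<beta> 1 x) \<noteq> bd C \<beta> 1 x"
  shows "globe_cube C n x \<in> neg_nerve C n"
  unfolding neg_nerve_iff[OF C] proper_initial_edges_def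
  using globe_cube_values[OF C x, where n = n] ne[OF globe_code_sign] globe_code_initial_edge by simp

text \<open>The faces of low index are connections. The last two are the cubes of the source and the
  target of \<open>x\<close>; the parity of m decides which comes first, and the alternating sign
  compensates for it.\<close>

lemma corner_bd_globe_cube:
  assumes x: "x \<in> carrier C" and ne: "\<And>\<beta>. \<beta> \<in> signs \<Longrightarrow> src C 0 (bd C \<beta> 1 x) \<noteq> bd C \<beta> 1 x"
  shows "corner_bd C (Suc (Suc m)) (globe_cube C (Suc (Suc m)) x)
    - (frag_of (globe_cube C (Suc m) (src C (Suc m) x)) - frag_of (globe_cube C (Suc m) (tgt C (Suc m) x)))
    \<in> frags (connections C m m)"
proof -
  have s: "(-1::int) \<in> signs" by simp
  let ?d = "\<lambda>i. frag_cmul ((-1) ^ i) (frag_of (face C (Suc (Suc m)) (Suc i) (-1) (globe_cube C (Suc (Suc m)) x)))"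
  let ?g = "\<lambda>\<alpha>. frag_of (globe_cube C (Suc m) (bd C \<alpha> (Suc m) x))"
  have low: "sum ?d {..<m} \<in> frags (connections C m m)"
  proof (intro frags_sum frags_cmul)
    fix i assume i: "i \<in> {..<m}"
    then obtain m' where m: "m = Suc m'" by (cases m) auto
    have "globe_cube C (Suc m) (src C (Suc m) x) \<in> neg_nerve C (Suc m)"
    proof (rule globe_cube_neg_nerve[OF bd_closed[OF x s]])
      fix \<beta> :: int assume b: "\<beta> \<in> signs"
      show "src C 0 (bd C \<beta> 1 (src C (Suc m) x)) \<noteq> bd C \<beta> 1 (src C (Suc m) x)"
        using ne[OF b] bd_bd_less[OF x s b, of 1 "Suc m"] m by simp
    qed
    then have "face C (Suc m) (Suc i) (-1) (globe_cube C (Suc m) (src C (Suc m) x)) \<in> neg_nerve C m"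
      by (rule neg_nerve_face) (use i in simp)
    then show "frag_of (face C (Suc (Suc m)) (Suc i) (-1) (globe_cube C (Suc (Suc m)) x)) \<in> frags (connections C m m)"
      using globe_cube_face_low[OF x _ s, of i m] i m unfolding frags_of connections_def by auto
  qed
  have "corner_bd C (Suc (Suc m)) (globe_cube C (Suc (Suc m)) x) = sum ?d {..<m} + ?d m + ?d (Suc m)"
    unfolding corner_bd_def by simp
  also have "?d m = frag_cmul ((-1) ^ m) (?g ((-1) ^ Suc m))"
    using globe_cube_face_neg[OF x, of m m] by simp
  also have "?d (Suc m) = frag_cmul ((-1) ^ Suc m) (?g ((-1) ^ m))"
    using globe_cube_face_neg[OF x, of "Suc m" m] by simp
  finally have "corner_bd C (Suc (Suc m)) (globe_cube C (Suc (Suc m)) x) - (?g (-1) - ?g 1) = sum ?d {..<m}"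
    by (cases "even m") auto
  then show ?thesis using low by simp
qed

end

section \<open>Cubes and functors of the target category\<close>

lemma nerve_map_globe_cube:
  assumes C: "omega_category C" and D: "omega_category D" and f: "omega_functor C D f"
    and x: "x \<in> carrier C"
  shows "nerve_map n f (globe_cube C n x) = globe_cube D n (f x)"
proof (rule nerve_ext)
  note g = globe_cube_values[OF C x, where n = n]
  note fx = omega_functorD(1)[OF f x]
  have "omega_functor (cube_cat n) D (f \<circ> globe_cube C n x)"
    by (rule omega_functor_comp[OF nerve_functor[OF g(1)] f])
  then show "nerve_map n f (globe_cube C n x) \<in> nerve D n"
    unfolding nerve_map_def by (rule restrict_functor_nerve)
  show "globe_cube D n (f x) \<in> nerve D n" by (rule globe_cube_values[OF D fx])
  fix k assume k: "k \<in> words n"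
  show "nerve_map n f (globe_cube C n x) (R {k}) = globe_cube D n (f x) (R {k})"
    using g(2)[OF k] globe_cube_values(2)[OF D fx k] omega_functorD(2)[OF f x globe_code_sign]
      generator_in_cube_cat[OF k] by (simp add: nerve_map_def)
qed

lemma nerve_map_nerve:
  assumes f: "omega_functor C D f" and x: "x \<in> nerve C n"
  shows "nerve_map n f x \<in> nerve D n" "k \<in> words n \<Longrightarrow> nerve_map n f x (R {k}) = f (x (R {k}))"
proof -
  show "nerve_map n f x \<in> nerve D n"
    unfolding nerve_map_def
    by (rule restrict_functor_nerve[OF omega_functor_comp[OF nerve_functor[OF x] f]])
  show "k \<in> words n \<Longrightarrow> nerve_map n f x (R {k}) = f (x (R {k}))"
    using generator_in_cube_cat by (simp add: nerve_map_def)
qed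

lemma nerve_map_face:
  assumes f: "omega_functor C D f" and x: "x \<in> nerve C (Suc n)" and i: "i \<le> n" and a: "\<alpha> \<in> signs"
  shows "nerve_map n f (face C (Suc n) (Suc i) \<alpha> x) = face D (Suc n) (Suc i) \<alpha> (nerve_map (Suc n) f x)"
proof (rule nerve_ext)
  note fx = face_values[OF x i a] and nx = nerve_map_nerve[OF f x]
  note nf = nerve_map_nerve[OF f fx(1)] and fn = face_values[OF nx(1) i a]
  show "nerve_map n f (face C (Suc n) (Suc i) \<alpha> x) \<in> nerve D n" by (rule nf)
  show "face D (Suc n) (Suc i) \<alpha> (nerve_map (Suc n) f x) \<in> nerve D n" by (rule fn)
  fix k assume k: "k \<in> words n"
  show "nerve_map n f (face C (Suc n) (Suc i) \<alpha> x) (R {k})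
    = face D (Suc n) (Suc i) \<alpha> (nerve_map (Suc n) f x) (R {k})"
    using nf(2)[OF k] fn(2)[OF k] fx(2)[OF k] nx(2)[OF insert_at_words[OF i a k]] by simp
qed

lemma nerve_map_connection:
  assumes f: "omega_functor C D f" and x: "x \<in> nerve C n" and i: "i < n"
  shows "nerve_map (Suc n) f (connection C n (Suc i) x) = connection D n (Suc i) (nerve_map n f x)"
proof (rule nerve_ext)
  note cx = connection_values[OF x i] and nx = nerve_map_nerve[OF f x]
  note nc = nerve_map_nerve[OF f cx(1)] and cn = connection_values[OF nx(1) i]
  show "nerve_map (Suc n) f (connection C n (Suc i) x) \<in> nerve D (Suc n)" by (rule nc)
  show "connection D n (Suc i) (nerve_map n f x) \<in> nerve D (Suc n)" by (rule cn)
  fix k assume k: "k \<in> words (Suc n)"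
  show "nerve_map (Suc n) f (connection C n (Suc i) x) (R {k})
    = connection D n (Suc i) (nerve_map n f x) (R {k})"
    using nc(2)[OF k] cn(2)[OF k] cx(2)[OF k] nx(2)[OF merge_at_words[OF i k]] by simp
qed

section \<open>Homology of quotient complexes\<close>

lemma (in group) rcoset_eq_iff:
  assumes H: "subgroup H G" and x: "x \<in> carrier G" and y: "y \<in> carrier G"
  shows "H #> x = H #> y \<longleftrightarrow> x \<otimes> inv y \<in> H"
proof -
  have "x \<in> H #> y \<longleftrightarrow> x \<otimes> inv y \<in> H" by (rule subgroup.rcos_module[OF H is_group y x])
  then show ?thesis using rcos_self[OF x H] repr_independence[OF _ y H] by metis
qed

text \<open>The image of a coset is only contained in a coset of \<open>H\<close>; multiplication by
  \<open>H\<close> fills it up.\<close>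

lemma set_mult_image_rcoset:
  assumes G: "group G" and L: "group L" and f: "f \<in> hom G L" and B: "subgroup B G" and H: "subgroup H L"
    and fB: "f ` B \<subseteq> H" and c: "c \<in> carrier G"
  shows "H <#>\<^bsub>L\<^esub> (f ` (B #>\<^bsub>G\<^esub> c)) = H #>\<^bsub>L\<^esub> f c"
proof
  interpret L: group L by (rule L)
  interpret G: group G by (rule G)
  have fc: "f c \<in> carrier L" using f c by (auto simp: hom_def)
  have one: "f \<one>\<^bsub>G\<^esub> = \<one>\<^bsub>L\<^esub>" by (rule hom_one[OF f G L])
  show "H <#>\<^bsub>L\<^esub> (f ` (B #>\<^bsub>G\<^esub> c)) \<subseteq> H #>\<^bsub>L\<^esub> f c"
  proof
    fix y assume "y \<in> H <#>\<^bsub>L\<^esub> (f ` (B #>\<^bsub>G\<^esub> c))"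
    then obtain h b where h: "h \<in> H" "b \<in> B" "y = h \<otimes>\<^bsub>L\<^esub> f (b \<otimes>\<^bsub>G\<^esub> c)"
      by (auto simp: set_mult_def r_coset_def)
    have bc: "b \<in> carrier G" "f b \<in> H" using h(2) subgroup.mem_carrier[OF B] fB by auto
    have "f (b \<otimes>\<^bsub>G\<^esub> c) = f b \<otimes>\<^bsub>L\<^esub> f c" using f bc(1) c by (simp add: hom_def)
    then have "y = (h \<otimes>\<^bsub>L\<^esub> f b) \<otimes>\<^bsub>L\<^esub> f c"
      using h bc subgroup.mem_carrier[OF H] fc by (simp add: L.m_assoc)
    moreover have "h \<otimes>\<^bsub>L\<^esub> f b \<in> H" by (rule subgroup.m_closed[OF H h(1) bc(2)])
    ultimately show "y \<in> H #>\<^bsub>L\<^esub> f c" by (auto simp: r_coset_def)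
  qed
  show "H #>\<^bsub>L\<^esub> f c \<subseteq> H <#>\<^bsub>L\<^esub> (f ` (B #>\<^bsub>G\<^esub> c))"
  proof
    fix y assume "y \<in> H #>\<^bsub>L\<^esub> f c"
    then obtain h where "h \<in> H" "y = h \<otimes>\<^bsub>L\<^esub> f c" by (auto simp: r_coset_def)
    moreover have "c \<in> B #>\<^bsub>G\<^esub> c" by (rule G.rcos_self[OF c B])
    ultimately show "y \<in> H <#>\<^bsub>L\<^esub> (f ` (B #>\<^bsub>G\<^esub> c))" unfolding set_mult_def by blast
  qed
qed

locale chain_complex =
  fixes K :: "'c complex_data"
  assumes comm_group_grp: "comm_group (grp K n)"
    and bdry_hom: "bdry K (Suc n) \<in> hom (grp K (Suc n)) (grp K n)"
    and bdry_bdry: "c \<in> carrier (grp K (Suc (Suc n))) \<Longrightarrow> bdry K (Suc n) (bdry K (Suc (Suc n)) c) = \<one>\<^bsub>grp K n\<^esub>"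
begin

lemma group_grp: "group (grp K n)"
  using comm_group_grp comm_group.axioms(2) by blast

lemma bdry_closed: "c \<in> carrier (grp K (Suc n)) \<Longrightarrow> bdry K (Suc n) c \<in> carrier (grp K n)"
  using bdry_hom by (auto simp: hom_def)

lemma group_hom_bdry: "group_hom (grp K (Suc n)) (grp K n) (bdry K (Suc n))"
  using group_grp bdry_hom by (simp add: group_hom_def group_hom_axioms_def)

lemma subgroup_cycles: "subgroup (cycles K n) (grp K n)"
proof (cases n)
  case 0
  then show ?thesis using group.subgroup_self[OF group_grp] by (simp add: cycles_def)
next
  case (Suc m)
  then show ?thesis using group_hom.subgroup_kernel[OF group_hom_bdry] by (simp add: cycles_def)
qed

lemma cycles_carrier: "c \<in> cycles K n \<Longrightarrow> c \<in> carrier (grp K n)"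
  by (rule subgroup.mem_carrier[OF subgroup_cycles])

lemma subgroup_boundaries: "subgroup (boundaries K n) (grp K n)"
  unfolding boundaries_def by (rule group_hom.img_is_subgroup[OF group_hom_bdry])

lemma boundaries_cycles: "b \<in> boundaries K n \<Longrightarrow> b \<in> cycles K n"
  using bdry_closed bdry_bdry by (cases n) (auto simp: boundaries_def cycles_def kernel_def)

lemma carrier_homology: "carrier (homology K n) = (\<lambda>c. boundaries K n #>\<^bsub>grp K n\<^esub> c) ` cycles K n"
  by (auto simp: homology_def FactGroup_def RCOSETS_def r_coset_def)

lemma mult_homology:
  assumes c: "c \<in> cycles K n" and d: "d \<in> cycles K n"
  shows "(boundaries K n #>\<^bsub>grp K n\<^esub> c) \<otimes>\<^bsub>homology K n\<^esub> (boundaries K n #>\<^bsub>grp K n\<^esub> d)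
    = boundaries K n #>\<^bsub>grp K n\<^esub> (c \<otimes>\<^bsub>grp K n\<^esub> d)"
proof -
  have "boundaries K n \<lhd> grp K n"
    by (rule comm_group.subgroup_imp_normal[OF comm_group_grp subgroup_boundaries])
  from normal.rcos_sum[OF this cycles_carrier[OF c] cycles_carrier[OF d]]
  show ?thesis by (simp add: homology_def FactGroup_def set_mult_def)
qed

end

lemma chain_map_closed:
  "chain_map K L f \<Longrightarrow> c \<in> carrier (grp K n) \<Longrightarrow> f n c \<in> carrier (grp L n)"
  by (auto simp: chain_map_def hom_def)

lemma chain_map_boundaries: "chain_map K L f \<Longrightarrow> f n ` boundaries K n \<subseteq> boundaries L n"
  using chain_map_closed[of K L f] by (auto simp: boundaries_def chain_map_def)

lemma chain_map_cycles:
  assumes K: "chain_complex K" and L: "chain_complex L" and f: "chain_map K L f" and c: "c \<in> cycles K n"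
  shows "f n c \<in> cycles L n"
proof (cases n)
  case 0
  then show ?thesis using c chain_map_closed[OF f] by (simp add: cycles_def)
next
  case (Suc m)
  have cc: "c \<in> carrier (grp K (Suc m))" "bdry K (Suc m) c = \<one>\<^bsub>grp K m\<^esub>"
    using c Suc by (auto simp: cycles_def kernel_def)
  have "bdry L (Suc m) (f (Suc m) c) = f m \<one>\<^bsub>grp K m\<^esub>" using f cc unfolding chain_map_def by metis
  also have "\<dots> = \<one>\<^bsub>grp L m\<^esub>"
    using f hom_one[OF _ chain_complex.group_grp[OF K] chain_complex.group_grp[OF L], of "f m" m m]
    by (simp add: chain_map_def)
  finally show ?thesis using chain_map_closed[OF f cc(1)] Suc by (simp add: cycles_def kernel_def)
qed

lemma homology_map_coset:
  assumes K: "chain_complex K" and L: "chain_complex L" and f: "chain_map K L f"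
    and c: "c \<in> carrier (grp K n)"
  shows "homology_map L n (f n) (boundaries K n #>\<^bsub>grp K n\<^esub> c) = boundaries L n #>\<^bsub>grp L n\<^esub> f n c"
  unfolding homology_map_def
  using chain_complex.group_grp[OF K] chain_complex.group_grp[OF L] f
    chain_complex.subgroup_boundaries[OF K] chain_complex.subgroup_boundaries[OF L]
    chain_map_boundaries[OF f] c
  by (intro set_mult_image_rcoset) (auto simp: chain_map_def)

section \<open>Quotient by a subcomplex and the induced map\<close>

locale subcomplex = chain_complex K for K :: "'c complex_data" +
  fixes N :: "nat \<Rightarrow> 'c set"
  assumes subgroup_N: "subgroup (N n) (grp K n)"
    and bdry_N: "c \<in> N (Suc n) \<Longrightarrow> bdry K (Suc n) c \<in> N n"
begin

abbreviation "Q \<equiv> quotient_complex K N"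

lemma grp_Q [simp]: "grp Q n = grp K n Mod N n"
  by (simp add: quotient_complex_def)

lemma normal_N: "N n \<lhd> grp K n"
  by (rule comm_group.subgroup_imp_normal[OF comm_group_grp subgroup_N])

lemma quotient_proj_hom: "quotient_proj K N n \<in> hom (grp K n) (grp K n Mod N n)"
  using normal.r_coset_hom_Mod[OF normal_N] unfolding quotient_proj_def[abs_def] .

lemma comm_group_Mod_N: "comm_group (grp K n Mod N n)"
  by (rule comm_group.abelian_FactGroup[OF comm_group_grp subgroup_N])

lemma group_Mod_N: "group (grp K n Mod N n)"
  using comm_group_Mod_N comm_group.axioms(2) by blast

lemma group_hom_proj: "group_hom (grp K n) (grp K n Mod N n) (quotient_proj K N n)"
  using group_grp group_Mod_N quotient_proj_hom by (simp add: group_hom_def group_hom_axioms_def)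

lemma carrier_Mod_N: "carrier (grp K n Mod N n) = quotient_proj K N n ` carrier (grp K n)"
  by (auto simp: FactGroup_def RCOSETS_def quotient_proj_def)

lemma quotient_proj_eq_iff:
  "c \<in> carrier (grp K n) \<Longrightarrow> d \<in> carrier (grp K n)
    \<Longrightarrow> quotient_proj K N n c = quotient_proj K N n d \<longleftrightarrow> c \<otimes>\<^bsub>grp K n\<^esub> inv\<^bsub>grp K n\<^esub> d \<in> N n"
  unfolding quotient_proj_def by (rule group.rcoset_eq_iff[OF group_grp subgroup_N])

lemma bdry_Q:
  "c \<in> carrier (grp K (Suc n))
    \<Longrightarrow> bdry Q (Suc n) (quotient_proj K N (Suc n) c) = quotient_proj K N n (bdry K (Suc n) c)"
  using set_mult_image_rcoset[OF group_grp group_grp bdry_hom subgroup_N subgroup_N, of n c] bdry_N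
  by (auto simp: quotient_complex_def quotient_proj_def)

lemma chain_complex_Q: "chain_complex Q"
proof (rule chain_complex.intro)
  fix n
  show "comm_group (grp Q n)" by (simp add: comm_group_Mod_N)
  show "bdry Q (Suc n) \<in> hom (grp Q (Suc n)) (grp Q n)"
  proof (rule homI)
    fix u assume "u \<in> carrier (grp Q (Suc n))"
    then obtain c where c: "u = quotient_proj K N (Suc n) c" "c \<in> carrier (grp K (Suc n))"
      by (auto simp: carrier_Mod_N)
    then show "bdry Q (Suc n) u \<in> carrier (grp Q n)" using bdry_Q bdry_closed by (simp add: carrier_Mod_N)
    fix v assume "v \<in> carrier (grp Q (Suc n))"
    then obtain d where d: "v = quotient_proj K N (Suc n) d" "d \<in> carrier (grp K (Suc n))"
      by (auto simp: carrier_Mod_N)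
    have "u \<otimes>\<^bsub>grp Q (Suc n)\<^esub> v = quotient_proj K N (Suc n) (c \<otimes>\<^bsub>grp K (Suc n)\<^esub> d)"
      using hom_mult[OF quotient_proj_hom c(2) d(2)] c(1) d(1) by simp
    then show "bdry Q (Suc n) (u \<otimes>\<^bsub>grp Q (Suc n)\<^esub> v)
      = bdry Q (Suc n) u \<otimes>\<^bsub>grp Q n\<^esub> bdry Q (Suc n) v"
      using bdry_Q[OF c(2)] bdry_Q[OF d(2)] bdry_Q[of "c \<otimes>\<^bsub>grp K (Suc n)\<^esub> d" n] c d
        monoid.m_closed[OF group.is_monoid[OF group_grp] c(2) d(2)]
        hom_mult[OF bdry_hom c(2) d(2)]
        hom_mult[OF quotient_proj_hom bdry_closed[OF c(2)] bdry_closed[OF d(2)]] by simp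
  qed
  fix u assume "u \<in> carrier (grp Q (Suc (Suc n)))"
  then obtain c where c: "u = quotient_proj K N (Suc (Suc n)) c" "c \<in> carrier (grp K (Suc (Suc n)))"
    by (auto simp: carrier_Mod_N)
  then show "bdry Q (Suc n) (bdry Q (Suc (Suc n)) u) = \<one>\<^bsub>grp Q n\<^esub>"
    using bdry_Q[OF c(2)] bdry_Q[OF bdry_closed[OF c(2)]] bdry_bdry[OF c(2)]
      hom_one[OF quotient_proj_hom group_grp group_Mod_N] by simp
qed

lemma chain_map_proj: "chain_map K Q (quotient_proj K N)"
  unfolding chain_map_def using quotient_proj_hom bdry_Q by simp

lemma boundaries_Q: "boundaries Q n = quotient_proj K N n ` boundaries K n"
  by (auto simp: boundaries_def carrier_Mod_N bdry_Q image_image cong: image_cong)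

end

text \<open>
  A chain map into \<open>L/N\<close> which lifts to homomorphisms \<open>h n\<close> induces a map into the homology of
  \<open>L\<close> if \<open>N\<close> is acyclic: a cycle \<open>c\<close> is sent to the class of any cycle \<open>l\<close> which differs from
  \<open>h n c\<close> by an element of \<open>N\<close> and a boundary.
\<close>

locale lifted_chain_map =
  K: chain_complex K + L: subcomplex L N for K :: "'c complex_data" and L :: "'d complex_data" and N +
  fixes h :: "nat \<Rightarrow> 'c \<Rightarrow> 'd"
  assumes acyclic: "c \<in> N n \<Longrightarrow> c \<in> cycles L n \<Longrightarrow> c \<in> bdry L (Suc n) ` N (Suc n)"
    and h_hom: "h n \<in> hom (grp K n) (grp L n)"
    and h_chain_map: "chain_map K (quotient_complex L N) (\<lambda>n. quotient_proj L N n \<circ> h n)"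
begin

definition lifts :: "nat \<Rightarrow> 'c \<Rightarrow> 'd \<Rightarrow> bool" where
  "lifts n c l \<longleftrightarrow> c \<in> cycles K n \<and> l \<in> cycles L n \<and>
    (\<exists>d \<in> N n. \<exists>b \<in> boundaries L n. l = d \<otimes>\<^bsub>grp L n\<^esub> (b \<otimes>\<^bsub>grp L n\<^esub> h n c))"

lemma N_carrier: "d \<in> N n \<Longrightarrow> d \<in> carrier (grp L n)"
  by (rule subgroup.mem_carrier[OF L.subgroup_N])

lemma h_closed: "c \<in> carrier (grp K n) \<Longrightarrow> h n c \<in> carrier (grp L n)"
  using h_hom by (auto simp: hom_def)

lemma boundaries_carrier: "b \<in> boundaries L n \<Longrightarrow> b \<in> carrier (grp L n)"
  by (rule subgroup.mem_carrier[OF L.subgroup_boundaries])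

lemma bdry_h:
  assumes c: "c \<in> carrier (grp K (Suc n))"
  shows "bdry L (Suc n) (h (Suc n) c) \<otimes>\<^bsub>grp L n\<^esub> inv\<^bsub>grp L n\<^esub> h n (bdry K (Suc n) c) \<in> N n"
proof -
  have "quotient_proj L N n (h n (bdry K (Suc n) c)) = quotient_proj L N n (bdry L (Suc n) (h (Suc n) c))"
    using h_chain_map c L.bdry_Q[OF h_closed[OF c]] by (simp add: chain_map_def)
  then show ?thesis
    using L.quotient_proj_eq_iff[OF L.bdry_closed[OF h_closed[OF c]] h_closed[OF K.bdry_closed[OF c]]] by simp
qed

text \<open>For a cycle \<open>c\<close> the boundary of \<open>h n c\<close> lies in
  \<open>N\<close> and is a cycle. By acyclicity it is the boundary of an element of
  \<open>N\<close>, whose inverse corrects \<open>h n c\<close> to a cycle; in degree 0 everything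
  is a cycle.\<close>

lemma lifts_exists:
  assumes c: "c \<in> cycles K n"
  shows "\<exists>l. lifts n c l"
proof -
  interpret G: comm_group "grp L n" by (rule L.comm_group_grp)
  have hc: "h n c \<in> carrier (grp L n)" by (rule h_closed[OF K.cycles_carrier[OF c]])
  have one: "\<one>\<^bsub>grp L n\<^esub> \<in> boundaries L n" by (rule subgroup.one_closed[OF L.subgroup_boundaries])
  obtain d where d: "d \<in> N n" "d \<otimes>\<^bsub>grp L n\<^esub> h n c \<in> cycles L n"
  proof (cases n)
    case 0
    have "\<one>\<^bsub>grp L n\<^esub> \<in> N n" by (rule subgroup.one_closed[OF L.subgroup_N])
    moreover have "\<one>\<^bsub>grp L n\<^esub> \<otimes>\<^bsub>grp L n\<^esub> h n c \<in> carrier (grp L n)" using hc by simp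
    moreover have "cycles L n = carrier (grp L n)" using 0 by (simp add: cycles_def)
    ultimately show thesis using that by blast
  next
    case (Suc m)
    interpret M: comm_group "grp L m" by (rule L.comm_group_grp)
    let ?e = "bdry L (Suc m) (h n c)"
    have cc: "c \<in> carrier (grp K (Suc m))" "bdry K (Suc m) c = \<one>\<^bsub>grp K m\<^esub>"
      using c Suc by (auto simp: cycles_def kernel_def)
    have hc': "h n c \<in> carrier (grp L (Suc m))" using hc Suc by simp
    have e: "?e \<in> carrier (grp L m)" by (rule L.bdry_closed[OF hc'])
    have "h m \<one>\<^bsub>grp K m\<^esub> = \<one>\<^bsub>grp L m\<^esub>" by (rule hom_one[OF h_hom K.group_grp L.group_grp])
    then have eN: "?e \<in> N m" using bdry_h[OF cc(1)] cc(2) e Suc by simp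
    have "?e \<in> boundaries L m" using hc' by (auto simp: boundaries_def)
    then obtain d where d: "d \<in> N (Suc m)" "bdry L (Suc m) d = ?e"
      using acyclic[OF eN L.boundaries_cycles] by auto
    let ?d = "inv\<^bsub>grp L n\<^esub> d"
    have d': "?d \<in> N n" using subgroup.m_inv_closed[OF L.subgroup_N d(1)] Suc by simp
    have "bdry L (Suc m) (?d \<otimes>\<^bsub>grp L n\<^esub> h n c) = inv\<^bsub>grp L m\<^esub> ?e \<otimes>\<^bsub>grp L m\<^esub> ?e"
      using hom_mult[OF L.bdry_hom, of ?d m "h n c"] group_hom.hom_inv[OF L.group_hom_bdry N_carrier[OF d(1)]]
        d(2) N_carrier[OF d'] hc Suc by simp
    moreover have "?d \<otimes>\<^bsub>grp L n\<^esub> h n c \<in> carrier (grp L n)" using N_carrier[OF d'] hc by simp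
    ultimately have "?d \<otimes>\<^bsub>grp L n\<^esub> h n c \<in> cycles L n"
      using e Suc by (simp add: cycles_def kernel_def)
    then show thesis using that d' by blast
  qed
  have "d \<otimes>\<^bsub>grp L n\<^esub> h n c = d \<otimes>\<^bsub>grp L n\<^esub> (\<one>\<^bsub>grp L n\<^esub> \<otimes>\<^bsub>grp L n\<^esub> h n c)" using hc by simp
  then show ?thesis unfolding lifts_def using c d one by metis
qed

lemma lifts_mult:
  assumes "lifts n c l" "lifts n c' l'"
  shows "lifts n (c \<otimes>\<^bsub>grp K n\<^esub> c') (l \<otimes>\<^bsub>grp L n\<^esub> l')"
proof -
  interpret G: comm_group "grp L n" by (rule L.comm_group_grp)
  obtain d b d' b' where d: "d \<in> N n" "d' \<in> N n" and b: "b \<in> boundaries L n" "b' \<in> boundaries L n"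
    and l: "l = d \<otimes>\<^bsub>grp L n\<^esub> (b \<otimes>\<^bsub>grp L n\<^esub> h n c)" "l' = d' \<otimes>\<^bsub>grp L n\<^esub> (b' \<otimes>\<^bsub>grp L n\<^esub> h n c')"
    and cl: "c \<in> cycles K n" "c' \<in> cycles K n" "l \<in> cycles L n" "l' \<in> cycles L n"
    using assms unfolding lifts_def by blast
  note cc = K.cycles_carrier[OF cl(1)] K.cycles_carrier[OF cl(2)]
  have "h n (c \<otimes>\<^bsub>grp K n\<^esub> c') = h n c \<otimes>\<^bsub>grp L n\<^esub> h n c'" by (rule hom_mult[OF h_hom cc])
  then have "l \<otimes>\<^bsub>grp L n\<^esub> l'
    = (d \<otimes>\<^bsub>grp L n\<^esub> d') \<otimes>\<^bsub>grp L n\<^esub> ((b \<otimes>\<^bsub>grp L n\<^esub> b') \<otimes>\<^bsub>grp L n\<^esub> h n (c \<otimes>\<^bsub>grp K n\<^esub> c'))"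
    using d[THEN N_carrier] b[THEN boundaries_carrier] cc[THEN h_closed] unfolding l
    by (simp add: G.m_ac)
  then show ?thesis unfolding lifts_def
    using subgroup.m_closed[OF L.subgroup_N d] subgroup.m_closed[OF L.subgroup_boundaries b]
      subgroup.m_closed[OF K.subgroup_cycles cl(1,2)] subgroup.m_closed[OF L.subgroup_cycles cl(3,4)] by blast
qed

abbreviation "induces n z w \<equiv> homology_map (quotient_complex L N) n (quotient_proj L N n) w
  = homology_map (quotient_complex L N) n (quotient_proj L N n \<circ> h n) z"

text \<open>Additively, both sides say that \<open>l\<close> minus \<open>h n c\<close> lies in the
  sum of \<open>N\<close> and the boundaries. The left side says it in the quotient, whose
  boundaries are the images of those of \<open>L\<close>.\<close>

lemma induces_iff_lifts:
  assumes c: "c \<in> cycles K n" and l: "l \<in> cycles L n"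
  shows "induces n (boundaries K n #>\<^bsub>grp K n\<^esub> c) (boundaries L n #>\<^bsub>grp L n\<^esub> l) \<longleftrightarrow> lifts n c l"
proof -
  interpret G: comm_group "grp L n" by (rule L.comm_group_grp)
  interpret Q: chain_complex "quotient_complex L N" by (rule L.chain_complex_Q)
  interpret p: group_hom "grp L n" "grp L n Mod N n" "quotient_proj L N n" by (rule L.group_hom_proj)
  note lc = L.cycles_carrier[OF l] and hc = h_closed[OF K.cycles_carrier[OF c]]
  let ?x = "l \<otimes>\<^bsub>grp L n\<^esub> inv\<^bsub>grp L n\<^esub> h n c"
  have "homology_map (quotient_complex L N) n (quotient_proj L N n) (boundaries L n #>\<^bsub>grp L n\<^esub> l)
    = boundaries (quotient_complex L N) n #>\<^bsub>grp L n Mod N n\<^esub> quotient_proj L N n l"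
    using homology_map_coset[OF L.chain_complex_axioms L.chain_complex_Q L.chain_map_proj lc] by simp
  moreover have "homology_map (quotient_complex L N) n (quotient_proj L N n \<circ> h n) (boundaries K n #>\<^bsub>grp K n\<^esub> c)
    = boundaries (quotient_complex L N) n #>\<^bsub>grp L n Mod N n\<^esub> quotient_proj L N n (h n c)"
    using homology_map_coset[OF K.chain_complex_axioms L.chain_complex_Q h_chain_map K.cycles_carrier[OF c]] by simp
  moreover have "boundaries (quotient_complex L N) n #>\<^bsub>grp L n Mod N n\<^esub> quotient_proj L N n l
      = boundaries (quotient_complex L N) n #>\<^bsub>grp L n Mod N n\<^esub> quotient_proj L N n (h n c)
    \<longleftrightarrow> quotient_proj L N n ?x \<in> boundaries (quotient_complex L N) n"
    using group.rcoset_eq_iff[OF L.group_Mod_N, of "boundaries (quotient_complex L N) n" n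
        "quotient_proj L N n l" "quotient_proj L N n (h n c)"] Q.subgroup_boundaries[of n] lc hc by simp
  moreover have "quotient_proj L N n ?x \<in> boundaries (quotient_complex L N) n
    \<longleftrightarrow> (\<exists>b \<in> boundaries L n. quotient_proj L N n ?x = quotient_proj L N n b)"
    unfolding L.boundaries_Q by blast
  moreover have "quotient_proj L N n ?x = quotient_proj L N n b
      \<longleftrightarrow> (\<exists>d \<in> N n. l = d \<otimes>\<^bsub>grp L n\<^esub> (b \<otimes>\<^bsub>grp L n\<^esub> h n c))" if b: "b \<in> boundaries L n" for b
  proof -
    note bc = boundaries_carrier[OF b]
    have cancel: "inv\<^bsub>grp L n\<^esub> b \<otimes>\<^bsub>grp L n\<^esub> (b \<otimes>\<^bsub>grp L n\<^esub> h n c) = h n c"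
      "h n c \<otimes>\<^bsub>grp L n\<^esub> (inv\<^bsub>grp L n\<^esub> h n c \<otimes>\<^bsub>grp L n\<^esub> inv\<^bsub>grp L n\<^esub> b) = inv\<^bsub>grp L n\<^esub> b"
      using hc bc by (simp_all add: G.m_assoc[symmetric])
    have "l = (?x \<otimes>\<^bsub>grp L n\<^esub> inv\<^bsub>grp L n\<^esub> b) \<otimes>\<^bsub>grp L n\<^esub> (b \<otimes>\<^bsub>grp L n\<^esub> h n c)"
      using lc hc bc cancel(1) by (simp add: G.m_assoc)
    moreover have "?x \<otimes>\<^bsub>grp L n\<^esub> inv\<^bsub>grp L n\<^esub> b = d"
      if "d \<in> N n" "l = d \<otimes>\<^bsub>grp L n\<^esub> (b \<otimes>\<^bsub>grp L n\<^esub> h n c)" for d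
      using that(2) N_carrier[OF that(1)] hc bc cancel(2) by (simp add: G.m_assoc)
    ultimately show ?thesis using L.quotient_proj_eq_iff[of ?x n b] lc hc bc by auto
  qed
  ultimately show ?thesis unfolding lifts_def using c l by auto
qed

text \<open>The difference of two lifts is an element of \<open>N\<close> times a boundary. The
  former is then a cycle, hence a boundary by acyclicity.\<close>

lemma lifts_unique:
  assumes "lifts n c l" "lifts n c l'"
  shows "boundaries L n #>\<^bsub>grp L n\<^esub> l = boundaries L n #>\<^bsub>grp L n\<^esub> l'"
proof -
  interpret G: comm_group "grp L n" by (rule L.comm_group_grp)
  obtain d b d' b' where d: "d \<in> N n" "d' \<in> N n" and b: "b \<in> boundaries L n" "b' \<in> boundaries L n"
    and l: "l = d \<otimes>\<^bsub>grp L n\<^esub> (b \<otimes>\<^bsub>grp L n\<^esub> h n c)" "l' = d' \<otimes>\<^bsub>grp L n\<^esub> (b' \<otimes>\<^bsub>grp L n\<^esub> h n c)"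
    and cl: "c \<in> cycles K n" "l \<in> cycles L n" "l' \<in> cycles L n"
    using assms unfolding lifts_def by blast
  let ?x = "l \<otimes>\<^bsub>grp L n\<^esub> inv\<^bsub>grp L n\<^esub> l'" and ?d = "d \<otimes>\<^bsub>grp L n\<^esub> inv\<^bsub>grp L n\<^esub> d'"
    and ?b = "b \<otimes>\<^bsub>grp L n\<^esub> inv\<^bsub>grp L n\<^esub> b'"
  note car = d[THEN N_carrier] b[THEN boundaries_carrier] h_closed[OF K.cycles_carrier[OF cl(1)]]
  have "?x = (?d \<otimes>\<^bsub>grp L n\<^esub> ?b) \<otimes>\<^bsub>grp L n\<^esub> (h n c \<otimes>\<^bsub>grp L n\<^esub> inv\<^bsub>grp L n\<^esub> h n c)"
    unfolding l using car by (simp add: G.inv_mult G.m_ac del: G.r_inv G.Units_r_inv)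
  then have x: "?x = ?d \<otimes>\<^bsub>grp L n\<^esub> ?b" using car by simp
  have bB: "?b \<in> boundaries L n"
    using subgroup.m_closed[OF L.subgroup_boundaries b(1) subgroup.m_inv_closed[OF L.subgroup_boundaries b(2)]] .
  have dN: "?d \<in> N n"
    using subgroup.m_closed[OF L.subgroup_N d(1) subgroup.m_inv_closed[OF L.subgroup_N d(2)]] .
  have "?x \<in> cycles L n"
    using subgroup.m_closed[OF L.subgroup_cycles cl(2) subgroup.m_inv_closed[OF L.subgroup_cycles cl(3)]] .
  moreover have "?d = ?x \<otimes>\<^bsub>grp L n\<^esub> inv\<^bsub>grp L n\<^esub> ?b"
    unfolding x using dN bB N_carrier boundaries_carrier by (simp add: G.m_assoc)
  ultimately have "?d \<in> cycles L n"
    using subgroup.m_closed[OF L.subgroup_cycles _ subgroup.m_inv_closed[OF L.subgroup_cycles L.boundaries_cycles[OF bB]]]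
    by metis
  then have "?d \<in> boundaries L n"
    using acyclic[OF dN] N_carrier unfolding boundaries_def by blast
  then have "?x \<in> boundaries L n" unfolding x by (rule subgroup.m_closed[OF L.subgroup_boundaries _ bB])
  then show ?thesis
    using group.rcoset_eq_iff[OF L.group_grp L.subgroup_boundaries] L.cycles_carrier cl by simp
qed

lemma induced_value:
  assumes z: "induces n (boundaries K n #>\<^bsub>grp K n\<^esub> c) w" and w: "w \<in> carrier (homology L n)"
    and l: "lifts n c l"
  shows "w = boundaries L n #>\<^bsub>grp L n\<^esub> l"
proof -
  obtain l' where l': "l' \<in> cycles L n" "w = boundaries L n #>\<^bsub>grp L n\<^esub> l'"
    using w by (auto simp: L.carrier_homology)
  have "c \<in> cycles K n" using l by (simp add: lifts_def)
  then have "lifts n c l'" using induces_iff_lifts[OF _ l'(1)] z l'(2) by simp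
  then show ?thesis using lifts_unique[OF _ l] l'(2) by simp
qed

lemma ex1_induced:
  "\<exists>!\<phi>. \<phi> \<in> hom (homology K n) (homology L n) \<and> \<phi> \<in> extensional (carrier (homology K n)) \<and>
    (\<forall>z \<in> carrier (homology K n). induces n z (\<phi> z))"
proof -
  have ex: "\<exists>!w. w \<in> carrier (homology L n) \<and> induces n z w" if z: "z \<in> carrier (homology K n)" for z
  proof -
    obtain c where c: "c \<in> cycles K n" "z = boundaries K n #>\<^bsub>grp K n\<^esub> c"
      using z by (auto simp: K.carrier_homology)
    obtain l where l: "lifts n c l" using lifts_exists[OF c(1)] by blast
    then have lc: "l \<in> cycles L n" by (simp add: lifts_def)
    let ?w = "boundaries L n #>\<^bsub>grp L n\<^esub> l"
    have "?w \<in> carrier (homology L n) \<and> induces n z ?w"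
      using induces_iff_lifts[OF c(1) lc] l lc unfolding c(2) L.carrier_homology by blast
    moreover have "w = ?w" if "w \<in> carrier (homology L n) \<and> induces n z w" for w
      using induced_value[OF _ _ l, of w] that unfolding c(2) by blast
    ultimately show ?thesis by blast
  qed
  define \<phi> where "\<phi> = (\<lambda>z \<in> carrier (homology K n). THE w. w \<in> carrier (homology L n) \<and> induces n z w)"
  have \<phi>: "\<phi> z \<in> carrier (homology L n) \<and> induces n z (\<phi> z)" if z: "z \<in> carrier (homology K n)" for z
    using theI'[OF ex[OF z]] z by (simp add: \<phi>_def)
  have "\<phi> \<in> hom (homology K n) (homology L n)"
  proof (rule homI)
    fix z assume z: "z \<in> carrier (homology K n)"
    then show "\<phi> z \<in> carrier (homology L n)" using \<phi> by blast
    fix z' assume z': "z' \<in> carrier (homology K n)"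
    obtain c where c: "c \<in> cycles K n" "z = boundaries K n #>\<^bsub>grp K n\<^esub> c"
      using z by (auto simp: K.carrier_homology)
    obtain c' where c': "c' \<in> cycles K n" "z' = boundaries K n #>\<^bsub>grp K n\<^esub> c'"
      using z' by (auto simp: K.carrier_homology)
    obtain l l' where l: "lifts n c l" "lifts n c' l'" using lifts_exists c(1) c'(1) by blast
    have lc: "l \<in> cycles L n" "l' \<in> cycles L n" using l by (auto simp: lifts_def)
    have zz: "z \<otimes>\<^bsub>homology K n\<^esub> z' = boundaries K n #>\<^bsub>grp K n\<^esub> (c \<otimes>\<^bsub>grp K n\<^esub> c')"
      using K.mult_homology[OF c(1) c'(1)] c(2) c'(2) by simp
    moreover have "c \<otimes>\<^bsub>grp K n\<^esub> c' \<in> cycles K n" by (rule subgroup.m_closed[OF K.subgroup_cycles c(1) c'(1)])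
    ultimately have "z \<otimes>\<^bsub>homology K n\<^esub> z' \<in> carrier (homology K n)" by (auto simp: K.carrier_homology)
    then have "\<phi> (z \<otimes>\<^bsub>homology K n\<^esub> z') = boundaries L n #>\<^bsub>grp L n\<^esub> (l \<otimes>\<^bsub>grp L n\<^esub> l')"
      using \<phi> induced_value[OF _ _ lifts_mult[OF l]] zz by metis
    moreover have "\<phi> z = boundaries L n #>\<^bsub>grp L n\<^esub> l" "\<phi> z' = boundaries L n #>\<^bsub>grp L n\<^esub> l'"
      using \<phi>[OF z] \<phi>[OF z'] induced_value[OF _ _ l(1)] induced_value[OF _ _ l(2)] c(2) c'(2) by auto
    ultimately show "\<phi> (z \<otimes>\<^bsub>homology K n\<^esub> z') = \<phi> z \<otimes>\<^bsub>homology L n\<^esub> \<phi> z'"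
      using L.mult_homology[OF lc] by simp
  qed
  then have P: "\<phi> \<in> hom (homology K n) (homology L n) \<and> \<phi> \<in> extensional (carrier (homology K n)) \<and>
    (\<forall>z \<in> carrier (homology K n). induces n z (\<phi> z))" using \<phi> by (simp add: \<phi>_def)
  show ?thesis
  proof (rule ex1I, rule P)
    fix \<psi> assume \<psi>: "\<psi> \<in> hom (homology K n) (homology L n) \<and>
      \<psi> \<in> extensional (carrier (homology K n)) \<and> (\<forall>z \<in> carrier (homology K n). induces n z (\<psi> z))"
    show "\<psi> = \<phi>"
    proof (rule extensionalityI)
      show "\<psi> \<in> extensional (carrier (homology K n))" using \<psi> by blast
      show "\<phi> \<in> extensional (carrier (homology K n))" by (simp add: \<phi>_def)
      fix z assume z: "z \<in> carrier (homology K n)"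
      have "\<psi> z \<in> carrier (homology L n) \<and> induces n z (\<psi> z)"
        using hom_in_carrier[OF conjunct1[OF \<psi>] z] conjunct2[OF conjunct2[OF \<psi>]] z by blast
      then show "\<psi> z = \<phi> z" using the1_equality[OF ex[OF z]] z by (simp add: \<phi>_def)
    qed
  qed
qed

end

section \<open>The comparison chain map\<close>

context omega_category
begin

lemma cellsD:
  assumes x: "x \<in> cells C n"
  shows "x \<in> carrier C" "\<alpha> \<in> signs \<Longrightarrow> n \<le> m \<Longrightarrow> bd C \<alpha> m x = x"
proof -
  show xc: "x \<in> carrier C" using x by (simp add: cells_def)
  have "src C n x = x \<and> tgt C n x = x"
    using x LeastI_ex[OF finite_dimensional[OF xc]] by (simp add: cells_def cell_dim_def)
  then have "bd C \<alpha> n x = x" if "\<alpha> \<in> signs" for \<alpha> using that by auto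
  then show "bd C \<alpha> m x = x" if "\<alpha> \<in> signs" "n \<le> m"
    using bd_bd_ge[OF xc that(1) that(1) that(2)] that(1) by simp
qed

lemma cell_dim_le:
  "(\<And>\<alpha>. \<alpha> \<in> signs \<Longrightarrow> bd C \<alpha> n x = x) \<Longrightarrow> cell_dim C x \<le> n"
  unfolding cell_dim_def by (rule Least_le) simp

lemma src_fixed_tgt_fixed:
  assumes x: "x \<in> carrier C" and s: "src C n x = x"
  shows "tgt C n x = x"
  using bd_bd_ge[OF x, of "-1" 1 n n] s by simp

lemma cells_1_src: "x \<in> cells C 1 \<Longrightarrow> src C 0 x \<noteq> x"
proof
  assume x: "x \<in> cells C 1" "src C 0 x = x"
  have "tgt C 0 x = x" by (rule src_fixed_tgt_fixed[OF cellsD(1)[OF x(1)] x(2)])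
  then have "cell_dim C x \<le> 0" using x(2) by (intro cell_dim_le) auto
  then show False using x(1) by (simp add: cells_def)
qed

lemma cells_1I:
  assumes "x \<in> carrier C" "\<And>\<alpha>. \<alpha> \<in> signs \<Longrightarrow> bd C \<alpha> 1 x = x" "src C 0 x \<noteq> x"
  shows "x \<in> cells C 1"
proof -
  have "cell_dim C x \<le> 1" by (rule cell_dim_le[OF assms(2)])
  moreover have "src C (cell_dim C x) x = x"
    using LeastI_ex[OF finite_dimensional[OF assms(1)]] by (simp add: cell_dim_def)
  then have "cell_dim C x \<noteq> 0" using assms(3) by (intro notI) simp
  ultimately show ?thesis using assms(1) by (simp add: cells_def)
qed

lemma cells_bd:
  assumes low: "bd_lowers_dim C" and x: "x \<in> cells C n" and b: "\<beta> \<in> signs"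
  shows "j < n \<Longrightarrow> bd C \<beta> j x \<in> cells C j"
proof (induction "n - j" arbitrary: j rule: less_induct)
  case less
  have lowj: "bd C \<beta> j y \<in> cells C j" if "y \<in> cells C (Suc j)" for y
    using low that b unfolding bd_lowers_dim_def by auto
  show ?case
  proof (cases "Suc j = n")
    case True
    then show ?thesis using lowj x by simp
  next
    case False
    then have "bd C \<beta> (Suc j) x \<in> cells C (Suc j)" using less by simp
    then have "bd C \<beta> j (bd C \<beta> (Suc j) x) \<in> cells C j" by (rule lowj)
    then show ?thesis using bd_bd_less[OF cellsD(1)[OF x] b b, of j "Suc j"] by simp
  qed
qed

text \<open>These cells are the initial edges of \<open>box_minus\<close>, whence it belongs to
  \<open>neg_nerve\<close>.\<close>

lemma cells_bd_1:
  assumes low: "bd_lowers_dim C" and x: "x \<in> cells C (Suc n)" and b: "\<beta> \<in> signs"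
  shows "bd C \<beta> 1 x \<in> cells C 1"
  using cells_bd[OF low x b, of 1] cellsD(2)[OF x b, of 1] x by (cases n) auto

lemma box_minus_cells: "x \<in> cells C n \<Longrightarrow> box_minus C n x = globe_cube C n x"
  by (rule box_minus_globe_cube[OF omega_category_axioms]) (auto simp: cellsD)

lemma globe_cube_cells_neg_nerve:
  assumes low: "bd_lowers_dim C" and x: "x \<in> cells C n"
  shows "globe_cube C n x \<in> neg_nerve C n"
proof (cases n)
  case 0
  then show ?thesis
    using globe_cube_values(1)[OF omega_category_axioms cellsD(1)[OF x]]
    by (simp add: neg_nerve_iff[OF omega_category_axioms] proper_initial_edges_def)
next
  case (Suc m)
  show ?thesis
    using cells_1_src[OF cells_bd_1[OF low x[unfolded Suc]]]
    by (intro globe_cube_neg_nerve[OF omega_category_axioms cellsD(1)[OF x]]) simp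
qed

end

lemma subgroup_frags:
  assumes "S \<subseteq> T"
  shows "subgroup (frags S) (free_Abelian_group T)"
  using assms frags_add frags_uminus
  by (intro subgroup.intro) (auto simp: frags_def, blast+)

lemma frag_extend_hom:
  "(\<And>x. x \<in> S \<Longrightarrow> f x \<in> frags T) \<Longrightarrow> frag_extend f \<in> hom (free_Abelian_group S) (free_Abelian_group T)"
  using frags_extend[of _ S f T]
  by (intro homI) (auto simp: frag_extend_add frags_def)

lemma grp_gl_complex:
  "grp (gl_complex C) n =
    free_Abelian_group (cells C n) \<times>\<times> free_Abelian_group (if n = 0 then cells C 0 else {})"
  by (simp add: gl_complex_def)

lemma carrier_gl_complex:
  "carrier (grp (gl_complex C) n) = frags (cells C n) \<times> frags (if n = 0 then cells C 0 else {})"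
  unfolding grp_gl_complex carrier_DirProd carrier_free_Abelian_group_frags ..

lemma bdry_gl_complex:
  "bdry (gl_complex C) 1 c =
    (frag_extend (\<lambda>x. frag_of (src C 0 x)) (fst c), frag_extend (\<lambda>x. frag_of (tgt C 0 x)) (fst c))"
  "bdry (gl_complex C) (Suc (Suc n)) c =
    (frag_extend (\<lambda>x. frag_of (src C (Suc n) x) - frag_of (tgt C (Suc n) x)) (fst c), 0)"
  by (auto simp: gl_complex_def split: prod.split)

lemma comm_group_DirProd:
  assumes "comm_group G" "comm_group H"
  shows "comm_group (G \<times>\<times> H)"
proof -
  interpret G: comm_group G by (rule assms)
  interpret H: comm_group H by (rule assms)
  interpret group "G \<times>\<times> H" by (rule DirProd_group[OF G.is_group H.is_group])
  show ?thesis by (rule group_comm_groupI) (auto simp: G.m_comm H.m_comm)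
qed

lemma chain_complex_gl_complex:
  assumes C: "omega_category C" and low: "bd_lowers_dim C"
  shows "chain_complex (gl_complex C)"
proof (rule chain_complex.intro)
  interpret omega_category C by (rule C)
  have s: "(-1::int) \<in> signs" "(1::int) \<in> signs" by auto
  fix n
  show "comm_group (grp (gl_complex C) n)"
    unfolding grp_gl_complex by (rule comm_group_DirProd[OF abelian_free_Abelian_group abelian_free_Abelian_group])
  have lower: "src C n x \<in> cells C n" "tgt C n x \<in> cells C n" if "x \<in> cells C (Suc n)" for x n
    using low that unfolding bd_lowers_dim_def by auto
  show "bdry (gl_complex C) (Suc n) \<in> hom (grp (gl_complex C) (Suc n)) (grp (gl_complex C) n)"
  proof (rule homI)
    fix c assume c: "c \<in> carrier (grp (gl_complex C) (Suc n))"
    then have fc: "fst c \<in> frags (cells C (Suc n))" by (auto simp: carrier_gl_complex)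
    show "bdry (gl_complex C) (Suc n) c \<in> carrier (grp (gl_complex C) n)"
    proof (cases n)
      case 0
      then show ?thesis using lower
        by (simp add: bdry_gl_complex[unfolded One_nat_def] carrier_gl_complex frags_extend[OF fc[unfolded 0]])
    next
      case (Suc m)
      then show ?thesis using lower
        by (simp add: bdry_gl_complex carrier_gl_complex frags_extend[OF fc[unfolded Suc]] frags_diff)
    qed
    fix d
    show "bdry (gl_complex C) (Suc n) (c \<otimes>\<^bsub>grp (gl_complex C) (Suc n)\<^esub> d)
      = bdry (gl_complex C) (Suc n) c \<otimes>\<^bsub>grp (gl_complex C) n\<^esub> bdry (gl_complex C) (Suc n) d"
      by (cases n) (simp_all add: grp_gl_complex mult_DirProd' bdry_gl_complex[unfolded One_nat_def] frag_extend_add)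
  qed
  fix c assume c: "c \<in> carrier (grp (gl_complex C) (Suc (Suc n)))"
  then have fc: "fst c \<in> frags (cells C (Suc (Suc n)))" by (auto simp: carrier_gl_complex)
  have eq: "bd C \<alpha> n (src C (Suc n) x) = bd C \<alpha> n (tgt C (Suc n) x)"
    if "x \<in> cells C (Suc (Suc n))" "\<alpha> \<in> signs" for x \<alpha>
    using bd_bd_less[OF cellsD(1)[OF that(1)] s(1) that(2)] bd_bd_less[OF cellsD(1)[OF that(1)] s(2) that(2)]
    by simp
  have z: "frag_extend f (frag_extend (\<lambda>x. frag_of (src C (Suc n) x) - frag_of (tgt C (Suc n) x)) (fst c)) = 0"
    if "\<And>x. x \<in> cells C (Suc (Suc n)) \<Longrightarrow> f (src C (Suc n) x) = f (tgt C (Suc n) x)" for f :: "'a \<Rightarrow> 'a \<Rightarrow>\<^sub>0 int"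
    using fc by (induction rule: frags_induct) (auto simp: frag_extend_diff that)
  show "bdry (gl_complex C) (Suc n) (bdry (gl_complex C) (Suc (Suc n)) c) = \<one>\<^bsub>grp (gl_complex C) n\<^esub>"
  proof (cases n)
    case 0
    show ?thesis using eq[unfolded 0] z[unfolded 0] s
      by (simp add: 0 grp_gl_complex bdry_gl_complex[unfolded One_nat_def])
  next
    case (Suc m)
    show ?thesis using eq[unfolded Suc] z[unfolded Suc] s by (simp add: Suc grp_gl_complex bdry_gl_complex)
  qed
qed

lemma chain_complex_corner_complex:
  assumes C: "omega_category C"
  shows "chain_complex (corner_complex C)"
proof (rule chain_complex.intro)
  fix n
  show "comm_group (grp (corner_complex C) n)"
    unfolding grp_corner_complex by (rule abelian_free_Abelian_group)
  show "bdry (corner_complex C) (Suc n) \<in> hom (grp (corner_complex C) (Suc n)) (grp (corner_complex C) n)"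
    unfolding grp_corner_complex bdry_corner_complex using corner_bd_frags by (rule frag_extend_hom)
  fix c assume "c \<in> carrier (grp (corner_complex C) (Suc (Suc n)))"
  then show "bdry (corner_complex C) (Suc n) (bdry (corner_complex C) (Suc (Suc n)) c) = \<one>\<^bsub>grp (corner_complex C) n\<^esub>"
    unfolding grp_corner_complex bdry_corner_complex
    using frag_extend_corner_bd_corner_bd by (simp add: frags_def)
qed

lemma subcomplex_D_minus:
  assumes C: "omega_category C"
  shows "subcomplex (corner_complex C) (D_minus C)"
proof (rule subcomplex.intro[OF chain_complex_corner_complex[OF C]], rule subcomplex_axioms.intro)
  fix n
  show "subgroup (D_minus C n) (grp (corner_complex C) n)"
    unfolding grp_corner_complex D_minus_frags[OF C]
    by (rule subgroup_frags) (use connections_neg_nerve[OF C] in \<open>cases n; simp\<close>)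
  show "c \<in> D_minus C (Suc n) \<Longrightarrow> bdry (corner_complex C) (Suc n) c \<in> D_minus C n" for c
    by (rule D_minus_subcomplex[OF C])
qed

lemma h_minus_hom:
  assumes C: "omega_category C" and low: "bd_lowers_dim C"
  shows "h_minus C n \<in> hom (grp (gl_complex C) n) (grp (corner_complex C) n)"
proof (rule homI)
  interpret omega_category C by (rule C)
  fix c assume "c \<in> carrier (grp (gl_complex C) n)"
  then have "fst c \<in> frags (cells C n)" by (auto simp: carrier_gl_complex)
  then have "h_minus C n c \<in> frags (neg_nerve C n)"
    unfolding h_minus_def using globe_cube_cells_neg_nerve[OF low] box_minus_cells
    by (auto elim!: frags_extend)
  then show "h_minus C n c \<in> carrier (grp (corner_complex C) n)"
    by (simp add: grp_corner_complex frags_def)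
  fix d
  show "h_minus C n (c \<otimes>\<^bsub>grp (gl_complex C) n\<^esub> d)
    = h_minus C n c \<otimes>\<^bsub>grp (corner_complex C) n\<^esub> h_minus C n d"
    by (simp add: h_minus_def grp_gl_complex grp_corner_complex mult_DirProd' frag_extend_add)
qed

lemma D_minus_diff: "omega_category C \<Longrightarrow> a \<in> D_minus C n \<Longrightarrow> b \<in> D_minus C n \<Longrightarrow> a - b \<in> D_minus C n"
  by (simp add: D_minus_frags frags_diff)

lemma D_minus_zero: "omega_category C \<Longrightarrow> 0 \<in> D_minus C n"
  by (simp add: D_minus_frags)

text \<open>In degree 0 the difference vanishes: the negative face of a 1-cube is its source, and
  \<open>h_minus\<close> keeps just the first component. In higher degrees the connections among the
  faces make up the difference.\<close>

lemma bdry_h_minus: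
  assumes C: "omega_category C" and low: "bd_lowers_dim C"
    and c: "c \<in> carrier (grp (gl_complex C) (Suc n))"
  shows "bdry (corner_complex C) (Suc n) (h_minus C (Suc n) c) - h_minus C n (bdry (gl_complex C) (Suc n) c)
    \<in> D_minus C n"
proof -
  interpret omega_category C by (rule C)
  have s: "(-1::int) \<in> signs" "(1::int) \<in> signs" by auto
  have lower: "src C n x \<in> cells C n" "tgt C n x \<in> cells C n" if "x \<in> cells C (Suc n)" for x
    using low that unfolding bd_lowers_dim_def by auto
  have fc: "fst c \<in> frags (cells C (Suc n))" using c by (auto simp: carrier_gl_complex)
  show ?thesis
  proof (cases n)
    case 0
    have gen: "corner_bd C 1 (box_minus C 1 x) = frag_of (box_minus C 0 (src C 0 x))" if x: "x \<in> cells C 1" for x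
    proof -
      note xc = cellsD(1)[OF x]
      have sc: "src C 0 x \<in> cells C 0" using lower x 0 by simp
      note g = globe_cube_values[OF C xc, where n = "Suc 0"]
      note g0 = globe_cube_values[OF C cellsD(1)[OF sc], where n = 0]
      note f = face_values[OF g(1) order_refl s(1)]
      have "face C (Suc 0) (Suc 0) (-1) (globe_cube C (Suc 0) x) = globe_cube C 0 (src C 0 x)"
      proof (rule nerve_ext[OF f(1) g0(1)])
        fix k assume "k \<in> words 0"
        then have k: "k = []" by simp
        show "face C (Suc 0) (Suc 0) (-1) (globe_cube C (Suc 0) x) (R {k}) = globe_cube C 0 (src C 0 x) (R {k})"
          using f(2)[of k] g(2)[of "[-1]"] g0(2)[of k] cellsD(2)[OF sc s(1)] unfolding k by simp
      qed
      then show ?thesis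
        using box_minus_cells[OF x] box_minus_cells[OF sc] by (simp add: corner_bd_def)
    qed
    have "frag_extend (corner_bd C 1) (frag_extend (\<lambda>x. frag_of (box_minus C 1 x)) (fst c))
      = frag_extend (\<lambda>x. frag_of (box_minus C 0 x)) (frag_extend (\<lambda>x. frag_of (src C 0 x)) (fst c))"
      using fc unfolding 0 One_nat_def[symmetric]
      by (induction rule: frags_induct) (simp_all only: frag_extend_diff frag_extend_of frag_extend_0 gen)
    then show ?thesis
      by (simp add: 0 bdry_corner_complex h_minus_def bdry_gl_complex[unfolded One_nat_def] D_minus_zero[OF C]
          del: box_minus.simps)
  next
    case (Suc m)
    have gen: "corner_bd C (Suc (Suc m)) (box_minus C (Suc (Suc m)) x)
        - (frag_of (box_minus C (Suc m) (src C (Suc m) x)) - frag_of (box_minus C (Suc m) (tgt C (Suc m) x)))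
        \<in> D_minus C (Suc m)" if x: "x \<in> cells C (Suc (Suc m))" for x
      using corner_bd_globe_cube[OF C cellsD(1)[OF x] cells_1_src[OF cells_bd_1[OF low x]], of m]
        lower[unfolded Suc, OF x] box_minus_cells x
      by (simp add: D_minus_Suc[OF C] del: box_minus.simps)
    have "frag_extend (corner_bd C (Suc (Suc m))) (frag_extend (\<lambda>x. frag_of (box_minus C (Suc (Suc m)) x)) (fst c))
      - frag_extend (\<lambda>x. frag_of (box_minus C (Suc m) x))
          (frag_extend (\<lambda>x. frag_of (src C (Suc m) x) - frag_of (tgt C (Suc m) x)) (fst c)) \<in> D_minus C (Suc m)"
      using fc unfolding Suc
    proof (induction rule: frags_induct)
      case zero
      then show ?case using D_minus_zero[OF C] by simp
    next
      case (one x)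
      then show ?case using gen by (simp add: frag_extend_diff del: box_minus.simps)
    next
      case (diff a b)
      have eq: "(p - q) - (r - t) = (p - r) - (q - t)" for p q r t :: "'a cube \<Rightarrow>\<^sub>0 int" by simp
      show ?case using D_minus_diff[OF C diff] unfolding frag_extend_diff eq .
    qed
    then show ?thesis
      by (simp add: Suc bdry_corner_complex h_minus_def bdry_gl_complex del: box_minus.simps)
  qed
qed

lemma reduction_eq_iff:
  assumes C: "omega_category C" and a: "a \<in> carrier (grp (corner_complex C) n)"
    and b: "b \<in> carrier (grp (corner_complex C) n)"
  shows "reduction C n a = reduction C n b \<longleftrightarrow> a - b \<in> D_minus C n"
  using subcomplex.quotient_proj_eq_iff[OF subcomplex_D_minus[OF C] a b] b
  by (simp add: reduction_def grp_corner_complex)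

lemma h_minus_closed:
  "omega_category C \<Longrightarrow> bd_lowers_dim C \<Longrightarrow> c \<in> carrier (grp (gl_complex C) n)
    \<Longrightarrow> h_minus C n c \<in> carrier (grp (corner_complex C) n)"
  using h_minus_hom hom_in_carrier by fast

lemma lifted_chain_map_h_minus:
  assumes C: "omega_category C" and low: "bd_lowers_dim C"
  shows "lifted_chain_map (gl_complex C) (corner_complex C) (D_minus C) (h_minus C)"
proof (rule lifted_chain_map.intro[OF chain_complex_gl_complex[OF C low] subcomplex_D_minus[OF C]],
    rule lifted_chain_map_axioms.intro)
  interpret K: chain_complex "gl_complex C" by (rule chain_complex_gl_complex[OF C low])
  interpret L: subcomplex "corner_complex C" "D_minus C" by (rule subcomplex_D_minus[OF C])
  fix n
  show "c \<in> bdry (corner_complex C) (Suc n) ` D_minus C (Suc n)"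
    if c: "c \<in> D_minus C n" "c \<in> cycles (corner_complex C) n" for c
  proof -
    have "n = 0 \<or> bdry (corner_complex C) n c = 0"
      using c(2) by (cases n) (auto simp: cycles_def kernel_def grp_corner_complex)
    then show ?thesis using D_minus_acyclic[OF C c(1)] by blast
  qed
  show "h_minus C n \<in> hom (grp (gl_complex C) n) (grp (corner_complex C) n)"
    by (rule h_minus_hom[OF C low])
  show "chain_map (gl_complex C) (quotient_complex (corner_complex C) (D_minus C))
    (\<lambda>n. quotient_proj (corner_complex C) (D_minus C) n \<circ> h_minus C n)"
    unfolding chain_map_def
  proof (intro conjI allI ballI)
    fix n
    show "quotient_proj (corner_complex C) (D_minus C) n \<circ> h_minus C n
      \<in> hom (grp (gl_complex C) n) (grp (quotient_complex (corner_complex C) (D_minus C)) n)"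
      using hom_compose[OF h_minus_hom[OF C low] L.quotient_proj_hom] by simp
    fix c assume c: "c \<in> carrier (grp (gl_complex C) (Suc n))"
    note hc = h_minus_closed[OF C low c]
    have "reduction C n (bdry (corner_complex C) (Suc n) (h_minus C (Suc n) c))
      = reduction C n (h_minus C n (bdry (gl_complex C) (Suc n) c))"
      using reduction_eq_iff[OF C L.bdry_closed[OF hc] h_minus_closed[OF C low K.bdry_closed[OF c]]]
        bdry_h_minus[OF C low c] by simp
    then show "(quotient_proj (corner_complex C) (D_minus C) n \<circ> h_minus C n) (bdry (gl_complex C) (Suc n) c)
      = bdry (quotient_complex (corner_complex C) (D_minus C)) (Suc n)
        ((quotient_proj (corner_complex C) (D_minus C) (Suc n) \<circ> h_minus C (Suc n)) c)"
      using L.bdry_Q[OF hc] by (simp add: reduction_def)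
  qed
qed

lemma induced_by_h_minusD:
  assumes "induced_by_h_minus C n \<phi>" and z: "z \<in> carrier (homology (gl_complex C) n)"
  shows "\<phi> z \<in> carrier (homology (corner_complex C) n)"
    and "homology_map (quotient_complex (corner_complex C) (D_minus C)) n
        (quotient_proj (corner_complex C) (D_minus C) n) (\<phi> z)
      = homology_map (quotient_complex (corner_complex C) (D_minus C)) n
        (quotient_proj (corner_complex C) (D_minus C) n \<circ> h_minus C n) z"
proof -
  note \<phi> = assms(1)[unfolded induced_by_h_minus_def reduced_complex_def reduction_def]
  show "\<phi> z \<in> carrier (homology (corner_complex C) n)" by (rule hom_in_carrier[OF conjunct1[OF \<phi>] z])
  show "homology_map (quotient_complex (corner_complex C) (D_minus C)) n
        (quotient_proj (corner_complex C) (D_minus C) n) (\<phi> z)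
      = homology_map (quotient_complex (corner_complex C) (D_minus C)) n
        (quotient_proj (corner_complex C) (D_minus C) n \<circ> h_minus C n) z"
    by (rule bspec[OF conjunct2[OF conjunct2[OF \<phi>]] z])
qed

section \<open>Naturality with respect to non 1-contracting functors\<close>

context
  fixes C :: "'a omega_cat" and D :: "'b omega_cat" and f :: "'a \<Rightarrow> 'b"
  assumes C: "omega_category C" and lowC: "bd_lowers_dim C"
    and D: "omega_category D" and lowD: "bd_lowers_dim D"
    and f: "omega_functor C D f" and nc: "non_1_contracting C D f"
begin

interpretation C: omega_category C by (rule C)
interpretation D: omega_category D by (rule D)

lemma functor_fixed:
  assumes x: "x \<in> cells C n" and a: "\<alpha> \<in> signs"
  shows "bd D \<alpha> n (f x) = f x"
  using omega_functorD(2)[OF f C.cellsD(1)[OF x] a, of n] C.cellsD(2)[OF x a order_refl] by simp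

lemma functor_cell_dim: "x \<in> cells C n \<Longrightarrow> cell_dim D (f x) \<le> n"
  using functor_fixed by (intro D.cell_dim_le) blast

lemma functor_cells: "x \<in> cells C n \<Longrightarrow> f x \<in> cells D (cell_dim D (f x))"
  using omega_functorD(1)[OF f C.cellsD(1)] by (simp add: cells_def)

lemma functor_cells_low:
  assumes x: "x \<in> cells C n" and n: "n = 0 \<or> n = 1"
  shows "f x \<in> cells D n"
proof (cases "n = 0")
  case True
  then have "cell_dim D (f x) = 0" using functor_cell_dim[OF x] by simp
  then show ?thesis using functor_cells[OF x] True by simp
next
  case False
  then show ?thesis using nc n x by (auto simp: non_1_contracting_def)
qed

text \<open>The initial edges are cells of dimension 1, which \<open>f\<close> keeps
  1-dimensional.\<close>

lemma nerve_map_neg_nerve: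
  assumes x: "x \<in> neg_nerve C n"
  shows "nerve_map n f x \<in> neg_nerve D n"
proof -
  have xn: "x \<in> nerve C n" "proper_initial_edges C n x" using x neg_nerve_iff[OF C] by auto
  note v = nerve_map_nerve[OF f xn(1)]
  have "src D 0 (nerve_map n f x (R {initial_edge n i})) \<noteq> nerve_map n f x (R {initial_edge n i})"
    if i: "i < n" for i
  proof -
    let ?v = "x (R {initial_edge n i})"
    have "?v \<in> cells C 1"
    proof (rule C.cells_1I)
      show "?v \<in> carrier C" by (rule nerve_carrier[OF xn(1)]) simp
      show "bd C \<alpha> 1 ?v = ?v" if "\<alpha> \<in> signs" for \<alpha>
        using nerve_bd_generator_ge[OF xn(1) initial_edge_words that] word_dim_initial_edge[OF i] by simp
      show "src C 0 ?v \<noteq> ?v" using xn(2) i by (simp add: proper_initial_edges_def)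
    qed
    then have "f ?v \<in> cells D 1" using nc by (simp add: non_1_contracting_def)
    then show ?thesis using D.cells_1_src v(2)[OF initial_edge_words] by simp
  qed
  then show ?thesis using v(1) by (simp add: neg_nerve_iff[OF D] proper_initial_edges_def)
qed

lemma nerve_map_box_minus:
  assumes x: "x \<in> cells C n" and fx: "f x \<in> cells D n"
  shows "nerve_map n f (box_minus C n x) = box_minus D n (f x)"
  using nerve_map_globe_cube[OF C D f C.cellsD(1)[OF x]] C.box_minus_cells[OF x] D.box_minus_cells[OF fx]
  by simp

lemma nerve_map_box_minus_contracted:
  assumes x: "x \<in> cells C n" and fx: "f x \<notin> cells D n"
  shows "frag_of (nerve_map n f (box_minus C n x)) \<in> D_minus D n"
proof -
  \<comment> \<open>Dimensions 0 and 1 are preserved, so a collapse occurs only where connections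
    exist.\<close>
  have n01: "\<not> (n = 0 \<or> n = 1)" using functor_cells_low[OF x] fx by blast
  define m where "m = n - 2"
  have n: "n = Suc (Suc m)" using n01 unfolding m_def by arith
  have fc: "f x \<in> carrier D" by (rule omega_functorD(1)[OF f C.cellsD(1)[OF x]])
  have "cell_dim D (f x) \<noteq> n" using functor_cells[OF x] fx by auto
  then have le: "cell_dim D (f x) \<le> Suc m" using functor_cell_dim[OF x] n by simp
  have "bd D \<alpha> (Suc m) (f x) = f x" if "\<alpha> \<in> signs" for \<alpha>
    by (rule D.cellsD(2)[OF functor_cells[OF x] that le])
  then have eq: "globe_cube D n (f x) = connection D (Suc m) (Suc m) (globe_cube D (Suc m) (f x))"
    unfolding n by (rule globe_cube_connection[OF D fc])
  have "globe_cube D (Suc m) (f x) \<in> neg_nerve D (Suc m)"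
  proof (rule globe_cube_neg_nerve[OF D fc])
    fix \<beta> :: int assume b: "\<beta> \<in> signs"
    have "bd C \<beta> 1 x \<in> cells C 1" by (rule C.cells_bd_1[OF lowC x[unfolded n] b])
    then have "f (bd C \<beta> 1 x) \<in> cells D 1" by (rule functor_cells_low) simp
    then show "src D 0 (bd D \<beta> 1 (f x)) \<noteq> bd D \<beta> 1 (f x)"
      using D.cells_1_src omega_functorD(2)[OF f C.cellsD(1)[OF x] b] by metis
  qed
  then have "globe_cube D n (f x) \<in> connections D (Suc m) (Suc m)"
    unfolding eq connections_def by blast
  then show ?thesis
    using nerve_map_globe_cube[OF C D f C.cellsD(1)[OF x], of n] C.box_minus_cells[OF x]
    by (simp add: n D_minus_Suc[OF D] del: box_minus.simps)
qed

lemma corner_map_hom: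
  "corner_map n f \<in> hom (grp (corner_complex C) n) (grp (corner_complex D) n)"
  unfolding corner_map_def grp_corner_complex using nerve_map_neg_nerve by (intro frag_extend_hom) simp

lemma chain_map_corner_map: "chain_map (corner_complex C) (corner_complex D) (\<lambda>n. corner_map n f)"
  unfolding chain_map_def
proof (intro conjI allI ballI corner_map_hom)
  fix n c assume "c \<in> carrier (grp (corner_complex C) (Suc n))"
  then have "c \<in> frags (neg_nerve C (Suc n))" by (simp add: grp_corner_complex frags_def)
  then show "corner_map n f (bdry (corner_complex C) (Suc n) c)
    = bdry (corner_complex D) (Suc n) (corner_map (Suc n) f c)"
    unfolding corner_map_def bdry_corner_complex
  proof (induction rule: frags_induct)
    case (one x)
    then have x: "x \<in> nerve C (Suc n)" by (simp add: neg_nerve_def)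
    have "frag_extend (\<lambda>x. frag_of (nerve_map n f x)) (corner_bd C (Suc n) x)
      = (\<Sum>i<Suc n. frag_cmul ((-1) ^ i) (frag_of (nerve_map n f (face C (Suc n) (Suc i) (-1) x))))"
      unfolding corner_bd_def by (subst frag_extend_sum) (simp_all add: frag_extend_cmul del: sum.lessThan_Suc)
    also have "\<dots> = corner_bd D (Suc n) (nerve_map (Suc n) f x)"
      unfolding corner_bd_def using nerve_map_face[OF f x] by (intro sum.cong) auto
    finally show ?case by simp
  qed (simp_all add: frag_extend_diff)
qed

lemma corner_map_D_minus:
  assumes c: "c \<in> D_minus C n"
  shows "corner_map n f c \<in> D_minus D n"
proof (cases n)
  case 0
  then show ?thesis using c by (simp add: D_minus_0[OF C] D_minus_0[OF D] corner_map_def)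
next
  case (Suc m)
  have "nerve_map (Suc m) f x \<in> connections D m m" if x: "x \<in> connections C m m" for x
  proof -
    obtain i y where y: "x = connection C m (Suc i) y" "i < m" "y \<in> neg_nerve C m"
      using x by (auto simp: connections_def)
    have "y \<in> nerve C m" using y(3) by (simp add: neg_nerve_def)
    then have "nerve_map (Suc m) f x = connection D m (Suc i) (nerve_map m f y)"
      unfolding y(1) using nerve_map_connection[OF f _ y(2)] by simp
    then show ?thesis using y(2) nerve_map_neg_nerve[OF y(3)] unfolding connections_def by blast
  qed
  then show ?thesis using c unfolding Suc D_minus_Suc[OF C] D_minus_Suc[OF D] corner_map_def
    by (auto elim!: frags_extend)
qed

lemma gl_map_pair:
  "gl_map D n f c = (let g = frag_extend (\<lambda>x. if cell_dim D (f x) = n then frag_of (f x) else 0)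
    in (g (fst c), g (snd c)))"
  by (cases c) (simp add: gl_map_def Let_def)

lemma gl_map_hom: "gl_map D n f \<in> hom (grp (gl_complex C) n) (grp (gl_complex D) n)"
proof (rule homI)
  have gen: "(if cell_dim D (f x) = n then frag_of (f x) else 0) \<in> frags (cells D n)" if "x \<in> cells C n" for x
    using functor_cells[OF that] by auto
  fix c assume c: "c \<in> carrier (grp (gl_complex C) n)"
  then have "fst c \<in> frags (cells C n)" "snd c \<in> frags (if n = 0 then cells C n else {})"
    by (auto simp: carrier_gl_complex)
  then show "gl_map D n f c \<in> carrier (grp (gl_complex D) n)"
    using gen by (cases "n = 0") (auto simp: carrier_gl_complex gl_map_pair Let_def elim!: frags_extend)
  fix d
  show "gl_map D n f (c \<otimes>\<^bsub>grp (gl_complex C) n\<^esub> d)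
    = gl_map D n f c \<otimes>\<^bsub>grp (gl_complex D) n\<^esub> gl_map D n f d"
    by (simp add: grp_gl_complex gl_map_pair Let_def mult_DirProd' frag_extend_add)
qed

lemma chain_map_gl_map: "chain_map (gl_complex C) (gl_complex D) (\<lambda>n. gl_map D n f)"
  unfolding chain_map_def
proof (intro conjI allI ballI gl_map_hom)
  fix n c assume "c \<in> carrier (grp (gl_complex C) (Suc n))"
  then have fc: "fst c \<in> frags (cells C (Suc n))" by (auto simp: carrier_gl_complex)
  let ?g = "\<lambda>n. frag_extend (\<lambda>x. if cell_dim D (f x) = n then frag_of (f x) else 0)"
  have cn: "bd C \<alpha> n x \<in> cells C n" "f (bd C \<alpha> n x) = bd D \<alpha> n (f x)"
    if "x \<in> cells C (Suc n)" "\<alpha> \<in> signs" for x \<alpha> n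
    using C.cells_bd[OF lowC that, of n] omega_functorD(2)[OF f C.cellsD(1)[OF that(1)] that(2)] by auto
  show "gl_map D n f (bdry (gl_complex C) (Suc n) c) = bdry (gl_complex D) (Suc n) (gl_map D (Suc n) f c)"
  proof (cases n)
    case 0
    have gen: "?g 0 (frag_of (bd C \<alpha> 0 x)) = frag_extend (\<lambda>x. frag_of (bd D \<alpha> 0 x)) (?g 1 (frag_of x))"
      if x: "x \<in> cells C 1" and a: "\<alpha> \<in> signs" for x \<alpha>
      using functor_cells_low[OF x] functor_cells_low[OF cn(1)[OF x[unfolded One_nat_def] a]]
        cn(2)[OF x[unfolded One_nat_def] a] by (simp add: cells_def)
    have "?g 0 (frag_extend (\<lambda>x. frag_of (bd C \<alpha> 0 x)) (fst c))
      = frag_extend (\<lambda>x. frag_of (bd D \<alpha> 0 x)) (?g 1 (fst c))" if "\<alpha> \<in> signs" for \<alpha>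
      using fc[unfolded 0 One_nat_def[symmetric]]
    proof (induction rule: frags_induct)
      case (one x)
      then show ?case using gen[OF one that] by simp
    qed (simp_all add: frag_extend_diff)
    from this[of "-1"] this[of 1] show ?thesis
      by (simp add: 0 bdry_gl_complex[unfolded One_nat_def] gl_map_pair Let_def)
  next
    case (Suc m)
    let ?d = "\<lambda>E x. frag_of (src E (Suc m) x) - frag_of (tgt E (Suc m) x)"
    have "?g (Suc m) (frag_extend (?d C) (fst c)) = frag_extend (?d D) (?g (Suc (Suc m)) (fst c))"
      using fc[unfolded Suc]
    proof (induction rule: frags_induct)
      case (one x)
      have s: "(-1::int) \<in> signs" "(1::int) \<in> signs" by auto
      have fs: "f (src C (Suc m) x) = src D (Suc m) (f x)" "f (tgt C (Suc m) x) = tgt D (Suc m) (f x)"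
        using cn(2)[OF one] by auto
      show ?case
      proof (cases "cell_dim D (f x) = Suc (Suc m)")
        case True
        then have "f x \<in> cells D (Suc (Suc m))" using functor_cells[OF one] by simp
        then have "src D (Suc m) (f x) \<in> cells D (Suc m)" "tgt D (Suc m) (f x) \<in> cells D (Suc m)"
          using lowD by (auto simp: bd_lowers_dim_def)
        then show ?thesis using True fs by (simp add: frag_extend_diff cells_def)
      next
        case False
        then have le: "cell_dim D (f x) \<le> Suc m" using functor_cell_dim[OF one] by simp
        \<comment> \<open>A collapsed cell has equal source and target, so its two boundary terms
          cancel, in accordance with its image 0.\<close>
        have "src D (Suc m) (f x) = f x" "tgt D (Suc m) (f x) = f x"
          using D.cellsD(2)[OF functor_cells[OF one] _ le] by auto
        then show ?thesis using False fs by (simp add: frag_extend_diff)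
      qed
    qed (simp_all add: frag_extend_diff)
    then show ?thesis by (simp add: Suc bdry_gl_complex gl_map_pair Let_def)
  qed
qed

lemma corner_map_h_minus:
  assumes c: "c \<in> carrier (grp (gl_complex C) n)"
  shows "corner_map n f (h_minus C n c) - h_minus D n (gl_map D n f c) \<in> D_minus D n"
proof -
  have fc: "fst c \<in> frags (cells C n)" using c by (auto simp: carrier_gl_complex)
  have "corner_map n f (frag_extend (\<lambda>x. frag_of (box_minus C n x)) (fst c))
    - frag_extend (\<lambda>x. frag_of (box_minus D n x))
        (frag_extend (\<lambda>x. if cell_dim D (f x) = n then frag_of (f x) else 0) (fst c)) \<in> D_minus D n"
    unfolding corner_map_def using fc
  proof (induction rule: frags_induct)
    case zero
    then show ?case using D_minus_zero[OF D] by simp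
  next
    case (one x)
    show ?case
    proof (cases "cell_dim D (f x) = n")
      case True
      then show ?thesis
        using functor_cells[OF one] nerve_map_box_minus[OF one] D_minus_zero[OF D]
        by (simp del: box_minus.simps)
    next
      case False
      then have "f x \<notin> cells D n" by (simp add: cells_def)
      then show ?thesis using nerve_map_box_minus_contracted[OF one] False by (simp del: box_minus.simps)
    qed
  next
    case (diff a b)
    have eq: "(p - q) - (r - t) = (p - r) - (q - t)" for p q r t :: "'b cube \<Rightarrow>\<^sub>0 int" by simp
    show ?case using D_minus_diff[OF D diff] unfolding frag_extend_diff eq .
  qed
  then show ?thesis by (simp add: h_minus_def gl_map_pair Let_def)
qed

lemma reduction_natural:
  assumes c: "c \<in> carrier (grp (gl_complex C) n)"
  shows "reduction D n (h_minus D n (gl_map D n f c)) = reduction D n (corner_map n f (h_minus C n c))"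
  using reduction_eq_iff[OF D
      hom_in_carrier[OF corner_map_hom h_minus_closed[OF C lowC c]]
      h_minus_closed[OF D lowD hom_in_carrier[OF gl_map_hom c]]]
    corner_map_h_minus[OF c] by simp

lemma induced_by_h_minus_natural:
  assumes \<phi>: "induced_by_h_minus C n \<phi>" and \<psi>: "induced_by_h_minus D n \<psi>"
    and z: "z \<in> carrier (homology (gl_complex C) n)"
  shows "homology_map (corner_complex D) n (corner_map n f) (\<phi> z)
    = \<psi> (homology_map (gl_complex D) n (gl_map D n f) z)"
proof -
  interpret PC: lifted_chain_map "gl_complex C" "corner_complex C" "D_minus C" "h_minus C"
    by (rule lifted_chain_map_h_minus[OF C lowC])
  interpret PD: lifted_chain_map "gl_complex D" "corner_complex D" "D_minus D" "h_minus D"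
    by (rule lifted_chain_map_h_minus[OF D lowD])
  obtain c where c: "c \<in> cycles (gl_complex C) n"
    "z = boundaries (gl_complex C) n #>\<^bsub>grp (gl_complex C) n\<^esub> c"
    using z by (auto simp: PC.K.carrier_homology)
  note cc = PC.K.cycles_carrier[OF c(1)]
  obtain l where l: "PC.lifts n c l" using PC.lifts_exists[OF c(1)] by blast
  note \<phi>z = induced_by_h_minusD[OF \<phi> z]
  have "\<phi> z = boundaries (corner_complex C) n #>\<^bsub>grp (corner_complex C) n\<^esub> l"
    using PC.induced_value[OF _ \<phi>z(1) l] \<phi>z(2) c(2) by simp
  moreover have lc: "l \<in> cycles (corner_complex C) n" using l by (simp add: PC.lifts_def)
  ultimately have left: "homology_map (corner_complex D) n (corner_map n f) (\<phi> z)
    = boundaries (corner_complex D) n #>\<^bsub>grp (corner_complex D) n\<^esub> corner_map n f l"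
    using homology_map_coset[OF PC.L.chain_complex_axioms PD.L.chain_complex_axioms chain_map_corner_map
        PC.L.cycles_carrier[OF lc]] by simp
  let ?z = "homology_map (gl_complex D) n (gl_map D n f) z"
  have zD: "?z = boundaries (gl_complex D) n #>\<^bsub>grp (gl_complex D) n\<^esub> gl_map D n f c"
    using homology_map_coset[OF PC.K.chain_complex_axioms PD.K.chain_complex_axioms chain_map_gl_map cc] c(2) by simp
  have gc: "gl_map D n f c \<in> cycles (gl_complex D) n"
    using chain_map_cycles[OF PC.K.chain_complex_axioms PD.K.chain_complex_axioms chain_map_gl_map c(1)] by simp
  have "PD.lifts n (gl_map D n f c) (corner_map n f l)"
  proof -
    obtain d b where d: "d \<in> D_minus C n" and b: "b \<in> boundaries (corner_complex C) n"
      and leq: "l = d + (b + h_minus C n c)"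
      using l by (auto simp: PC.lifts_def grp_corner_complex)
    have "corner_map n f b \<in> boundaries (corner_complex D) n"
      using chain_map_boundaries[OF chain_map_corner_map, of n] b by blast
    \<comment> \<open>The component in \<open>D_minus\<close> of the new lift: the image of
      \<open>d\<close> plus the failure of \<open>h_minus\<close> to commute with
      \<open>f\<close>.\<close>
    moreover have "corner_map n f d + (corner_map n f (h_minus C n c) - h_minus D n (gl_map D n f c)) \<in> D_minus D n"
      (is "?d \<in> _")
      using corner_map_D_minus[OF d] corner_map_h_minus[OF cc] by (simp add: D_minus_frags[OF D] frags_add)
    moreover have "corner_map n f l = ?d + (corner_map n f b + h_minus D n (gl_map D n f c))"
      unfolding leq by (simp add: corner_map_def frag_extend_add)
    moreover have "corner_map n f l \<in> cycles (corner_complex D) n"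
      using chain_map_cycles[OF PC.L.chain_complex_axioms PD.L.chain_complex_axioms chain_map_corner_map lc] by simp
    ultimately show ?thesis using gc unfolding PD.lifts_def grp_corner_complex mult_free_Abelian_group by blast
  qed
  moreover have zc: "?z \<in> carrier (homology (gl_complex D) n)" using gc zD by (auto simp: PD.K.carrier_homology)
  note \<psi>z = induced_by_h_minusD[OF \<psi> zc]
  ultimately have "\<psi> ?z = boundaries (corner_complex D) n #>\<^bsub>grp (corner_complex D) n\<^esub> corner_map n f l"
    using PD.induced_value[OF _ \<psi>z(1)] zD by simp
  then show ?thesis using left by simp
qed

end

theorem corollary7p5:
  fixes C :: "'a omega_cat"
  assumes "omega_category C" and "bd_lowers_dim C"
  shows
    "(\<forall>n. h_minus C n \<in> hom (grp (gl_complex C) n) (grp (corner_complex C) n)) \<and>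
     chain_map (gl_complex C) (reduced_complex C) (\<lambda>n. reduction C n \<circ> h_minus C n) \<and>
     (\<forall>n. \<exists>!\<phi>. induced_by_h_minus C n \<phi>) \<and>
     (\<forall>(D :: 'b omega_cat) f.
        omega_category D \<longrightarrow> bd_lowers_dim D \<longrightarrow>
        omega_functor C D f \<longrightarrow> non_1_contracting C D f \<longrightarrow>
        (\<forall>n. \<forall>x \<in> cells C n. f x \<in> cells D n \<longrightarrow>
          nerve_map n f (box_minus C n x) = box_minus D n (f x)) \<and>
        (\<forall>n. \<forall>c \<in> carrier (grp (gl_complex C) n).
          reduction D n (h_minus D n (gl_map D n f c)) =
          reduction D n (corner_map n f (h_minus C n c))) \<and>
        (\<forall>n \<phi> \<psi>. induced_by_h_minus C n \<phi> \<longrightarrow> induced_by_h_minus D n \<psi> \<longrightarrow>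
          (\<forall>z \<in> carrier (homology (gl_complex C) n).
            homology_map (corner_complex D) n (corner_map n f) (\<phi> z) =
            \<psi> (homology_map (gl_complex D) n (gl_map D n f) z))))"
proof (intro conjI allI impI ballI)
  interpret P: lifted_chain_map "gl_complex C" "corner_complex C" "D_minus C" "h_minus C"
    by (rule lifted_chain_map_h_minus[OF assms])
  fix n
  show "h_minus C n \<in> hom (grp (gl_complex C) n) (grp (corner_complex C) n)" by (rule P.h_hom)
  show "chain_map (gl_complex C) (reduced_complex C) (\<lambda>n. reduction C n \<circ> h_minus C n)"
    unfolding reduced_complex_def reduction_def by (rule P.h_chain_map)
  show "\<exists>!\<phi>. induced_by_h_minus C n \<phi>"
    unfolding induced_by_h_minus_def reduced_complex_def reduction_def by (rule P.ex1_induced)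
next
  fix D :: "'b omega_cat" and f
  assume D: "omega_category D" "bd_lowers_dim D" "omega_functor C D f" "non_1_contracting C D f"
  note CD = assms D
  fix n
  show "nerve_map n f (box_minus C n x) = box_minus D n (f x)" if "x \<in> cells C n" "f x \<in> cells D n" for x
    by (rule nerve_map_box_minus[OF CD that])
  show "reduction D n (h_minus D n (gl_map D n f c)) = reduction D n (corner_map n f (h_minus C n c))"
    if "c \<in> carrier (grp (gl_complex C) n)" for c
    by (rule reduction_natural[OF CD that])
  show "homology_map (corner_complex D) n (corner_map n f) (\<phi> z)
      = \<psi> (homology_map (gl_complex D) n (gl_map D n f) z)"
    if "induced_by_h_minus C n \<phi>" "induced_by_h_minus D n \<psi>" "z \<in> carrier (homology (gl_complex C) n)" for \<phi> \<psi> z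
    by (rule induced_by_h_minus_natural[OF CD that])
qed

end
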